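(* Let $\Omega\subset\mathbb{R}^N$ be a bounded open set with Lipschitz boundary. For every $k\in\mathbb{N}$, $\lim_{s\to0^+}\frac{\lambda_{k,s}(\Omega)-1}{s}=\lambda_{k,L}(\Omega)$. Moreover, if $(s_n)_n\subset(0,1)$ with $s_n\to0$ and $\phi_{k,s_n}$ is an $L^2$-normalized Dirichlet eigenfunction of $(-\Delta)^{s_n}$ in $\Omega$ corresponding to $\lambda_{k,s_n}(\Omega)$, then after passing to a subsequence $\phi_{k,s_n}\to\phi_{k,L}$ in $L^2(\Omega)$ as $n\to\infty$, where $\phi_{k,L}$ is an $L^2$-normalized Dirichlet eigenfunction of the logarithmic Laplacian in $\Omega$ corresponding to $\lambda_{k,L}(\Omega)$.
   Context: For $s\in(0,1)$: $C_{N,s}=s4^s\frac{\Gamma(\frac N2+s)}{\pi^{N/2}\Gamma(1-s)}$, $\mathcal{H}^s_0(\Omega)=\{u\in H^s(\mathbb{R}^N): u\equiv0\text{ on }\mathbb{R}^N\setminus\Omega\}$, $\mathcal{E}_s(u,v)=\frac{C_{N,s}}2\iint\frac{(u(x)-u(y))(v(x)-v(y))}{|x-y|^{N+2s}}dxdy$; Dirichlet eigenfunctions of $(-\Delta)^s$: $\phi\in\mathcal{H}^s_0(\Omega)\setminus\{0\}$ with $\mathcal{E}_s(\phi,v)=\lambda\int_\Omega\phi v$ for all $v\in\mathcal{H}^s_0(\Omega)$; $\lambda_{k,s}(\Omega)$ is the $k$-th eigenvalue counted with multiplicity. Logarithmic Laplacian: $C_N=\pi^{-N/2}\Gamma(\frac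 N2)$, $\rho_N=2\log2+\psi(\frac N2)-\gamma$, $\mathcal{H}^0_0(\Omega)=\{u\in L^2(\mathbb{R}^N): u\equiv0\text{ off }\Omega,\ \iint_{|x-y|<1}\frac{(u(x)-u(y))^2}{|x-y|^N}<\infty\}$, $\mathcal{E}_L(u,v)=\frac{C_N}2\iint_{|x-y|<1}\frac{(u(x)-u(y))(v(x)-v(y))}{|x-y|^N}-C_N\iint_{|x-y|\ge1}\frac{u(x)v(y)}{|x-y|^N}+\rho_N\int uv$; Dirichlet eigenfunctions: $\phi\in\mathcal{H}^0_0(\Omega)\setminus\{0\}$ with $\mathcal{E}_L(\phi,v)=\lambda\int_\Omega\phi v$ for all $v\in\mathcal{H}^0_0(\Omega)$; $\lambda_{k,L}(\Omega)$ is the $k$-th eigenvalue counted with multiplicity. *)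

theory Defs
  imports "HOL-Analysis.Analysis"
begin

text \<open>Ambient space: R^N is an arbitrary euclidean space 'a, with N = DIM('a).
Functions are real valued, Borel measurable, and considered up to a.e. equality.\<close>

definition dimN :: "'a::euclidean_space itself \<Rightarrow> real" where
  "dimN _ = real DIM('a)"

text \<open>Lipschitz boundary: near every boundary point, after a choice of a unit direction e
(the rotated N-th axis), Omega is the region below the graph of a Lipschitz function g
defined on the hyperplane orthogonal to e.\<close>
definition lipschitz_boundary :: "'a::euclidean_space set \<Rightarrow> bool" where
  "lipschitz_boundary \<Omega> \<longleftrightarrow>
     (\<forall>x\<in>frontier \<Omega>. \<exists>r>0. \<exists>e::'a. \<exists>g::'a \<Rightarrow> real. \<exists>L.
        norm e = 1 \<and> L-lipschitz_on {z. z \<bullet> e = 0} g \<and>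
        \<Omega> \<inter> ball x r = {y\<in>ball x r. y \<bullet> e < g (y - (y \<bullet> e) *\<^sub>R e)})"

definition L2 :: "('a::euclidean_space \<Rightarrow> real) set" where
  "L2 = {u. u \<in> borel_measurable lborel \<and> integrable lborel (\<lambda>x. (u x)\<^sup>2)}"

definition vanishes_off :: "'a::euclidean_space set \<Rightarrow> ('a \<Rightarrow> real) \<Rightarrow> bool" where
  "vanishes_off \<Omega> u \<longleftrightarrow> (AE x in lborel. x \<notin> \<Omega> \<longrightarrow> u x = 0)"

definition C_Ns :: "'a::euclidean_space itself \<Rightarrow> real \<Rightarrow> real" where
  "C_Ns T s = s * 4 powr s * Gamma (dimN T / 2 + s) / (pi powr (dimN T / 2) * Gamma (1 - s))"

definition Hs :: "real \<Rightarrow> ('a::euclidean_space \<Rightarrow> real) set" where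
  "Hs s = {u\<in>L2. (\<integral>\<^sup>+ x. \<integral>\<^sup>+ y. ennreal ((u x - u y)\<^sup>2 / norm (x - y) powr (real DIM('a) + 2 * s))
                 \<partial>lborel \<partial>lborel) < \<infinity>}"

definition Hs0 :: "real \<Rightarrow> 'a::euclidean_space set \<Rightarrow> ('a \<Rightarrow> real) set" where
  "Hs0 s \<Omega> = {u\<in>Hs s. vanishes_off \<Omega> u}"

definition Es :: "real \<Rightarrow> ('a::euclidean_space \<Rightarrow> real) \<Rightarrow> ('a \<Rightarrow> real) \<Rightarrow> real" where
  "Es s u v = C_Ns TYPE('a) s / 2 *
     integral\<^sup>L (lborel \<Otimes>\<^sub>M lborel)
       (\<lambda>(x,y). (u x - u y) * (v x - v y) / norm (x - y) powr (real DIM('a) + 2 * s))"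

definition frac_eigenpair :: "real \<Rightarrow> 'a::euclidean_space set \<Rightarrow> ('a \<Rightarrow> real) \<Rightarrow> real \<Rightarrow> bool" where
  "frac_eigenpair s \<Omega> \<phi> lam \<longleftrightarrow> \<phi> \<in> Hs0 s \<Omega> \<and> \<not> (AE x in lborel. \<phi> x = 0) \<and>
     (\<forall>v\<in>Hs0 s \<Omega>. Es s \<phi> v = lam * (LINT x:\<Omega>|lborel. \<phi> x * v x))"

definition C_N :: "'a::euclidean_space itself \<Rightarrow> real" where
  "C_N T = pi powr (- dimN T / 2) * Gamma (dimN T / 2)"

definition rho_N :: "'a::euclidean_space itself \<Rightarrow> real" where
  "rho_N T = 2 * ln 2 + Digamma (dimN T / 2) - euler_mascheroni"

definition H00 :: "'a::euclidean_space set \<Rightarrow> ('a \<Rightarrow> real) set" where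
  "H00 \<Omega> = {u\<in>L2. vanishes_off \<Omega> u \<and>
     (\<integral>\<^sup>+ x. \<integral>\<^sup>+ y. ennreal (indicator {p. norm (fst p - snd p) < 1} (x, y) *
         (u x - u y)\<^sup>2 / norm (x - y) powr real DIM('a)) \<partial>lborel \<partial>lborel) < \<infinity>}"

definition EL :: "('a::euclidean_space \<Rightarrow> real) \<Rightarrow> ('a \<Rightarrow> real) \<Rightarrow> real" where
  "EL u v =
     C_N TYPE('a) / 2 * integral\<^sup>L (lborel \<Otimes>\<^sub>M lborel)
       (\<lambda>(x,y). indicator {p. norm (fst p - snd p) < 1} (x, y) *
          ((u x - u y) * (v x - v y) / norm (x - y) powr real DIM('a)))
     - C_N TYPE('a) * integral\<^sup>L (lborel \<Otimes>\<^sub>M lborel)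
       (\<lambda>(x,y). indicator {p. norm (fst p - snd p) \<ge> 1} (x, y) *
          (u x * v y / norm (x - y) powr real DIM('a)))
     + rho_N TYPE('a) * (\<integral>x. u x * v x \<partial>lborel)"

definition log_eigenpair :: "'a::euclidean_space set \<Rightarrow> ('a \<Rightarrow> real) \<Rightarrow> real \<Rightarrow> bool" where
  "log_eigenpair \<Omega> \<phi> lam \<longleftrightarrow> \<phi> \<in> H00 \<Omega> \<and> \<not> (AE x in lborel. \<phi> x = 0) \<and>
     (\<forall>v\<in>H00 \<Omega>. EL \<phi> v = lam * (LINT x:\<Omega>|lborel. \<phi> x * v x))"

text \<open>k-th eigenvalue counted with multiplicity (k \<ge> 1), for an eigenvalue predicate P:
the least t such that there are k L^2-orthonormal eigenfunctions with eigenvalues \<le> t.\<close>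
definition L2_orthonormal :: "('a::euclidean_space \<Rightarrow> real) set \<Rightarrow> bool" where
  "L2_orthonormal F \<longleftrightarrow> (\<forall>f\<in>F. \<forall>g\<in>F.
      (\<integral>x. f x * g x \<partial>lborel) = (if f = g then 1 else 0))"

definition kth_eigenvalue :: "(('a::euclidean_space \<Rightarrow> real) \<Rightarrow> real \<Rightarrow> bool) \<Rightarrow> nat \<Rightarrow> real" where
  "kth_eigenvalue P k = Inf {t. \<exists>F. finite F \<and> card F = k \<and> L2_orthonormal F \<and>
                                  (\<forall>f\<in>F. \<exists>lam\<le>t. P f lam)}"

definition lambda_ks :: "nat \<Rightarrow> real \<Rightarrow> 'a::euclidean_space set \<Rightarrow> real" where
  "lambda_ks k s \<Omega> = kth_eigenvalue (frac_eigenpair s \<Omega>) k"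

definition lambda_kL :: "nat \<Rightarrow> 'a::euclidean_space set \<Rightarrow> real" where
  "lambda_kL k \<Omega> = kth_eigenvalue (log_eigenpair \<Omega>) k"

end

theory Submission
  imports Defs "HOL-Complex_Analysis.Great_Picard" "HOL-Library.Diagonal_Subsequence"
begin

text \<open>Write \<open>E\<^sub>s(u,v) = \<langle>u,v\<rangle> + s Q\<^sub>s(u,v)\<close>. Separating the near part \<open>|x - y| < 1\<close> from the far part of
  the kernel shows that \<open>Q\<^sub>s\<close> has the same shape for all \<open>s \<ge> 0\<close>, with \<open>Q\<^sub>0 = E\<^sub>L\<close>, and
  \<open>(\<lambda>\<^sub>k\<^sub>,\<^sub>s - 1) / s\<close> is the \<open>k\<close>-th eigenvalue of \<open>Q\<^sub>s\<close>. The forms \<open>Q\<^sub>s\<close> Gamma-converge to \<open>Q\<^sub>0\<close>: lower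
  semicontinuity is Fatou's lemma, and \<open>Q\<^sub>s \<rightarrow> Q\<^sub>0\<close> pointwise on Lipschitz functions vanishing off \<open>\<Omega>\<close>.
  Since \<open>|z| powr (-N)\<close> is not integrable at the origin, convolution with normalised truncations of it
  approximates the identity uniformly on sets of bounded near energy, which gives compactness.
  The Lipschitz functions are dense in the domain of \<open>Q\<^sub>0\<close> (truncate, cut off at distance
  \<open>\<delta>\<close> from the boundary, mollify); the Lipschitz boundary enters only through the volume
  \<open>O(\<delta>)\<close> of the boundary strip. Min-max arguments then transfer to eigenvalues and eigenfunctions.\<close>

section \<open>Square-integrable functions\<close>

text \<open>The obstacle is that the form domains shrink as \<open>s\<close> grows: a function of
  \<open>Dom \<Omega> 0\<close> need not lie in \<open>Dom \<Omega> s\<close> for any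
  \<open>s > 0\<close>, so limit eigenfunctions cannot serve as trial functions for
  \<open>Qf s\<close>. The Lipschitz functions, which lie in the domain for every
  \<open>s \<le> 1/2\<close>, replace them, and the density theorem is the price. In the other
  direction the near kernel increases with \<open>s\<close>, so a bound on the near energy at any
  \<open>s\<close> is one at \<open>s = 0\<close>, and a single compactness theorem serves all
  parameters. The far part and the zeroth-order term are bounded on L2 uniformly in
  \<open>s\<close>, since \<Omega> has finite volume; for semiboundedness they cost only a shift by
  a constant \<open>M\<close>. The abstract hypotheses let the parameter vary along a sequence:
  constant sequences give the spectrum of each single form, null sequences its limit. The
  eigenvalues of the statement are defined by orthonormal eigenfunctions, not by min-max. A
  dimension count reconciles the two: \<open>k + 1\<close> orthonormal functions have a nonzero
  combination orthogonal to any \<open>k\<close> given ones.\<close>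

definition ip :: "('a::euclidean_space \<Rightarrow> real) \<Rightarrow> ('a \<Rightarrow> real) \<Rightarrow> real" where
  "ip f g = (\<integral>x. f x * g x \<partial>lborel)"

text \<open>The squared distance of \<open>f\<close> and \<open>g\<close> in the seminorm of the
  form \<open>F\<close>; working with squares keeps roots out of the limit statements.\<close>

abbreviation (input) on_diff where
  "on_diff F f g \<equiv> F (\<lambda>x. f x - g x) (\<lambda>x. f x - g x)"

definition L2_lim :: "(nat \<Rightarrow> 'a::euclidean_space \<Rightarrow> real) \<Rightarrow> ('a \<Rightarrow> real) \<Rightarrow> bool" where
  "L2_lim u v \<longleftrightarrow> (\<lambda>n. on_diff ip (u n) v) \<longlonglongrightarrow> 0"

lemma L2_measurable [measurable_dest]: "f \<in> L2 \<Longrightarrow> f \<in> borel_measurable borel"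
  by (simp add: L2_def)

lemma L2_mult_integrable:
  assumes "f \<in> L2" "g \<in> L2"
  shows "integrable lborel (\<lambda>x. f x * g x)"
proof (rule Bochner_Integration.integrable_bound)
  show "integrable lborel (\<lambda>x. (f x)\<^sup>2 + (g x)\<^sup>2)"
    using assms by (auto simp: L2_def)
  show "(\<lambda>x. f x * g x) \<in> borel_measurable lborel"
    using assms by (auto simp: L2_def)
  show "AE x in lborel. norm (f x * g x) \<le> norm ((f x)\<^sup>2 + (g x)\<^sup>2)"
  proof (rule AE_I2)
    fix x
    have "2 * \<bar>f x * g x\<bar> \<le> (f x)\<^sup>2 + (g x)\<^sup>2"
      using sum_squares_bound[of "\<bar>f x\<bar>" "\<bar>g x\<bar>"] by (simp add: abs_mult)
    then show "norm (f x * g x) \<le> norm ((f x)\<^sup>2 + (g x)\<^sup>2)" by simp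
  qed
qed

lemma L2_lin:
  assumes "f \<in> L2" "g \<in> L2"
  shows "(\<lambda>x. a * f x + b * g x) \<in> L2"
proof -
  have "integrable lborel (\<lambda>x. a\<^sup>2 * (f x)\<^sup>2 + 2 * a * b * (f x * g x) + b\<^sup>2 * (g x)\<^sup>2)"
    using assms L2_mult_integrable[OF assms] by (auto simp: L2_def)
  then have "integrable lborel (\<lambda>x. (a * f x + b * g x)\<^sup>2)"
    by (rule Bochner_Integration.integrable_cong[THEN iffD1, rotated -1])
      (auto simp: power2_eq_square algebra_simps)
  then show ?thesis using assms by (auto simp: L2_def)
qed

lemma L2_zero: "(\<lambda>x. 0) \<in> L2" by (simp add: L2_def)

lemma L2_diff: "f \<in> L2 \<Longrightarrow> g \<in> L2 \<Longrightarrow> (\<lambda>x. f x - g x) \<in> L2"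
  using L2_lin[of f g 1 "-1"] by simp

lemma ip_commute: "ip f g = ip g f"
  by (simp add: ip_def mult.commute)

lemma ip_lin:
  assumes "f \<in> L2" "g \<in> L2" "h \<in> L2"
  shows "ip (\<lambda>x. a * f x + b * g x) h = a * ip f h + b * ip g h"
proof -
  have "ip (\<lambda>x. a * f x + b * g x) h = (\<integral>x. a * (f x * h x) + b * (g x * h x) \<partial>lborel)"
    by (simp add: ip_def algebra_simps)
  also have "\<dots> = a * ip f h + b * ip g h"
    unfolding ip_def using assms L2_mult_integrable by (subst Bochner_Integration.integral_add) auto
  finally show ?thesis .
qed

lemma ip_nonneg: "0 \<le> ip f f"
  by (simp add: ip_def)

section \<open>Symmetric forms\<close>

text \<open>Form domains are sets of functions that vary with the parameter, not types, so linearity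
  is relative to \<open>D\<close>. One axiom for general linear combinations covers sums,
  differences and multiples at once.\<close>

locale sym_form =
  fixes D :: "('a::euclidean_space \<Rightarrow> real) set" and Q :: "('a \<Rightarrow> real) \<Rightarrow> ('a \<Rightarrow> real) \<Rightarrow> real"
  assumes zero: "(\<lambda>x. 0) \<in> D"
    and lin: "f \<in> D \<Longrightarrow> g \<in> D \<Longrightarrow> (\<lambda>x. a * f x + b * g x) \<in> D"
    and sym: "f \<in> D \<Longrightarrow> g \<in> D \<Longrightarrow> Q f g = Q g f"
    and Q_lin: "f \<in> D \<Longrightarrow> g \<in> D \<Longrightarrow> h \<in> D \<Longrightarrow>
                  Q (\<lambda>x. a * f x + b * g x) h = a * Q f h + b * Q g h"
begin

lemma Q_lin2: "f \<in> D \<Longrightarrow> g \<in> D \<Longrightarrow> h \<in> D \<Longrightarrow>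
    Q h (\<lambda>x. a * f x + b * g x) = a * Q h f + b * Q h g"
  using Q_lin[of f g h a b] sym[of h] lin[of f g a b] by simp

lemma diff: "f \<in> D \<Longrightarrow> g \<in> D \<Longrightarrow> (\<lambda>x. f x - g x) \<in> D"
  using lin[of f g 1 "-1"] by simp

lemma Q_diff: "f \<in> D \<Longrightarrow> g \<in> D \<Longrightarrow> h \<in> D \<Longrightarrow> Q (\<lambda>x. f x - g x) h = Q f h - Q g h"
  using Q_lin[of f g h 1 "-1"] by simp

lemma Q_diff2: "f \<in> D \<Longrightarrow> g \<in> D \<Longrightarrow> h \<in> D \<Longrightarrow> Q h (\<lambda>x. f x - g x) = Q h f - Q h g"
  using Q_lin2[of f g h 1 "-1"] by simp

lemma Q_add_scaled:
  assumes "f \<in> D" "g \<in> D"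
  shows "Q (\<lambda>x. f x + t * g x) (\<lambda>x. f x + t * g x) = Q f f + 2 * t * Q f g + t\<^sup>2 * Q g g"
proof -
  have "(\<lambda>x. 1 * f x + t * g x) \<in> D" using lin[OF assms] .
  then have "Q (\<lambda>x. 1 * f x + t * g x) (\<lambda>x. 1 * f x + t * g x) = Q f f + 2 * t * Q f g + t\<^sup>2 * Q g g"
    using assms sym[of f g]
    by (simp only: Q_lin Q_lin2) (simp add: power2_eq_square algebra_simps)
  then show ?thesis by simp
qed

lemma lincomb: "(\<And>i. i < (k::nat) \<Longrightarrow> f i \<in> D) \<Longrightarrow> (\<lambda>x. \<Sum>i<k. c i * f i x) \<in> D"
proof (induction k)
  case 0 then show ?case using zero by simp
next
  case (Suc k)
  have "(\<lambda>x. 1 * (\<Sum>i<k. c i * f i x) + c k * f k x) \<in> D"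
    using Suc by (intro lin) auto
  then show ?case by simp
qed

lemma Q_zero: "h \<in> D \<Longrightarrow> Q (\<lambda>x. 0) h = 0"
  using Q_lin[of "\<lambda>x. 0" "\<lambda>x. 0" h 0 0] zero by simp

lemma Q_lincomb: "(\<And>i. i < (k::nat) \<Longrightarrow> f i \<in> D) \<Longrightarrow> h \<in> D \<Longrightarrow>
    Q (\<lambda>x. \<Sum>i<k. c i * f i x) h = (\<Sum>i<k. c i * Q (f i) h)"
proof (induction k)
  case 0 then show ?case using Q_zero by simp
next
  case (Suc k)
  have "Q (\<lambda>x. 1 * (\<Sum>i<k. c i * f i x) + c k * f k x) h = 1 * Q (\<lambda>x. \<Sum>i<k. c i * f i x) h + c k * Q (f k) h"
    using Suc by (intro Q_lin lincomb) auto
  then show ?case using Suc by simp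
qed

lemma Q_lincomb_self:
  assumes "\<And>i. i < (k::nat) \<Longrightarrow> f i \<in> D"
  shows "Q (\<lambda>x. \<Sum>i<k. c i * f i x) (\<lambda>x. \<Sum>i<k. c i * f i x) = (\<Sum>i<k. \<Sum>j<k. c i * c j * Q (f i) (f j))"
proof -
  let ?h = "\<lambda>x. \<Sum>i<k. c i * f i x"
  have h: "?h \<in> D" using assms lincomb by blast
  have "Q ?h ?h = (\<Sum>i<k. c i * Q ?h (f i))"
    using Q_lincomb[OF assms h] sym[OF _ h] assms by simp
  also have "\<dots> = (\<Sum>i<k. c i * (\<Sum>j<k. c j * Q (f j) (f i)))"
    using Q_lincomb[OF assms] assms by simp
  also have "\<dots> = (\<Sum>i<k. \<Sum>j<k. c i * c j * Q (f i) (f j))"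
    using sym assms by (auto simp: sum_distrib_left mult.assoc intro!: sum.cong)
  finally show ?thesis .
qed

lemma add_sym_form:
  assumes "sym_form D R"
  shows "sym_form D (\<lambda>f g. a * Q f g + b * R f g)"
proof -
  interpret R: sym_form D R by fact
  show ?thesis
    by unfold_locales (use zero lin sym R.sym in \<open>auto simp: Q_lin R.Q_lin algebra_simps\<close>)
qed

end

lemma sum_kronecker:
  fixes a :: "nat \<Rightarrow> real"
  assumes "i < k"
  shows "(\<Sum>j<k. a j * (if i = j then 1 else 0)) = a i" "(\<Sum>j<k. a j * (if j = i then 1 else 0)) = a i"
  using assms by (simp_all add: if_distrib[of "\<lambda>x. a _ * x"] cong: if_cong)

lemma sum_squares_pos:
  fixes c :: "nat \<Rightarrow> real"
  assumes "\<exists>i<k. c i \<noteq> 0"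
  shows "0 < (\<Sum>i<k. (c i)\<^sup>2)"
proof -
  obtain i where "i < k" "c i \<noteq> 0" using assms by blast
  then show ?thesis by (intro sum_pos2[of _ i]) auto
qed

text \<open>The discriminant of a nonnegative quadratic. Besides the two Cauchy-Schwarz inequalities
  it yields weak equations: if the constant or the quadratic coefficient is zero, the linear one
  must vanish.\<close>

lemma quadratic_nonneg_coeff:
  fixes a b c :: real
  assumes "\<And>t. 0 \<le> a + 2 * t * b + t\<^sup>2 * c"
  shows "b\<^sup>2 \<le> a * c"
proof (cases "c = 0")
  case True
  have "b = 0"
  proof (rule ccontr)
    assume "b \<noteq> 0"
    \<comment> \<open>At this \<open>t\<close> the expression takes the value -1.\<close>
    then show False using assms[of "- (a + 1) / (2 * b)"] True by (simp add: field_simps)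
  qed
  then show ?thesis using True by simp
next
  case False
  have "0 \<le> c"
  proof (rule ccontr)
    assume c: "\<not> 0 \<le> c"
    \<comment> \<open>The quotient makes \<open>t * (- c)\<close> dominate
      \<open>\<bar>a\<bar> + 1 + 2 * \<bar>b\<bar>\<close>; the last summand ensures
      \<open>t \<ge> 1\<close>, so that multiplying by \<open>t\<close> loses nothing.\<close>
    define t where "t = (\<bar>a\<bar> + 1 + 2 * \<bar>b\<bar>) / (- c) + 1"
    have t1: "t \<ge> 1" using c by (auto simp: t_def field_simps)
    have "t * (- c) \<ge> \<bar>a\<bar> + 1 + 2 * \<bar>b\<bar>" using c by (auto simp: t_def field_simps)
    then have "t * (t * (- c)) \<ge> t * (\<bar>a\<bar> + 1 + 2 * \<bar>b\<bar>)" using t1 by (intro mult_left_mono) auto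
    moreover have "t * (\<bar>a\<bar> + 1) \<ge> \<bar>a\<bar> + 1" using t1 by (simp add: mult_le_cancel_right1)
    moreover have "2 * (t * b) \<le> 2 * (t * \<bar>b\<bar>)" using t1 by (simp add: mult_left_mono)
    ultimately have "a + 2 * t * b + t\<^sup>2 * c < 0"
      by (simp add: power2_eq_square algebra_simps)
    then show False using assms[of t] by simp
  qed
  then have c: "0 < c" using False by simp
  have "0 \<le> a + 2 * (- b / c) * b + (- b / c)\<^sup>2 * c" by (rule assms)
  also have "\<dots> = a - b\<^sup>2 / c" using c by (simp add: power2_eq_square field_simps)
  finally show ?thesis using c by (simp add: field_simps)
qed

section \<open>Nonnegative forms: Cauchy-Schwarz and continuity\<close>

locale psd_form = sym_form +
  assumes nonneg: "f \<in> D \<Longrightarrow> 0 \<le> Q f f"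
begin

lemma cauchy_schwarz:
  assumes "f \<in> D" "g \<in> D"
  shows "\<bar>Q f g\<bar> \<le> sqrt (Q f f) * sqrt (Q g g)"
proof -
  have "(Q f g)\<^sup>2 \<le> Q f f * Q g g"
  proof (rule quadratic_nonneg_coeff)
    fix t
    have "(\<lambda>x. f x + t * g x) \<in> D" using lin[OF assms, of 1 t] by simp
    then show "0 \<le> Q f f + 2 * t * Q f g + t\<^sup>2 * Q g g"
      using nonneg Q_add_scaled[OF assms, of t] by metis
  qed
  then have "sqrt ((Q f g)\<^sup>2) \<le> sqrt (Q f f * Q g g)" by (rule real_sqrt_le_mono)
  then show ?thesis by (simp add: real_sqrt_mult)
qed

text \<open>Expanding \<open>Q (f n) (g n)\<close> about \<open>(a, b)\<close> leaves three error
  terms. Each contains a difference that tends to zero in the seminorm, so Cauchy-Schwarz disposes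
  of them.\<close>

lemma tendsto_form:
  assumes "\<And>n. f n \<in> D" "\<And>n. g n \<in> D" "a \<in> D" "b \<in> D"
    and f: "(\<lambda>n::nat. Q (\<lambda>x. f n x - a x) (\<lambda>x. f n x - a x)) \<longlonglongrightarrow> 0"
    and g: "(\<lambda>n. Q (\<lambda>x. g n x - b x) (\<lambda>x. g n x - b x)) \<longlonglongrightarrow> 0"
  shows "(\<lambda>n. Q (f n) (g n)) \<longlonglongrightarrow> Q a b"
proof -
  let ?F = "\<lambda>n x. f n x - a x" and ?G = "\<lambda>n x. g n x - b x"
  have D: "?F n \<in> D" "?G n \<in> D" for n using assms diff by blast+
  have sf: "(\<lambda>n. sqrt (Q (?F n) (?F n))) \<longlonglongrightarrow> 0" using tendsto_real_sqrt[OF f] by simp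
  have sg: "(\<lambda>n. sqrt (Q (?G n) (?G n))) \<longlonglongrightarrow> 0" using tendsto_real_sqrt[OF g] by simp
  have z: "(\<lambda>n. Q (h n) (k n)) \<longlonglongrightarrow> 0"
    if "\<And>n. h n \<in> D" "\<And>n. k n \<in> D" "(\<lambda>n. sqrt (Q (h n) (h n)) * sqrt (Q (k n) (k n))) \<longlonglongrightarrow> 0" for h k :: "nat \<Rightarrow> 'a \<Rightarrow> real"
    using that(3) by (rule Lim_null_comparison[rotated]) (use that cauchy_schwarz in auto)
  have 1: "(\<lambda>n. Q (?F n) (?G n)) \<longlonglongrightarrow> 0"
    by (rule z) (use D tendsto_mult[OF sf sg] in auto)
  have 2: "(\<lambda>n. Q (?F n) b) \<longlonglongrightarrow> 0"
    by (rule z) (use D assms tendsto_mult[OF sf tendsto_const] in auto)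
  have 3: "(\<lambda>n. Q a (?G n)) \<longlonglongrightarrow> 0"
    by (rule z) (use D assms tendsto_mult[OF tendsto_const sg] in auto)
  have eq: "Q (f n) (g n) = Q (?F n) (?G n) + Q (?F n) b + Q a (?G n) + Q a b" for n
    using assms D[of n] by (simp add: Q_diff Q_diff2)
  show ?thesis unfolding eq
    using tendsto_add[OF tendsto_add[OF tendsto_add[OF 1 2] 3] tendsto_const[of "Q a b"]] by simp
qed

end

interpretation ip: psd_form L2 ip
  by unfold_locales (auto simp: L2_zero L2_lin ip_lin ip_nonneg intro: ip_commute)

lemma ip_tendsto:
  assumes "\<And>n. f n \<in> L2" "\<And>n. g n \<in> L2" "a \<in> L2" "b \<in> L2" "L2_lim f a" "L2_lim g b"
  shows "(\<lambda>n. ip (f n) (g n)) \<longlonglongrightarrow> ip a b"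
  using assms unfolding L2_lim_def by (intro ip.tendsto_form)

lemma L2_lim_subseq: "L2_lim u v \<Longrightarrow> strict_mono r \<Longrightarrow> L2_lim (\<lambda>n. u (r n)) v"
  unfolding L2_lim_def using LIMSEQ_subseq_LIMSEQ[of _ 0 r] by (fastforce simp: o_def)

lemma ip_eq_0_AE:
  assumes "f \<in> L2"
  shows "ip f f = 0 \<longleftrightarrow> (AE x in lborel. f x = 0)"
proof -
  have "integrable lborel (\<lambda>x. f x * f x)" using assms L2_mult_integrable by blast
  then show ?thesis unfolding ip_def
    by (subst integral_nonneg_eq_0_iff_AE) auto
qed

section \<open>Eigenfunctions by successive minimisation\<close>

text \<open>Gaussian elimination, by induction on the number of equations: unless the last equation
  is trivial, it is solved for an unknown \<open>p\<close> with nonzero coefficient, and the rest is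
  a smaller system.\<close>

lemma homogeneous_system:
  fixes A :: "nat \<Rightarrow> nat \<Rightarrow> real"
  shows "\<exists>c. (\<exists>i<Suc m. c i \<noteq> 0) \<and> (\<forall>j<m. (\<Sum>i<Suc m. c i * A j i) = 0)"
proof (induction m arbitrary: A)
  case 0 show ?case by (intro exI[of _ "\<lambda>_. 1"]) auto
next
  case (Suc m)
  show ?case
  proof (cases "\<forall>i<Suc (Suc m). A m i = 0")
    case True
    obtain c where c: "\<exists>i<Suc m. c i \<noteq> 0" "\<forall>j<m. (\<Sum>i<Suc m. c i * A j i) = 0"
      using Suc[of A] by blast
    let ?c = "c(Suc m := 0)"
    have "(\<Sum>i<Suc (Suc m). ?c i * A j i) = (\<Sum>i<Suc m. c i * A j i)" for j
      by simp
    moreover have "\<exists>i<Suc (Suc m). ?c i \<noteq> 0" using c(1) by (metis fun_upd_other less_SucI less_irrefl)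
    moreover have "(\<Sum>i<Suc (Suc m). ?c i * A m i) = 0" using True by (intro sum.neutral) auto
    ultimately show ?thesis using c(2) by (intro exI[of _ ?c]) (auto simp: less_Suc_eq simp del: sum.lessThan_Suc)
  next
    case False
    then obtain p where p: "p < Suc (Suc m)" "A m p \<noteq> 0" by blast
    \<comment> \<open>An enumeration of the indices other than \<open>p\<close>.\<close>
    define e where "e i = (if i < p then i else Suc i)" for i
    have img: "e ` {..<Suc m} = {..<Suc (Suc m)} - {p}"
    proof (intro set_eqI iffI)
      fix y assume "y \<in> {..<Suc (Suc m)} - {p}"
      then show "y \<in> e ` {..<Suc m}"
        by (intro image_eqI[of _ _ "if y < p then y else y - 1"]) (use p in \<open>auto simp: e_def\<close>)
    qed (use p in \<open>auto simp: e_def split: if_splits\<close>)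
    have inj: "inj_on e {..<Suc m}" by (auto simp: inj_on_def e_def split: if_splits)
    \<comment> \<open>The coefficients of the remaining equations after the unknown \<open>p\<close>
      has been eliminated by means of equation \<open>m\<close>.\<close>
    define B where "B j i = A j (e i) - A j p * A m (e i) / A m p" for j i
    obtain c where c: "\<exists>i<Suc m. c i \<noteq> 0" "\<forall>j<m. (\<Sum>i<Suc m. c i * B j i) = 0"
      using Suc[of B] by blast
    define inve where "inve y = (if y < p then y else y - 1)" for y
    have inve: "inve (e i) = i" for i by (auto simp: inve_def e_def)
    \<comment> \<open>Equation \<open>m\<close> forces the value \<open>- S\<close> on the unknown
      \<open>p\<close>.\<close>
    define S where "S = (\<Sum>i<Suc m. c i * A m (e i)) / A m p"
    define d where "d y = (if y = p then - S else c (inve y))" for y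
    have ep: "e i \<noteq> p" for i by (auto simp: e_def)
    have sm: "(\<Sum>y<Suc (Suc m). d y * A j y) = - S * A j p + (\<Sum>i<Suc m. c i * A j (e i))" for j
    proof -
      have "(\<Sum>y<Suc (Suc m). d y * A j y) = d p * A j p + (\<Sum>y\<in>{..<Suc (Suc m)} - {p}. d y * A j y)"
        using p by (subst sum.remove[of _ p]) auto
      also have "(\<Sum>y\<in>{..<Suc (Suc m)} - {p}. d y * A j y) = (\<Sum>i<Suc m. d (e i) * A j (e i))"
        unfolding img[symmetric] by (subst sum.reindex[OF inj]) auto
      also have "\<dots> = (\<Sum>i<Suc m. c i * A j (e i))" by (simp add: d_def ep inve)
      finally show ?thesis by (simp add: d_def)
    qed
    have "(\<Sum>y<Suc (Suc m). d y * A j y) = 0" if "j < Suc m" for j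
    proof (cases "j = m")
      case True then show ?thesis unfolding sm S_def using p by simp
    next
      case False
      then have "0 = (\<Sum>i<Suc m. c i * B j i)" using c(2) that by auto
      also have "\<dots> = (\<Sum>i<Suc m. c i * A j (e i)) - S * A j p"
        unfolding B_def S_def
        by (simp only: right_diff_distrib sum_subtractf sum_divide_distrib sum_distrib_right)
          (simp add: mult_ac)
      finally show ?thesis unfolding sm by simp
    qed
    moreover have "\<exists>y<Suc (Suc m). d y \<noteq> 0"
    proof -
      obtain i where "i < Suc m" "c i \<noteq> 0" using c(1) by blast
      then show ?thesis using ep[of i] inve[of i] img
        by (intro exI[of _ "e i"]) (auto simp: d_def)
    qed
    ultimately show ?thesis by blast
  qed
qed

text \<open>These are the hypotheses of the direct method. \<open>compact_lsc\<close> fuses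
  compactness of the embedding into L2 with lower semicontinuity and stands in for closedness of the
  form; \<open>infinite_dim\<close> keeps every constrained minimisation problem feasible.\<close>

locale spectral_form = sym_form +
  fixes M :: real
  assumes D_L2: "D \<subseteq> L2"
    and bounded_below: "f \<in> D \<Longrightarrow> - M * ip f f \<le> Q f f"
    and compact_lsc: "(\<And>n::nat. u n \<in> D) \<Longrightarrow> (\<And>n. ip (u n) (u n) = 1) \<Longrightarrow> (\<lambda>n. Q (u n) (u n)) \<longlonglongrightarrow> c \<Longrightarrow>
        \<exists>r v. strict_mono r \<and> v \<in> D \<and> L2_lim (\<lambda>n. u (r n)) v \<and> Q v v \<le> c"
    and infinite_dim: "\<exists>f. \<forall>i<k::nat. f i \<in> D \<and> (\<forall>j<k. ip (f i) (f j) = (if i = j then 1 else 0))"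

text \<open>The last clause is the variational one: \<open>\<mu> i\<close> minimises the Rayleigh
  quotient on the orthogonal complement of the earlier \<open>e j\<close>. It orders the eigenvalues
  and rules out that one has been skipped.\<close>

definition eigen_family where
  "eigen_family D Q k e \<mu> \<longleftrightarrow>
     (\<forall>i<k::nat. e i \<in> D \<and> (\<forall>j<k. ip (e i) (e j) = (if i = j then 1 else 0)) \<and>
        (\<forall>v\<in>D. Q (e i) v = \<mu> i * ip (e i) v) \<and>
        (\<forall>v\<in>D. (\<forall>j<i. ip v (e j) = 0) \<longrightarrow> \<mu> i * ip v v \<le> Q v v))"

lemma eigen_familyD:
  assumes "eigen_family D Q k e \<mu>" "i < k"
  shows "e i \<in> D" "\<And>j. j < k \<Longrightarrow> ip (e i) (e j) = (if i = j then 1 else 0)"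
    "\<And>v. v \<in> D \<Longrightarrow> Q (e i) v = \<mu> i * ip (e i) v"
    "\<And>v. v \<in> D \<Longrightarrow> (\<And>j. j < i \<Longrightarrow> ip v (e j) = 0) \<Longrightarrow> \<mu> i * ip v v \<le> Q v v"
  using assms unfolding eigen_family_def by blast+

context spectral_form
begin

lemma ip_form: "sym_form D ip"
  using D_L2 by unfold_locales (auto simp: zero lin ip_lin subset_iff intro: ip_commute)

sublocale ipD: sym_form D ip by (rule ip_form)

lemma orthonormal_combination_norm:
  assumes "\<And>i. i < (k::nat) \<Longrightarrow> f i \<in> D" "\<And>i j. i < k \<Longrightarrow> j < k \<Longrightarrow> ip (f i) (f j) = (if i = j then 1 else 0)"
  shows "ip (\<lambda>x. \<Sum>i<k. c i * f i x) (\<lambda>x. \<Sum>i<k. c i * f i x) = (\<Sum>i<k. (c i)\<^sup>2)"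
proof -
  have "ip (\<lambda>x. \<Sum>i<k. c i * f i x) (\<lambda>x. \<Sum>i<k. c i * f i x) = (\<Sum>i<k. \<Sum>j<k. c i * c j * (if i = j then 1 else 0))"
    using assms by (subst ipD.Q_lincomb_self) auto
  also have "\<dots> = (\<Sum>i<k. (c i)\<^sup>2)" by (intro sum.cong refl) (simp add: sum_kronecker power2_eq_square)
  finally show ?thesis .
qed

text \<open>There are \<open>k + 1\<close> free coefficients against \<open>k\<close> linear
  conditions. This is the dimension count behind every min-max comparison below.\<close>

lemma orthogonal_combination:
  assumes "\<And>i. i < Suc k \<Longrightarrow> f i \<in> D" "\<And>j. j < k \<Longrightarrow> e j \<in> D"
  obtains c where "\<exists>i<Suc k. c i \<noteq> 0" "\<And>j. j < k \<Longrightarrow> ip (\<lambda>x. \<Sum>i<Suc k. c i * f i x) (e j) = 0"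
proof -
  obtain c where c: "\<exists>i<Suc k. c i \<noteq> 0" "\<forall>j<k. (\<Sum>i<Suc k. c i * ip (f i) (e j)) = 0"
    using homogeneous_system[of k "\<lambda>j i. ip (f i) (e j)"] by blast
  show ?thesis
  proof (rule that[OF c(1)])
    fix j assume j: "j < k"
    have "ip (\<lambda>x. \<Sum>i<Suc k. c i * f i x) (e j) = (\<Sum>i<Suc k. c i * ip (f i) (e j))"
      using assms(1) assms(2)[OF j] by (rule ipD.Q_lincomb)
    then show "ip (\<lambda>x. \<Sum>i<Suc k. c i * f i x) (e j) = 0" using c(2) j by metis
  qed
qed

lemma ip_scale: "f \<in> D \<Longrightarrow> ip (\<lambda>x. a * f x) (\<lambda>x. a * f x) = a\<^sup>2 * ip f f"
  and Q_scale: "f \<in> D \<Longrightarrow> Q (\<lambda>x. a * f x) (\<lambda>x. a * f x) = a\<^sup>2 * Q f f"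
  using ipD.Q_add_scaled[of "\<lambda>x. 0" f a] Q_add_scaled[of "\<lambda>x. 0" f a] zero ipD.Q_zero Q_zero by auto

lemma scale: "f \<in> D \<Longrightarrow> (\<lambda>x. a * f x) \<in> D"
  using lin[of f f a 0] by simp

text \<open>The direct method on the unit sphere of the orthogonal complement of the
  \<open>e j\<close>. Both constraints survive L2 convergence of a minimising sequence, and
  homogeneity extends the inequality from the sphere to all orthogonal \<open>w\<close>.\<close>

lemma minimizer_exists:
  assumes e: "\<And>j. j < (k::nat) \<Longrightarrow> e j \<in> D"
  obtains v m where "v \<in> D" "ip v v = 1" "\<And>j. j < k \<Longrightarrow> ip v (e j) = 0" "Q v v = m"
    "\<And>w. w \<in> D \<Longrightarrow> (\<And>j. j < k \<Longrightarrow> ip w (e j) = 0) \<Longrightarrow> m * ip w w \<le> Q w w"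
proof -
  define S where "S = {v\<in>D. ip v v = 1 \<and> (\<forall>j<k. ip v (e j) = 0)}"
  obtain f where f: "\<And>i. i < Suc k \<Longrightarrow> f i \<in> D"
    "\<And>i j. i < Suc k \<Longrightarrow> j < Suc k \<Longrightarrow> ip (f i) (f j) = (if i = j then 1 else 0)"
    using infinite_dim[of "Suc k"] by blast
  \<comment> \<open>The admissible set is nonempty because \<open>k + 1\<close> orthonormal
    functions have a nonzero combination in the complement.\<close>
  obtain c where c: "\<exists>i<Suc k. c i \<noteq> 0" "\<And>j. j < k \<Longrightarrow> ip (\<lambda>x. \<Sum>i<Suc k. c i * f i x) (e j) = 0"
    using orthogonal_combination[of k f e] f(1) e by blast
  define w where "w = (\<lambda>x. \<Sum>i<Suc k. c i * f i x)"
  have wD: "w \<in> D" unfolding w_def using f(1) lincomb by blast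
  have "ip w w = (\<Sum>i<Suc k. (c i)\<^sup>2)" unfolding w_def using f by (rule orthonormal_combination_norm)
  moreover have "(\<Sum>i<Suc k. (c i)\<^sup>2) > 0" using c(1) by (rule sum_squares_pos)
  ultimately have wpos: "ip w w > 0" by simp
  have norm1: "(\<lambda>x. 1 / sqrt (ip v v) * v x) \<in> S"
    if v: "v \<in> D" "\<And>j. j < k \<Longrightarrow> ip v (e j) = 0" "ip v v > 0" for v
    unfolding S_def
  proof (intro CollectI conjI allI impI)
    show "(\<lambda>x. 1 / sqrt (ip v v) * v x) \<in> D" using scale v(1) by blast
    show "ip (\<lambda>x. 1 / sqrt (ip v v) * v x) (\<lambda>x. 1 / sqrt (ip v v) * v x) = 1"
      using v(3) by (simp only: ip_scale[OF v(1)]) (simp add: power_divide)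
    fix j assume "j < k"
    then show "ip (\<lambda>x. 1 / sqrt (ip v v) * v x) (e j) = 0"
      using v ipD.Q_lin[of v v "e j" "1 / sqrt (ip v v)" 0] e by simp
  qed
  have Sne: "S \<noteq> {}" using norm1[of w] wD c(2) wpos unfolding w_def by blast
  define m where "m = (INF v\<in>S. Q v v)"
  have bdd: "bdd_below ((\<lambda>v. Q v v) ` S)"
    by (rule bdd_belowI[of _ "- M"]) (use bounded_below in \<open>force simp: S_def\<close>)
  have "\<exists>v\<in>S. Q v v < m + 1 / real (Suc n)" for n
    using cINF_less_iff[OF Sne bdd, of "m + 1 / real (Suc n)"] unfolding m_def by auto
  then obtain u where u: "\<And>n. u n \<in> S" "\<And>n. Q (u n) (u n) < m + 1 / real (Suc n)"
    by metis
  have low: "m \<le> Q v v" if "v \<in> S" for v unfolding m_def using bdd that by (rule cINF_lower)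
  have "(\<lambda>n. Q (u n) (u n)) \<longlonglongrightarrow> m"
  proof (rule tendsto_sandwich[of "\<lambda>_. m" _ _ "\<lambda>n. m + 1 / real (Suc n)"])
    show "(\<lambda>n. m + 1 / real (Suc n)) \<longlonglongrightarrow> m"
      using tendsto_add[OF tendsto_const[of m] LIMSEQ_Suc[OF lim_1_over_n]] by simp
  qed (use u low in \<open>auto intro: less_imp_le always_eventually\<close>)
  then obtain r v where rv: "strict_mono r" "v \<in> D" "L2_lim (\<lambda>n. u (r n)) v" "Q v v \<le> m"
    using compact_lsc[of u m] u(1) unfolding S_def by blast
  have uD: "u n \<in> D" "ip (u n) (u n) = 1" "\<And>j. j < k \<Longrightarrow> ip (u n) (e j) = 0" for n using u(1) by (auto simp: S_def)
  have const: "L2_lim (\<lambda>n. g) g" for g :: "'a \<Rightarrow> real" by (simp add: L2_lim_def ip_def)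
  have "ip v v = 1"
    using ip_tendsto[of "\<lambda>n. u (r n)" "\<lambda>n. u (r n)" v v] uD D_L2 rv
    by (auto simp: subset_iff LIMSEQ_const_iff)
  moreover have "ip v (e j) = 0" if "j < k" for j
    using ip_tendsto[of "\<lambda>n. u (r n)" "\<lambda>n. e j" v "e j"] uD D_L2 rv e[OF that] that const
    by (auto simp: subset_iff LIMSEQ_const_iff)
  ultimately have vS: "v \<in> S" using rv by (auto simp: S_def)
  have Qv: "Q v v = m" using low[OF vS] rv(4) by simp
  show ?thesis
  proof (rule that[of v m])
    fix w assume w: "w \<in> D" "\<And>j. j < k \<Longrightarrow> ip w (e j) = 0"
    show "m * ip w w \<le> Q w w"
    proof (cases "ip w w = 0")
      \<comment> \<open>A null function cannot be normalised; here semiboundedness gives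
        \<open>0 \<le> Q w w\<close>.\<close>
      case True then show ?thesis using bounded_below[OF w(1)] by simp
    next
      case False
      then have pos: "ip w w > 0" using ip_nonneg[of w] by simp
      have "m \<le> Q (\<lambda>x. 1 / sqrt (ip w w) * w x) (\<lambda>x. 1 / sqrt (ip w w) * w x)"
        using low norm1[OF w pos] by blast
      also have "\<dots> = Q w w / ip w w"
        unfolding Q_scale[OF w(1)] using pos by (simp add: power_divide)
      finally show ?thesis using pos by (simp add: field_simps)
    qed
  qed (use vS Qv in \<open>auto simp: S_def\<close>)
qed

text \<open>Each step adds a constrained minimiser. Its Euler-Lagrange equation holds first against
  functions orthogonal to the earlier \<open>e i\<close>, and then against all of \<open>D\<close>,
  because the earlier ones are eigenfunctions orthogonal to it.\<close>

lemma eigen_family_exists: "\<exists>e \<mu>. eigen_family D Q k e \<mu>"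
proof (induction k)
  case 0 show ?case by (simp add: eigen_family_def)
next
  case (Suc k)
  then obtain e \<mu> where "eigen_family D Q k e \<mu>" by blast
  then have e: "\<And>i. i < k \<Longrightarrow> e i \<in> D" "\<And>i j. i < k \<Longrightarrow> j < k \<Longrightarrow> ip (e i) (e j) = (if i = j then 1 else 0)"
    "\<And>i v. i < k \<Longrightarrow> v \<in> D \<Longrightarrow> Q (e i) v = \<mu> i * ip (e i) v"
    "\<And>i v. i < k \<Longrightarrow> v \<in> D \<Longrightarrow> (\<forall>j<i. ip v (e j) = 0) \<Longrightarrow> \<mu> i * ip v v \<le> Q v v"
    by (auto simp: eigen_family_def)
  obtain v m where v: "v \<in> D" "ip v v = 1" "\<And>j. j < k \<Longrightarrow> ip v (e j) = 0" "Q v v = m"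
    "\<And>w. w \<in> D \<Longrightarrow> (\<And>j. j < k \<Longrightarrow> ip w (e j) = 0) \<Longrightarrow> m * ip w w \<le> Q w w"
    using minimizer_exists[of k e] e(1) by blast
  have orth: "Q v w = m * ip v w" if w: "w \<in> D" "\<And>j. j < k \<Longrightarrow> ip w (e j) = 0" for w
  proof -
    \<comment> \<open>Along \<open>v + t w\<close> the quantity \<open>Q - m * ip\<close> is
      nonnegative and vanishes at \<open>t = 0\<close>, so its linear coefficient is zero.\<close>
    have "(Q v w - m * ip v w)\<^sup>2 \<le> 0 * (Q w w - m * ip w w)"
    proof (rule quadratic_nonneg_coeff)
      fix t
      have D: "(\<lambda>x. v x + t * w x) \<in> D" using lin[OF v(1) w(1), of 1 t] by simp
      have "ip (\<lambda>x. v x + t * w x) (e j) = 0" if "j < k" for j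
        using ipD.Q_lin[of v w "e j" 1 t] v w e that by simp
      from v(5)[OF D this]
      show "0 \<le> 0 + 2 * t * (Q v w - m * ip v w) + t\<^sup>2 * (Q w w - m * ip w w)"
        using v w by (simp add: Q_add_scaled ipD.Q_add_scaled algebra_simps)
    qed
    then show ?thesis by simp
  qed
  have eig: "Q v w = m * ip v w" if w: "w \<in> D" for w
  proof -
    \<comment> \<open>The orthogonal projection of \<open>w\<close> onto the span of the earlier
      eigenfunctions; both \<open>Q v p\<close> and \<open>ip v p\<close> vanish.\<close>
    define p where "p = (\<lambda>x. \<Sum>i<k. ip w (e i) * e i x)"
    have pD: "p \<in> D" unfolding p_def using e(1) by (rule lincomb)
    have "ip p (e j) = ip w (e j)" if "j < k" for j
    proof -
      have "ip p (e j) = (\<Sum>i<k. ip w (e i) * (if i = j then 1 else 0))"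
        unfolding p_def using e that by (subst ipD.Q_lincomb) auto
      then show ?thesis using that by (simp add: sum_kronecker)
    qed
    then have "Q v (\<lambda>x. w x - p x) = m * ip v (\<lambda>x. w x - p x)"
      using orth[of "\<lambda>x. w x - p x"] w pD diff e(1) by (simp add: ipD.Q_diff)
    moreover have "Q v p = 0"
    proof -
      have "Q p v = (\<Sum>i<k. ip w (e i) * Q (e i) v)" unfolding p_def using e v by (subst Q_lincomb) auto
      also have "\<dots> = 0" using e(3) v by (auto intro!: sum.neutral simp: ip_commute)
      finally show ?thesis using sym pD v by simp
    qed
    moreover have "ip v p = 0"
    proof -
      have "ip p v = (\<Sum>i<k. ip w (e i) * ip (e i) v)" unfolding p_def using e v by (subst ipD.Q_lincomb) auto
      also have "\<dots> = 0" using v by (auto intro!: sum.neutral simp: ip_commute)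
      finally show ?thesis by (simp add: ip_commute)
    qed
    ultimately show ?thesis using v w pD by (simp add: Q_diff2 ipD.Q_diff2)
  qed
  have "eigen_family D Q (Suc k) (e(k := v)) (\<mu>(k := m))"
    unfolding eigen_family_def
  proof (intro allI impI)
    fix i assume i: "i < Suc k"
    have vj: "ip v (e j) = 0" "ip (e j) v = 0" if "j < k" for j
      using v(3)[OF that] by (simp_all add: ip_commute[of "e j"])
    show "(e(k := v)) i \<in> D \<and> (\<forall>j<Suc k. ip ((e(k := v)) i) ((e(k := v)) j) = (if i = j then 1 else 0)) \<and>
        (\<forall>w\<in>D. Q ((e(k := v)) i) w = (\<mu>(k := m)) i * ip ((e(k := v)) i) w) \<and>
        (\<forall>w\<in>D. (\<forall>j<i. ip w ((e(k := v)) j) = 0) \<longrightarrow> (\<mu>(k := m)) i * ip w w \<le> Q w w)"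
    proof (cases "i = k")
      case True
      have "m * ip w w \<le> Q w w" if "w \<in> D" "\<forall>j<k. ip w ((e(k := v)) j) = 0" for w
        using v(5)[OF that(1)] that(2) by simp
      then show ?thesis using True v(1,2) vj eig by (auto simp: less_Suc_eq)
    next
      case False
      then have ik: "i < k" using i by simp
      have "\<mu> i * ip w w \<le> Q w w" if "w \<in> D" "\<forall>j<i. ip w ((e(k := v)) j) = 0" for w
      proof (rule e(4)[OF ik that(1)], intro allI impI)
        fix j assume "j < i"
        then show "ip w (e j) = 0" using that(2) ik by (metis fun_upd_other less_asym)
      qed
      moreover have "ip (e i) ((e(k := v)) j) = (if i = j then 1 else 0)" if "j < Suc k" for j
        using e(2)[OF ik, of j] vj(2)[OF ik] that ik by (cases "j = k") auto
      ultimately show ?thesis using False ik e(1,3) by simp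
    qed
  qed
  then show ?case by blast
qed

text \<open>Being orthogonal to the first \<open>i\<close> eigenfunctions, \<open>e j\<close> is a
  competitor in the minimisation that defines \<open>\<mu> i\<close>.\<close>

lemma eigen_family_mono:
  assumes "eigen_family D Q k e \<mu>" "i \<le> j" "j < k"
  shows "\<mu> i \<le> \<mu> j"
proof -
  note E = eigen_familyD[OF assms(1)]
  have "\<mu> i * ip (e j) (e j) \<le> Q (e j) (e j)"
    using assms(2,3) by (intro E(4) E(1)) (auto simp: E(2))
  then show ?thesis using E(2)[OF assms(3) assms(3)] E(3)[OF assms(3) E(1)[OF assms(3)]] by simp
qed

text \<open>The affine reparametrisation \<^term>\<open>\<lambda>lam. (lam - b) / s\<close> serves the fractional form, which is
  the identity plus \<^term>\<open>s\<close> times the normalised form.\<close>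

lemma kth_eigenvalue_eq:
  assumes E: "eigen_family D Q (Suc k) e \<mu>" and s: "s > 0"
    and P: "\<And>\<phi> lam. P \<phi> lam \<longleftrightarrow> \<phi> \<in> D \<and> \<not> (AE x in lborel. \<phi> x = 0) \<and> (\<forall>v\<in>D. Q \<phi> v = (lam - b) / s * ip \<phi> v)"
  shows "kth_eigenvalue P (Suc k) = b + s * \<mu> k"
proof -
  have e: "\<And>i. i < Suc k \<Longrightarrow> e i \<in> D"
    "\<And>i j. i < Suc k \<Longrightarrow> j < Suc k \<Longrightarrow> ip (e i) (e j) = (if i = j then 1 else 0)"
    "\<And>i v. i < Suc k \<Longrightarrow> v \<in> D \<Longrightarrow> Q (e i) v = \<mu> i * ip (e i) v"
    "\<And>i v. i < Suc k \<Longrightarrow> v \<in> D \<Longrightarrow> (\<forall>j<i. ip v (e j) = 0) \<Longrightarrow> \<mu> i * ip v v \<le> Q v v"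
    using E by (auto simp: eigen_family_def)
  \<comment> \<open>The set under the infimum is found exactly. The family \<open>e\<close> puts the
    endpoint into it. Conversely, \<open>k + 1\<close> orthonormal eigenfunctions at threshold
    \<open>t\<close> have a combination orthogonal to \<open>e 0\<close>, ...,
    \<open>e (k - 1)\<close>, whose Rayleigh quotient lies between \<open>\<mu> k\<close> and
    \<open>(t - b) / s\<close>.\<close>
  have "{t. \<exists>F. finite F \<and> card F = Suc k \<and> L2_orthonormal F \<and> (\<forall>f\<in>F. \<exists>lam\<le>t. P f lam)} = {b + s * \<mu> k..}"
    (is "?L = _")
  proof (intro set_eqI iffI)
    fix t assume "t \<in> {b + s * \<mu> k..}"
    then have t: "b + s * \<mu> k \<le> t" by simp
    have inj: "inj_on e {..<Suc k}"
    proof (rule inj_onI)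
      fix i j assume ij: "i \<in> {..<Suc k}" "j \<in> {..<Suc k}" and eq: "e i = e j"
      then have "ip (e i) (e j) = 1" using e(2)[of i i] by simp
      then show "i = j" using e(2)[of i j] ij by (auto split: if_splits)
    qed
    have "L2_orthonormal (e ` {..<Suc k})"
      unfolding L2_orthonormal_def using e(2) inj unfolding ip_def by (auto simp: inj_on_eq_iff)
    moreover have "\<exists>lam\<le>t. P f lam" if f: "f \<in> e ` {..<Suc k}" for f
    proof -
      obtain i where i: "i < Suc k" "f = e i" using f by blast
      have "b + s * \<mu> i \<le> t" using eigen_family_mono[OF E, of i k] i s t
        by (smt (verit) less_Suc_eq_le mult_left_mono lessI)
      moreover have "P f (b + s * \<mu> i)"
        unfolding P using i e s D_L2 ip_eq_0_AE[of "e i"] by (auto simp: subset_iff)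
      ultimately show ?thesis by blast
    qed
    ultimately show "t \<in> ?L" using inj by (auto intro!: exI[of _ "e ` {..<Suc k}"] simp: card_image simp del: lessThan_Suc)
  next
    fix t assume "t \<in> ?L"
    then obtain F where F: "finite F" "card F = Suc k" "L2_orthonormal F" "\<And>f. f \<in> F \<Longrightarrow> \<exists>lam\<le>t. P f lam" by blast
    obtain f where f: "bij_betw f {..<Suc k} F" using F ex_bij_betw_nat_finite[OF F(1)] by (auto simp: lessThan_atLeast0)
    have fF: "f i \<in> F" if "i < Suc k" for i using f that by (auto simp: bij_betw_def)
    have orth: "ip (f i) (f j) = (if i = j then 1 else 0)" if "i < Suc k" "j < Suc k" for i j
      using F(3) fF[OF that(1)] fF[OF that(2)] f that unfolding L2_orthonormal_def ip_def
      by (auto simp: bij_betw_def inj_on_def)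
    have "\<exists>lam. lam \<le> t \<and> P (f i) lam" if "i < Suc k" for i using F(4)[OF fF[OF that]] by blast
    then obtain lam where lam: "\<And>i. i < Suc k \<Longrightarrow> lam i \<le> t \<and> P (f i) (lam i)" by metis
    have fD: "f i \<in> D" if "i < Suc k" for i using lam[OF that] P by blast
    have Qf: "Q (f i) v = (lam i - b) / s * ip (f i) v" if "i < Suc k" "v \<in> D" for i v
      using lam[OF that(1)] P that(2) by blast
    obtain c where c: "\<exists>i<Suc k. c i \<noteq> 0" "\<And>j. j < k \<Longrightarrow> ip (\<lambda>x. \<Sum>i<Suc k. c i * f i x) (e j) = 0"
      using orthogonal_combination[of k f e, OF fD e(1)[OF less_SucI]] by blast
    define w where "w = (\<lambda>x. \<Sum>i<Suc k. c i * f i x)"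
    have wD: "w \<in> D" unfolding w_def using fD lincomb by blast
    have ipw: "ip w w = (\<Sum>i<Suc k. (c i)\<^sup>2)" unfolding w_def using fD orth by (rule orthonormal_combination_norm)
    moreover have "(\<Sum>i<Suc k. (c i)\<^sup>2) > 0" using c(1) by (rule sum_squares_pos)
    ultimately have wpos: "ip w w > 0" by simp
    have "\<mu> k * ip w w \<le> Q w w" using e(4)[of k w] wD c(2) unfolding w_def by auto
    also have "Q w w = (\<Sum>i<Suc k. \<Sum>j<Suc k. c i * c j * Q (f i) (f j))"
      unfolding w_def using fD by (rule Q_lincomb_self)
    also have "\<dots> = (\<Sum>i<Suc k. \<Sum>j<Suc k. c i * c j * ((lam i - b) / s * (if i = j then 1 else 0)))"
      by (intro sum.cong refl) (simp add: Qf fD orth)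
    also have "\<dots> = (\<Sum>i<Suc k. \<Sum>j<Suc k. (c i * c j * ((lam i - b) / s)) * (if i = j then 1 else 0))"
      by (simp only: mult.assoc)
    also have "\<dots> = (\<Sum>i<Suc k. (lam i - b) / s * (c i)\<^sup>2)"
      by (intro sum.cong refl, subst sum_kronecker) (auto simp: power2_eq_square)
    also have "\<dots> \<le> (\<Sum>i<Suc k. (t - b) / s * (c i)\<^sup>2)"
      using lam s by (intro sum_mono mult_right_mono divide_right_mono) auto
    also have "\<dots> = (t - b) / s * ip w w" by (simp only: ipw sum_distrib_left)
    finally have "\<mu> k \<le> (t - b) / s" using wpos by (rule mult_right_le_imp_le)
    then show "t \<in> {b + s * \<mu> k..}" using s by (simp add: field_simps)
  qed
  then show ?thesis unfolding kth_eigenvalue_def by simp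
qed

end

section \<open>Convergence of spectra under Gamma-convergence with a common core\<close>

text \<open>A crude operator norm bound: every product \<open>c i * c j\<close> is at most the sum
  of squares in absolute value, and there are \<open>K\<close> squared of them.\<close>

lemma quad_form_perturb:
  fixes c :: "nat \<Rightarrow> real"
  assumes "\<And>i j. i < K \<Longrightarrow> j < K \<Longrightarrow> \<bar>X i j - Y i j\<bar> \<le> \<eta>"
  shows "\<bar>(\<Sum>i<K. \<Sum>j<K. c i * c j * X i j) - (\<Sum>i<K. \<Sum>j<K. c i * c j * Y i j)\<bar>
     \<le> (real K)\<^sup>2 * \<eta> * (\<Sum>i<K. (c i)\<^sup>2)"
proof -
  define N where "N = (\<Sum>i<K. (c i)\<^sup>2)"
  have N0: "0 \<le> N" unfolding N_def by (intro sum_nonneg) auto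
  have cc: "\<bar>c i * c j\<bar> \<le> N" if "i < K" "j < K" for i j
  proof -
    have i: "(c i)\<^sup>2 \<le> N" unfolding N_def using that by (intro member_le_sum) auto
    have j: "(c j)\<^sup>2 \<le> N" unfolding N_def using that by (intro member_le_sum) auto
    have "2 * \<bar>c i * c j\<bar> \<le> (c i)\<^sup>2 + (c j)\<^sup>2"
      using sum_squares_bound[of "\<bar>c i\<bar>" "\<bar>c j\<bar>"] by (simp add: abs_mult)
    then show ?thesis using i j by simp
  qed
  have "(\<Sum>i<K. \<Sum>j<K. c i * c j * X i j) - (\<Sum>i<K. \<Sum>j<K. c i * c j * Y i j)
      = (\<Sum>i<K. \<Sum>j<K. c i * c j * (X i j - Y i j))"
    by (simp add: sum_subtractf[symmetric] right_diff_distrib)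
  also have "\<bar>\<dots>\<bar> \<le> (\<Sum>i<K. \<bar>\<Sum>j<K. c i * c j * (X i j - Y i j)\<bar>)" by (rule sum_abs)
  also have "\<dots> \<le> (\<Sum>i<K. \<Sum>j<K. \<bar>c i * c j * (X i j - Y i j)\<bar>)" by (intro sum_mono sum_abs)
  also have "\<dots> \<le> (\<Sum>i<K. \<Sum>j<K. N * \<eta>)"
  proof (intro sum_mono)
    fix i j assume "i \<in> {..<K}" "j \<in> {..<K}"
    then show "\<bar>c i * c j * (X i j - Y i j)\<bar> \<le> N * \<eta>"
      unfolding abs_mult[of "c i * c j"] using cc[of i j] assms[of i j] N0 by (intro mult_mono) auto
  qed
  also have "\<dots> = (real K)\<^sup>2 * \<eta> * N" by (simp add: power2_eq_square algebra_simps)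
  finally show ?thesis unfolding N_def .
qed

text \<open>Subsequences are extracted for one index after the other; properties already secured
  survive because they are inherited by subsequences.\<close>

lemma common_subseq:
  assumes "\<And>j r. j < k \<Longrightarrow> strict_mono (r :: nat \<Rightarrow> nat) \<Longrightarrow> \<exists>r'. strict_mono (r' :: nat \<Rightarrow> nat) \<and> P j (r \<circ> r')"
    and "\<And>j r r'. P j r \<Longrightarrow> strict_mono r' \<Longrightarrow> P j (r \<circ> r')"
  shows "\<exists>r. strict_mono (r :: nat \<Rightarrow> nat) \<and> (\<forall>j<k::nat. P j r)"
  using assms(1)
proof (induction k)
  case 0 then show ?case by (auto intro: exI[of _ id] strict_mono_id)
next
  case (Suc k)
  then obtain r where r: "strict_mono r" "\<forall>j<k. P j r" by (metis less_SucI)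
  obtain r' where r': "strict_mono r'" "P k (r \<circ> r')" using Suc.prems[OF _ r(1), of k] by blast
  have "\<forall>j<Suc k. P j (r \<circ> r')" using assms(2) r r' by (auto simp: less_Suc_eq)
  then show ?case using r r' strict_mono_o by blast
qed

lemma filterlim_at_right_0:
  fixes \<sigma> :: "nat \<Rightarrow> real"
  assumes "\<And>n. 0 < \<sigma> n" "\<sigma> \<longlonglongrightarrow> 0"
  shows "filterlim \<sigma> (at_right 0) sequentially"
  using assms less_imp_neq by (fastforce simp: filterlim_at intro!: eventuallyI)

definition eigenpair where
  "eigenpair D Q \<phi> lam \<longleftrightarrow> \<phi> \<in> D \<and> \<not> (AE x in lborel. \<phi> x = 0) \<and> (\<forall>v\<in>D. Q \<phi> v = lam * ip \<phi> v)"

text \<open>Gamma-convergence with a common core: \<open>lsc\<close> is the lower bound, while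
  \<open>core_tendsto\<close> and \<open>core_dense\<close> supply recovery sequences. Since the
  parameters in \<open>cpt\<close> and \<open>lsc\<close> form an arbitrary sequence in
  \<open>[0, s0)\<close>, the same clauses apply to a fixed \<open>s\<close> (constant sequence) and
  to the limit at zero.\<close>

locale gamma_family =
  fixes D :: "real \<Rightarrow> ('a::euclidean_space \<Rightarrow> real) set"
    and Q :: "real \<Rightarrow> ('a \<Rightarrow> real) \<Rightarrow> ('a \<Rightarrow> real) \<Rightarrow> real"
    and core :: "('a \<Rightarrow> real) set" and M s0 :: real
  assumes s0: "0 < s0"
    and form: "0 \<le> s \<Longrightarrow> s < s0 \<Longrightarrow> sym_form (D s) (Q s)"
    and D_L2: "0 \<le> s \<Longrightarrow> s < s0 \<Longrightarrow> D s \<subseteq> L2"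
    and low: "0 \<le> s \<Longrightarrow> s < s0 \<Longrightarrow> f \<in> D s \<Longrightarrow> - M * ip f f \<le> Q s f f"
    and cpt: "(\<And>n::nat. 0 \<le> \<sigma> n) \<Longrightarrow> (\<And>n. \<sigma> n < s0) \<Longrightarrow> (\<And>n. u n \<in> D (\<sigma> n)) \<Longrightarrow> (\<And>n. ip (u n) (u n) = 1) \<Longrightarrow>
        (\<And>n. Q (\<sigma> n) (u n) (u n) \<le> C) \<Longrightarrow> \<exists>r v. strict_mono r \<and> v \<in> L2 \<and> L2_lim (\<lambda>n. u (r n)) v"
    and lsc: "(\<And>n::nat. 0 \<le> \<sigma> n) \<Longrightarrow> (\<And>n. \<sigma> n < s0) \<Longrightarrow> \<sigma> \<longlonglongrightarrow> t \<Longrightarrow> 0 \<le> t \<Longrightarrow> t < s0 \<Longrightarrow>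
        (\<And>n. u n \<in> D (\<sigma> n)) \<Longrightarrow> v \<in> L2 \<Longrightarrow> L2_lim u v \<Longrightarrow> (\<lambda>n. Q (\<sigma> n) (u n) (u n)) \<longlonglongrightarrow> c \<Longrightarrow>
        v \<in> D t \<and> Q t v v \<le> c"
    and core_D: "0 \<le> s \<Longrightarrow> s < s0 \<Longrightarrow> core \<subseteq> D s"
    and core_infinite_dim: "\<exists>f. \<forall>i<k::nat. f i \<in> core \<and> (\<forall>j<k. ip (f i) (f j) = (if i = j then 1 else 0))"
    and core_tendsto: "f \<in> core \<Longrightarrow> g \<in> core \<Longrightarrow> ((\<lambda>s. Q s f g) \<longlongrightarrow> Q 0 f g) (at_right 0)"
    and core_dense: "f \<in> D 0 \<Longrightarrow> \<exists>h. (\<forall>n::nat. h n \<in> core) \<and> L2_lim h f \<and>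
        (\<lambda>n. on_diff (Q 0) (h n) f) \<longlonglongrightarrow> 0"
begin

section \<open>Spectra at a fixed parameter and approximation from the core\<close>

lemma spectral: "0 \<le> s \<Longrightarrow> s < s0 \<Longrightarrow> spectral_form (D s) (Q s) M"
proof (intro spectral_form.intro spectral_form_axioms.intro form D_L2 low)
  fix u :: "nat \<Rightarrow> 'a \<Rightarrow> real" and c
  assume s: "0 \<le> s" "s < s0" and u: "\<And>n. u n \<in> D s" "\<And>n. ip (u n) (u n) = 1" "(\<lambda>n. Q s (u n) (u n)) \<longlonglongrightarrow> c"
  obtain C where C: "\<And>n. Q s (u n) (u n) \<le> C"
  proof -
    have "Bseq (\<lambda>n. Q s (u n) (u n))" using u(3) by (intro convergent_imp_Bseq) (auto simp: convergent_def)
    then show ?thesis using that unfolding Bseq_def by (metis abs_le_D1 real_norm_def)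
  qed
  obtain r v where r: "strict_mono r" "v \<in> L2" "L2_lim (\<lambda>n. u (r n)) v"
    using cpt[of "\<lambda>_. s" u C] s u C by blast
  have "v \<in> D s \<and> Q s v v \<le> c"
    by (rule lsc[of "\<lambda>_. s" s "\<lambda>n. u (r n)"])
      (use s u r LIMSEQ_subseq_LIMSEQ[OF u(3) r(1)] in \<open>auto simp: o_def\<close>)
  then show "\<exists>r v. strict_mono r \<and> v \<in> D s \<and> L2_lim (\<lambda>n. u (r n)) v \<and> Q s v v \<le> c" using r by blast
next
  fix k :: nat assume "0 \<le> s" "s < s0"
  then show "\<exists>f. \<forall>i<k. f i \<in> D s \<and> (\<forall>j<k. ip (f i) (f j) = (if i = j then 1 else 0))"
    using core_infinite_dim[of k] core_D[of s] by (meson subsetD)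
qed auto

text \<open>Indices count from zero here, in step with \<open>eigen_family\<close>, whereas
  \<open>kth_eigenvalue\<close> counts from one.\<close>

definition ev :: "nat \<Rightarrow> real \<Rightarrow> real" where
  "ev k s = kth_eigenvalue (eigenpair (D s) (Q s)) (Suc k)"

lemma ev_eq: "0 \<le> s \<Longrightarrow> s < s0 \<Longrightarrow> eigen_family (D s) (Q s) (Suc k) e \<mu> \<Longrightarrow> ev k s = \<mu> k"
  unfolding ev_def
  using spectral_form.kth_eigenvalue_eq[OF spectral, of s k e \<mu> 1 "eigenpair (D s) (Q s)" 0]
  by (simp add: eigenpair_def)

text \<open>\<open>Q 0\<close> is only bounded below; the shift by \<open>M\<close> makes it
  nonnegative, so that Cauchy-Schwarz and \<open>tendsto_form\<close> become available.\<close>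

lemma psd0: "psd_form (D 0) (\<lambda>f g. Q 0 f g + M * ip f g)"
proof -
  interpret spectral_form "D 0" "Q 0" M using spectral s0 by simp
  have "sym_form (D 0) (\<lambda>f g. 1 * Q 0 f g + M * ip f g)" by (rule add_sym_form[OF ip_form])
  then show ?thesis
    by (intro psd_form.intro psd_form_axioms.intro) (use bounded_below in \<open>fastforce+\<close>)
qed

lemma core_approx:
  assumes "u \<in> D 0"
  obtains v where "\<And>n. v n \<in> core" "L2_lim v u"
    "(\<lambda>n. on_diff (Q 0) (v n) u + M * on_diff ip (v n) u) \<longlonglongrightarrow> 0"
proof -
  obtain v where v: "\<And>n. v n \<in> core" "L2_lim v u" "(\<lambda>n. on_diff (Q 0) (v n) u) \<longlonglongrightarrow> 0"
    using core_dense[OF assms] by blast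
  have "(\<lambda>n. on_diff (Q 0) (v n) u + M * on_diff ip (v n) u) \<longlonglongrightarrow> 0 + M * 0"
    using v by (intro tendsto_intros) (auto simp: L2_lim_def)
  then have "(\<lambda>n. on_diff (Q 0) (v n) u + M * on_diff ip (v n) u) \<longlonglongrightarrow> 0" by simp
  then show ?thesis using that v by blast
qed

lemma core_approx_tendsto:
  assumes "\<And>n. v n \<in> core" "u \<in> D 0" "L2_lim v u" "\<And>n. v' n \<in> core" "u' \<in> D 0" "L2_lim v' u'"
    "(\<lambda>n. on_diff (Q 0) (v n) u + M * on_diff ip (v n) u) \<longlonglongrightarrow> 0"
    "(\<lambda>n. on_diff (Q 0) (v' n) u' + M * on_diff ip (v' n) u') \<longlonglongrightarrow> 0"
  shows "(\<lambda>n. ip (v n) (v' n)) \<longlonglongrightarrow> ip u u'" "(\<lambda>n. Q 0 (v n) (v' n)) \<longlonglongrightarrow> Q 0 u u'"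
proof -
  have c: "core \<subseteq> D 0" "D 0 \<subseteq> L2" using core_D D_L2 s0 by auto
  show ip: "(\<lambda>n. ip (v n) (v' n)) \<longlonglongrightarrow> ip u u'"
    by (rule ip_tendsto) (use assms c in auto)
  have "(\<lambda>n. Q 0 (v n) (v' n) + M * ip (v n) (v' n)) \<longlonglongrightarrow> Q 0 u u' + M * ip u u'"
    using psd_form.tendsto_form[OF psd0 _ _ assms(2,5,7,8)] assms c by blast
  from tendsto_diff[OF this tendsto_mult_left[OF ip, of M]]
  show "(\<lambda>n. Q 0 (v n) (v' n)) \<longlonglongrightarrow> Q 0 u u'" by simp
qed

text \<open>Testing lower semicontinuity on \<open>u\<^sub>n + t w\<close> for every real \<open>t\<close> forces the limit to solve the
  weak equation: a linear function of \<open>t\<close> bounded below is constant.\<close>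

lemma limit_eigenfunction:
  assumes \<sigma>: "\<And>n::nat. 0 < \<sigma> n" "\<And>n. \<sigma> n < s0" "\<sigma> \<longlonglongrightarrow> 0"
    and u: "\<And>n. u n \<in> D (\<sigma> n)" "\<And>n. ip (u n) (u n) = 1"
    and eq: "\<And>n w. w \<in> D (\<sigma> n) \<Longrightarrow> Q (\<sigma> n) (u n) w = m n * ip (u n) w"
    and m: "m \<longlonglongrightarrow> c" and v: "v \<in> L2" "L2_lim u v"
  shows "v \<in> D 0" "ip v v = 1" "\<And>w. w \<in> D 0 \<Longrightarrow> Q 0 v w = c * ip v w"
proof -
  have \<sigma>0: "0 \<le> \<sigma> n" for n using \<sigma>(1)[of n] by simp
  interpret F: sym_form "D (\<sigma> n)" "Q (\<sigma> n)" for n using form \<sigma>0 \<sigma> by blast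
  interpret F0: sym_form "D 0" "Q 0" using form s0 by blast
  have uL2: "u n \<in> L2" for n using D_L2 \<sigma>0 \<sigma> u by blast
  have Qu: "Q (\<sigma> n) (u n) (u n) = m n" for n using eq[OF u(1)] u(2) by simp
  have v0: "v \<in> D 0 \<and> Q 0 v v \<le> c"
    by (rule lsc[OF \<sigma>0 \<sigma>(2,3)]) (use u v m s0 Qu in auto)
  then show vD: "v \<in> D 0" ..
  show ipv: "ip v v = 1"
    using ip_tendsto[OF uL2 uL2 v(1) v(1) v(2) v(2)] u(2) by (simp add: LIMSEQ_const_iff)
  have core: "Q 0 v w = c * ip v w" if w: "w \<in> core" for w
  proof -
    have wD: "w \<in> D (\<sigma> n)" for n using core_D \<sigma>0 \<sigma> w by blast
    have wD0: "w \<in> D 0" using core_D s0 w by blast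
    have wL2: "w \<in> L2" using D_L2 s0 wD0 by blast
    have const: "L2_lim (\<lambda>n. g) g" for g :: "'a \<Rightarrow> real" by (simp add: L2_lim_def ip_def)
    have ipw: "(\<lambda>n. ip (u n) w) \<longlonglongrightarrow> ip v w"
      using ip_tendsto[OF uL2 _ v(1) wL2 v(2) const] wL2 by blast
    have Qw: "(\<lambda>n. Q (\<sigma> n) w w) \<longlonglongrightarrow> Q 0 w w"
      using core_tendsto[OF w w] filterlim_at_right_0[OF \<sigma>(1,3)] by (rule filterlim_compose)
    have *: "0 \<le> (c - Q 0 v v) + 2 * t * (c * ip v w - Q 0 v w) + t\<^sup>2 * 0" for t
    proof -
      have "(\<lambda>x. v x + t * w x) \<in> D 0 \<and> Q 0 (\<lambda>x. v x + t * w x) (\<lambda>x. v x + t * w x) \<le> c + 2 * t * (c * ip v w) + t\<^sup>2 * Q 0 w w"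
      proof (rule lsc[OF \<sigma>0 \<sigma>(2,3)])
        show "(\<lambda>x. u n x + t * w x) \<in> D (\<sigma> n)" for n using F.lin[OF u(1) wD, of 1 n t] by simp
        show "(\<lambda>x. v x + t * w x) \<in> L2" using L2_lin[OF v(1) wL2, of 1 t] by simp
        show "L2_lim (\<lambda>n x. u n x + t * w x) (\<lambda>x. v x + t * w x)" using v(2) by (simp add: L2_lim_def)
        have "(\<lambda>n. m n + 2 * t * (m n * ip (u n) w) + t\<^sup>2 * Q (\<sigma> n) w w) \<longlonglongrightarrow> c + 2 * t * (c * ip v w) + t\<^sup>2 * Q 0 w w"
          using m ipw Qw by (intro tendsto_intros)
        then show "(\<lambda>n. Q (\<sigma> n) (\<lambda>x. u n x + t * w x) (\<lambda>x. u n x + t * w x)) \<longlonglongrightarrow> c + 2 * t * (c * ip v w) + t\<^sup>2 * Q 0 w w"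
          by (simp only: F.Q_add_scaled[OF u(1) wD] Qu eq[OF wD])
      qed (use s0 in auto)
      then show ?thesis by (simp add: F0.Q_add_scaled[OF vD wD0] algebra_simps)
    qed
    have "(c * ip v w - Q 0 v w)\<^sup>2 \<le> (c - Q 0 v v) * 0" by (rule quadratic_nonneg_coeff[OF *])
    then show ?thesis by simp
  qed
  fix w assume w: "w \<in> D 0"
  \<comment> \<open>The equation is now known against the core; approximation in the shifted form
    seminorm carries it to every \<open>w\<close> in \<open>D 0\<close>.\<close>
  obtain g where g: "\<And>n. g n \<in> core" "L2_lim g w"
    "(\<lambda>n. on_diff (Q 0) (g n) w + M * on_diff ip (g n) w) \<longlonglongrightarrow> 0"
    using core_approx[OF w] by blast
  have gD: "g n \<in> D 0" for n using core_D s0 g by blast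
  have "(\<lambda>n. Q 0 v (g n) + M * ip v (g n)) \<longlonglongrightarrow> Q 0 v w + M * ip v w"
    by (rule psd_form.tendsto_form[OF psd0]) (use vD gD w g F0.Q_zero[OF F0.zero] in \<open>auto simp: ip_def\<close>)
  moreover have "Q 0 v (g n) + M * ip v (g n) = (c + M) * ip v (g n)" for n
    using core[OF g(1)] by (simp add: algebra_simps)
  moreover have "(\<lambda>n. ip v (g n)) \<longlonglongrightarrow> ip v w"
  proof (rule ip_tendsto)
    show "g n \<in> L2" for n using gD D_L2 s0 by blast
    show "w \<in> L2" using w D_L2 s0 by blast
  qed (use v g in \<open>auto simp: L2_lim_def ip_def\<close>)
  then have "(\<lambda>n. (c + M) * ip v (g n)) \<longlonglongrightarrow> (c + M) * ip v w" by (intro tendsto_intros)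
  ultimately have "Q 0 v w + M * ip v w = (c + M) * ip v w" by (auto intro: LIMSEQ_unique)
  then show "Q 0 v w = c * ip v w" by (simp add: algebra_simps)
qed

text \<open>The first \<open>k + 1\<close> limit eigenfunctions are replaced by core functions,
  which are legitimate trial functions for every small \<open>s\<close>. Their Gram and energy
  matrices are nearly diagonal, so every combination has Rayleigh quotient at most slightly above
  \<open>\<mu> k\<close>; one of them is admissible in the minimisation for
  \<open>ev k s\<close>.\<close>

lemma ev_limsup:
  assumes "\<epsilon> > 0"
  shows "eventually (\<lambda>s. ev k s \<le> ev k 0 + \<epsilon>) (at_right 0)"
proof -
  interpret S0: spectral_form "D 0" "Q 0" M using spectral s0 by blast
  obtain e \<mu> where E: "eigen_family (D 0) (Q 0) (Suc k) e \<mu>" using S0.eigen_family_exists by blast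
  let ?K = "Suc k"
  have e: "\<And>i. i < ?K \<Longrightarrow> e i \<in> D 0"
    "\<And>i j. i < ?K \<Longrightarrow> j < ?K \<Longrightarrow> ip (e i) (e j) = (if i = j then 1 else 0)"
    "\<And>i v. i < ?K \<Longrightarrow> v \<in> D 0 \<Longrightarrow> Q 0 (e i) v = \<mu> i * ip (e i) v"
    using E by (auto simp: eigen_family_def)
  define approx where "approx i v \<longleftrightarrow> (\<forall>n. v n \<in> core) \<and> L2_lim v (e i) \<and>
    (\<lambda>n. on_diff (Q 0) (v n) (e i) + M * on_diff ip (v n) (e i)) \<longlonglongrightarrow> 0"
    for i v
  have "\<exists>v. approx i v" if "i < ?K" for i
    unfolding approx_def using core_approx[OF e(1)[OF that]] by blast
  then obtain V where "\<And>i. i < ?K \<Longrightarrow> approx i (V i)" by metis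
  then have V: "\<And>i n. i < ?K \<Longrightarrow> V i n \<in> core" "\<And>i. i < ?K \<Longrightarrow> L2_lim (V i) (e i)"
    "\<And>i. i < ?K \<Longrightarrow> (\<lambda>n. on_diff (Q 0) (V i n) (e i) + M * on_diff ip (V i n) (e i)) \<longlonglongrightarrow> 0"
    unfolding approx_def by blast+
  define \<delta> where "\<delta> i j = (if i = j then 1 else 0 :: real)" for i j :: nat
  have G: "(\<lambda>n. ip (V i n) (V j n)) \<longlonglongrightarrow> \<delta> i j" if "i < ?K" "j < ?K" for i j
    using core_approx_tendsto(1)[OF V(1)[OF that(1)] e(1)[OF that(1)] V(2)[OF that(1)] V(1)[OF that(2)] e(1)[OF that(2)] V(2)[OF that(2)] V(3)[OF that(1)] V(3)[OF that(2)]] e(2)[OF that] by (simp add: \<delta>_def)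
  have q: "(\<lambda>n. Q 0 (V i n) (V j n)) \<longlonglongrightarrow> \<mu> i * \<delta> i j" if "i < ?K" "j < ?K" for i j
    using core_approx_tendsto(2)[OF V(1)[OF that(1)] e(1)[OF that(1)] V(2)[OF that(1)] V(1)[OF that(2)] e(1)[OF that(2)] V(2)[OF that(2)] V(3)[OF that(1)] V(3)[OF that(2)]] e(2)[OF that] e(3)[OF that(1) e(1)[OF that(2)]]
    by (simp add: \<delta>_def)
  \<comment> \<open>Subtracting \<open>\<mu> k\<close> times the Gram matrix gives a limit matrix
    that is diagonal with nonpositive entries. Rayleigh quotients are thus compared without
    dividing.\<close>
  have R: "(\<lambda>n. Q 0 (V i n) (V j n) - \<mu> k * ip (V i n) (V j n)) \<longlonglongrightarrow> (\<mu> i - \<mu> k) * \<delta> i j" if "i < ?K" "j < ?K" for i j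
    using tendsto_diff[OF q[OF that] tendsto_mult_left[OF G[OF that], of "\<mu> k"]] by (simp add: algebra_simps)
  \<comment> \<open>Entrywise errors \<open>\<eta>\<close> are amplified by \<open>K\<close> squared
    in a quadratic form. The choice leaves a relative error of at most 1/8 in the norm and
    \<epsilon>/8 in the energy.\<close>
  define \<eta> where "\<eta> = min 1 \<epsilon> / (8 * (real ?K)\<^sup>2)"
  have \<eta>: "\<eta> > 0" "(real ?K)\<^sup>2 * \<eta> \<le> 1 / 8" "(real ?K)\<^sup>2 * \<eta> \<le> \<epsilon> / 8"
    using assms by (auto simp: \<eta>_def)
  have "eventually (\<lambda>n. \<forall>i\<in>{..<?K}. \<forall>j\<in>{..<?K}. \<bar>ip (V i n) (V j n) - \<delta> i j\<bar> < \<eta> \<and>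
      \<bar>(Q 0 (V i n) (V j n) - \<mu> k * ip (V i n) (V j n)) - (\<mu> i - \<mu> k) * \<delta> i j\<bar> < \<eta>) sequentially"
    by (intro eventually_ball_finite ballI finite_lessThan eventually_conj)
      (use tendstoD[OF G \<eta>(1)] tendstoD[OF R \<eta>(1)] in \<open>auto simp: dist_real_def\<close>)
  then obtain n where n: "\<And>i j. i < ?K \<Longrightarrow> j < ?K \<Longrightarrow> \<bar>ip (V i n) (V j n) - \<delta> i j\<bar> < \<eta>"
    "\<And>i j. i < ?K \<Longrightarrow> j < ?K \<Longrightarrow> \<bar>(Q 0 (V i n) (V j n) - \<mu> k * ip (V i n) (V j n)) - (\<mu> i - \<mu> k) * \<delta> i j\<bar> < \<eta>"
    unfolding eventually_sequentially by (auto simp del: lessThan_Suc)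
  \<comment> \<open>The approximation index is frozen before \<open>s\<close> varies, because
    \<open>core_tendsto\<close> is a statement about fixed functions.\<close>
  define f where "f i = V i n" for i
  have fc: "f i \<in> core" if "i < ?K" for i using V(1) that by (simp add: f_def)
  have "eventually (\<lambda>s. \<forall>i\<in>{..<?K}. \<forall>j\<in>{..<?K}. \<bar>Q s (f i) (f j) - Q 0 (f i) (f j)\<bar> < \<eta>) (at_right 0)"
    by (intro eventually_ball_finite ballI finite_lessThan)
      (use tendstoD[OF core_tendsto[OF fc fc] \<eta>(1)] in \<open>auto simp: dist_real_def\<close>)
  moreover have "eventually (\<lambda>s. 0 < s \<and> s < s0) (at_right 0)"
    using eventually_at_right[OF s0] s0 by auto
  ultimately show ?thesis
  proof eventually_elim
    case (elim s)
    then have s: "0 \<le> s" "s < s0" by auto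
    interpret S: spectral_form "D s" "Q s" M using spectral s by blast
    have fD: "f i \<in> D s" if "i < ?K" for i using fc core_D s that by blast
    obtain e' \<mu>' where E': "eigen_family (D s) (Q s) (Suc k) e' \<mu>'" using S.eigen_family_exists by blast
    then have e': "\<And>i. i < ?K \<Longrightarrow> e' i \<in> D s" "\<And>v. v \<in> D s \<Longrightarrow> (\<forall>j<k. ip v (e' j) = 0) \<Longrightarrow> \<mu>' k * ip v v \<le> Q s v v"
      by (auto simp: eigen_family_def)
    obtain c where c: "\<exists>i<Suc k. c i \<noteq> 0" "\<And>j. j < k \<Longrightarrow> ip (\<lambda>x. \<Sum>i<Suc k. c i * f i x) (e' j) = 0"
      using S.orthogonal_combination[of k f e', OF fD e'(1)[OF less_SucI]] by blast
    define w where "w = (\<lambda>x. \<Sum>i<Suc k. c i * f i x)"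
    have wD: "w \<in> D s" unfolding w_def using fD S.lincomb by blast
    define N where "N = (\<Sum>i<?K. (c i)\<^sup>2)"
    have N: "N > 0" unfolding N_def using c(1) by (rule sum_squares_pos)
    have diag: "(\<Sum>i<?K. \<Sum>j<?K. c i * c j * (a i * \<delta> i j)) = (\<Sum>i<?K. a i * (c i)\<^sup>2)" for a
    proof (rule sum.cong[OF refl])
      fix i assume i: "i \<in> {..<Suc k}"
      have "(\<Sum>j<Suc k. c i * c j * (a i * \<delta> i j)) = (\<Sum>j<Suc k. if i = j then a i * (c i)\<^sup>2 else 0)"
        by (intro sum.cong) (auto simp: power2_eq_square \<delta>_def)
      also have "\<dots> = a i * (c i)\<^sup>2" using i by (simp add: sum.delta' del: lessThan_Suc sum.lessThan_Suc)
      finally show "(\<Sum>j<Suc k. c i * c j * (a i * \<delta> i j)) = a i * (c i)\<^sup>2" .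
    qed
    have ipw: "ip w w = (\<Sum>i<?K. \<Sum>j<?K. c i * c j * ip (f i) (f j))"
      unfolding w_def using fD by (rule S.ipD.Q_lincomb_self)
    have Qw: "Q s w w = (\<Sum>i<?K. \<Sum>j<?K. c i * c j * Q s (f i) (f j))"
      unfolding w_def using fD by (rule S.Q_lincomb_self)
    have "\<bar>ip w w - (\<Sum>i<?K. \<Sum>j<?K. c i * c j * (1 * \<delta> i j))\<bar> \<le> (real ?K)\<^sup>2 * \<eta> * N"
      unfolding ipw N_def using n(1) by (intro quad_form_perturb) (auto simp: f_def less_imp_le)
    then have "\<bar>ip w w - N\<bar> \<le> (real ?K)\<^sup>2 * \<eta> * N" unfolding diag N_def by simp
    also have "\<dots> \<le> 1 / 8 * N" using \<eta> N by (intro mult_right_mono) auto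
    finally have ipN: "ip w w \<ge> N / 2" using N by linarith
    have RQ: "Q s w w - \<mu> k * ip w w = (\<Sum>i<?K. \<Sum>j<?K. c i * c j * (Q s (f i) (f j) - \<mu> k * ip (f i) (f j)))"
      unfolding Qw ipw sum_distrib_left sum_subtractf[symmetric] by (intro sum.cong) (auto simp: algebra_simps)
    have "\<bar>(Q s w w - \<mu> k * ip w w) - (\<Sum>i<?K. \<Sum>j<?K. c i * c j * ((\<mu> i - \<mu> k) * \<delta> i j))\<bar> \<le> (real ?K)\<^sup>2 * (2 * \<eta>) * N"
      unfolding RQ N_def
    proof (intro quad_form_perturb)
      fix i j assume ij: "i < ?K" "j < ?K"
      have "\<bar>Q s (f i) (f j) - Q 0 (f i) (f j)\<bar> < \<eta>" using elim ij by blast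
      then show "\<bar>Q s (f i) (f j) - \<mu> k * ip (f i) (f j) - (\<mu> i - \<mu> k) * \<delta> i j\<bar> \<le> 2 * \<eta>"
        using n(2)[OF ij] unfolding f_def by linarith
    qed
    then have "Q s w w - \<mu> k * ip w w \<le> (\<Sum>i<?K. (\<mu> i - \<mu> k) * (c i)\<^sup>2) + (real ?K)\<^sup>2 * (2 * \<eta>) * N"
      unfolding diag by linarith
    also have "(\<Sum>i<?K. (\<mu> i - \<mu> k) * (c i)\<^sup>2) \<le> 0"
      using S0.eigen_family_mono[OF E, of _ k] by (intro sum_nonpos mult_nonpos_nonneg) auto
    also have "(real ?K)\<^sup>2 * (2 * \<eta>) * N = 2 * ((real ?K)\<^sup>2 * \<eta>) * N" by simp
    also have "\<dots> \<le> 2 * (\<epsilon> / 8) * N" using \<eta> N by (intro mult_right_mono) auto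
    finally have 1: "Q s w w - \<mu> k * ip w w \<le> \<epsilon> / 4 * N" by simp
    have "\<mu>' k * ip w w \<le> Q s w w" using e'(2)[OF wD] c(2) unfolding w_def by blast
    then have 2: "(\<mu>' k - \<mu> k) * ip w w \<le> \<epsilon> / 4 * N" using 1 by (simp add: algebra_simps)
    \<comment> \<open>The bound \<open>ip w w \<ge> N / 2\<close> can be multiplied in only when the
      gap is positive, hence the argument by contradiction: \<open>\<epsilon> * N / 2\<close> would
      be at most \<open>\<epsilon> * N / 4\<close>.\<close>
    have "\<mu>' k - \<mu> k \<le> \<epsilon>"
    proof (rule ccontr)
      assume "\<not> \<mu>' k - \<mu> k \<le> \<epsilon>"
      then have "\<epsilon> * (N / 2) \<le> (\<mu>' k - \<mu> k) * ip w w" using assms N ipN by (intro mult_mono) auto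
      then show False using 2 mult_pos_pos[OF assms N] by linarith
    qed
    then show ?case using ev_eq[OF s E'] ev_eq[OF _ _ E] s0 by simp
  qed
qed

text \<open>The first \<open>k + 1\<close> eigenfunctions subconverge together with their
  eigenvalues. The limits are orthonormal eigenfunctions of \<open>Q 0\<close> with eigenvalues at
  most \<open>b\<close>, so on their span the Rayleigh quotient is at most \<open>b\<close>, and
  some element of the span competes for \<open>ev k 0\<close>.\<close>

lemma ev_liminf_seq:
  assumes \<sigma>: "\<And>n::nat. 0 < \<sigma> n" "\<And>n. \<sigma> n < s0" "\<sigma> \<longlonglongrightarrow> 0" and b: "\<And>n. ev k (\<sigma> n) \<le> b"
  shows "ev k 0 \<le> b"
proof -
  have \<sigma>0: "0 \<le> \<sigma> n" for n using \<sigma>(1)[of n] by simp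
  have "\<exists>e \<mu>. eigen_family (D (\<sigma> n)) (Q (\<sigma> n)) (Suc k) e \<mu>" for n
    using spectral_form.eigen_family_exists[OF spectral[OF \<sigma>0 \<sigma>(2)]] .
  then obtain e \<mu> where E: "\<And>n. eigen_family (D (\<sigma> n)) (Q (\<sigma> n)) (Suc k) (e n) (\<mu> n)" by metis
  have e: "\<And>n i. i < Suc k \<Longrightarrow> e n i \<in> D (\<sigma> n)"
    "\<And>n i j. i < Suc k \<Longrightarrow> j < Suc k \<Longrightarrow> ip (e n i) (e n j) = (if i = j then 1 else 0)"
    "\<And>n i v. i < Suc k \<Longrightarrow> v \<in> D (\<sigma> n) \<Longrightarrow> Q (\<sigma> n) (e n i) v = \<mu> n i * ip (e n i) v"
    using E by (auto simp: eigen_family_def)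
  have eL2: "e n i \<in> L2" if "i < Suc k" for n i using e(1)[OF that] D_L2[OF \<sigma>0 \<sigma>(2)] by blast
  have \<mu>b: "\<mu> n i \<le> b" if "i < Suc k" for n i
    using spectral_form.eigen_family_mono[OF spectral[OF \<sigma>0 \<sigma>(2)] E, of i k n] that b[of n] ev_eq[OF \<sigma>0 \<sigma>(2) E, of n] by simp
  have \<mu>l: "- M \<le> \<mu> n i" if "i < Suc k" for n i
    using low[OF \<sigma>0 \<sigma>(2) e(1)[OF that, of n]] e(3)[OF that e(1)[OF that, of n]] e(2)[OF that that, of n] by simp
  \<comment> \<open>The limits are quantified inside \<open>P\<close>, which makes it hereditary
    under subsequences as \<open>common_subseq\<close> demands.\<close>
  define P where "P i r \<longleftrightarrow> (\<exists>v c. v \<in> L2 \<and> L2_lim (\<lambda>n. e (r n) i) v \<and> (\<lambda>n. \<mu> (r n) i) \<longlonglongrightarrow> c)" for i and r :: "nat \<Rightarrow> nat"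
  have "\<exists>r. strict_mono r \<and> (\<forall>j<Suc k. P j r)"
  proof (rule common_subseq)
    fix i and r :: "nat \<Rightarrow> nat" assume i: "i < Suc k" and r: "strict_mono r"
    have "\<exists>r1 v. strict_mono r1 \<and> v \<in> L2 \<and> L2_lim (\<lambda>n. e (r (r1 n)) i) v"
      using cpt[of "\<lambda>n. \<sigma> (r n)" "\<lambda>n. e (r n) i" b] \<sigma>0 \<sigma> e[OF i] i \<mu>b[OF i] by auto
    then obtain r1 v where r1: "strict_mono r1" "v \<in> L2" "L2_lim (\<lambda>n. e (r (r1 n)) i) v" by blast
    have "bounded (range (\<lambda>n. \<mu> (r (r1 n)) i))"
      by (rule boundedI[of _ "\<bar>b\<bar> + \<bar>M\<bar>"]) (use \<mu>b[OF i] \<mu>l[OF i] in \<open>auto simp: abs_le_iff\<close>, (smt (verit))+)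
    then obtain c r2 where r2: "strict_mono r2" "((\<lambda>n. \<mu> (r (r1 n)) i) \<circ> r2) \<longlonglongrightarrow> c"
      using bounded_imp_convergent_subsequence by blast
    have "P i (r \<circ> (r1 \<circ> r2))" unfolding P_def using r1 r2 L2_lim_subseq[OF r1(3) r2(1)] by (auto simp: o_def)
    then show "\<exists>r'. strict_mono r' \<and> P i (r \<circ> r')" using r1 r2 strict_mono_o by blast
  next
    fix i and r r' :: "nat \<Rightarrow> nat" assume "P i r" "strict_mono r'"
    then show "P i (r \<circ> r')" unfolding P_def using L2_lim_subseq LIMSEQ_subseq_LIMSEQ by (fastforce simp: o_def)
  qed
  then obtain r where r: "strict_mono r" "\<And>i. i < Suc k \<Longrightarrow> P i r" by blast
  then obtain v c where v: "\<And>i. i < Suc k \<Longrightarrow> v i \<in> L2" "\<And>i. i < Suc k \<Longrightarrow> L2_lim (\<lambda>n. e (r n) i) (v i)"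
    "\<And>i. i < Suc k \<Longrightarrow> (\<lambda>n. \<mu> (r n) i) \<longlonglongrightarrow> c i" unfolding P_def by metis
  have \<sigma>r: "(\<lambda>n. \<sigma> (r n)) \<longlonglongrightarrow> 0" using LIMSEQ_subseq_LIMSEQ[OF \<sigma>(3) r(1)] by (simp add: o_def)
  have lim: "v i \<in> D 0" "\<And>w. w \<in> D 0 \<Longrightarrow> Q 0 (v i) w = c i * ip (v i) w" if i: "i < Suc k" for i
    using limit_eigenfunction[of "\<lambda>n. \<sigma> (r n)" "\<lambda>n. e (r n) i" "\<lambda>n. \<mu> (r n) i" "c i" "v i"] \<sigma> \<sigma>r e i v[OF i] by auto
  have orth: "ip (v i) (v j) = (if i = j then 1 else 0)" if "i < Suc k" "j < Suc k" for i j
    using ip_tendsto[OF eL2 eL2 v(1) v(1) v(2) v(2), of i j] that e(2)[OF that] by (simp add: LIMSEQ_const_iff)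
  have cb: "c i \<le> b" if "i < Suc k" for i using v(3)[OF that] \<mu>b[OF that] by (intro LIMSEQ_le_const2) auto
  interpret S: spectral_form "D 0" "Q 0" M using spectral s0 by blast
  obtain e0 \<mu>0 where E0: "eigen_family (D 0) (Q 0) (Suc k) e0 \<mu>0" using S.eigen_family_exists by blast
  then have e0: "\<And>i. i < Suc k \<Longrightarrow> e0 i \<in> D 0" "\<And>v. v \<in> D 0 \<Longrightarrow> (\<forall>j<k. ip v (e0 j) = 0) \<Longrightarrow> \<mu>0 k * ip v v \<le> Q 0 v v"
      by (auto simp: eigen_family_def)
  obtain a where a: "\<exists>i<Suc k. a i \<noteq> 0" "\<And>j. j < k \<Longrightarrow> ip (\<lambda>x. \<Sum>i<Suc k. a i * v i x) (e0 j) = 0"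
    using S.orthogonal_combination[of k v e0, OF lim(1) e0(1)[OF less_SucI]] by blast
  define w where "w = (\<lambda>x. \<Sum>i<Suc k. a i * v i x)"
  have wD: "w \<in> D 0" unfolding w_def using lim S.lincomb by blast
  have ipw: "ip w w = (\<Sum>i<Suc k. (a i)\<^sup>2)" unfolding w_def using lim(1) orth by (rule S.orthonormal_combination_norm)
  moreover have "(\<Sum>i<Suc k. (a i)\<^sup>2) > 0" using a(1) by (rule sum_squares_pos)
  ultimately have wpos: "ip w w > 0" by simp
  have "\<mu>0 k * ip w w \<le> Q 0 w w" using e0(2)[OF wD] a(2) unfolding w_def by auto
  also have "Q 0 w w = (\<Sum>i<Suc k. a i * Q 0 (v i) w)"
    using S.Q_lincomb[of "Suc k" v w a] lim(1) wD by (simp only: w_def)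
  also have "\<dots> = (\<Sum>i<Suc k. a i * (c i * a i))"
  proof (intro sum.cong refl)
    fix i assume i: "i \<in> {..<Suc k}"
    have "ip w (v i) = (\<Sum>j<Suc k. a j * ip (v j) (v i))"
      unfolding w_def using lim(1) i by (intro S.ipD.Q_lincomb) auto
    also have "\<dots> = (\<Sum>j<Suc k. if j = i then a i else 0)" using orth i by (intro sum.cong) auto
    also have "\<dots> = a i" using i by (simp add: sum.delta del: lessThan_Suc sum.lessThan_Suc)
    finally show "a i * Q 0 (v i) w = a i * (c i * a i)" using lim(2)[OF _ wD, of i] i by (simp add: ip_commute)
  qed
  also have "\<dots> \<le> (\<Sum>i<Suc k. b * (a i)\<^sup>2)"
  proof (intro sum_mono)
    fix i assume "i \<in> {..<Suc k}"
    then have "c i * (a i)\<^sup>2 \<le> b * (a i)\<^sup>2" using cb by (intro mult_right_mono) auto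
    then show "a i * (c i * a i) \<le> b * (a i)\<^sup>2" by (simp add: power2_eq_square mult_ac)
  qed
  also have "\<dots> = b * ip w w" by (simp only: ipw sum_distrib_left)
  finally show ?thesis using wpos ev_eq[OF _ _ E0] s0 by simp
qed

text \<open>The upper half is \<open>ev_limsup\<close>. If the lower half failed, some null sequence
  would have eigenvalues at most \<open>ev k 0 - \<epsilon>\<close>, and
  \<open>ev_liminf_seq\<close> with this bound is absurd.\<close>

theorem ev_tendsto: "((\<lambda>s. ev k s) \<longlongrightarrow> ev k 0) (at_right 0)"
proof (rule tendstoI)
  fix \<epsilon> :: real assume \<epsilon>: "\<epsilon> > 0"
  have "eventually (\<lambda>s. ev k 0 - \<epsilon> < ev k s) (at_right 0)"
  proof (rule ccontr)
    assume neg: "\<not> ?thesis"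
    have "\<exists>s. 0 < s \<and> s < min s0 (1 / real (Suc n)) \<and> ev k s \<le> ev k 0 - \<epsilon>" for n
    proof (rule ccontr)
      assume no: "\<not> ?thesis"
      have "eventually (\<lambda>s. 0 < s \<and> s < min s0 (1 / real (Suc n))) (at_right 0)"
        by (rule eventually_at_rightI[of 0 "min s0 (1 / real (Suc n))"]) (use s0 in auto)
      then have "eventually (\<lambda>s. ev k 0 - \<epsilon> < ev k s) (at_right 0)"
        by eventually_elim (use no in force)
      then show False using neg by blast
    qed
    then obtain \<sigma> where \<sigma>: "\<And>n. 0 < \<sigma> n \<and> \<sigma> n < min s0 (1 / real (Suc n)) \<and> ev k (\<sigma> n) \<le> ev k 0 - \<epsilon>" by metis
    have "\<sigma> \<longlonglongrightarrow> 0"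
    proof (rule tendsto_sandwich[of "\<lambda>_. 0" _ _ "\<lambda>n. 1 / real (Suc n)"])
      show "\<forall>\<^sub>F n in sequentially. \<sigma> n \<le> 1 / real (Suc n)" using \<sigma> by (intro always_eventually) (auto intro: less_imp_le)
      show "\<forall>\<^sub>F n in sequentially. 0 \<le> \<sigma> n" using \<sigma> by (intro always_eventually) (auto intro: less_imp_le)
    qed (auto simp: LIMSEQ_Suc[OF lim_1_over_n, simplified])
    then have "ev k 0 \<le> ev k 0 - \<epsilon>" using \<sigma> by (intro ev_liminf_seq[of \<sigma>]) auto
    then show False using \<epsilon> by simp
  qed
  moreover have "eventually (\<lambda>s. ev k s \<le> ev k 0 + \<epsilon> / 2) (at_right 0)" using \<epsilon> by (intro ev_limsup) simp
  ultimately show "eventually (\<lambda>s. dist (ev k s) (ev k 0) < \<epsilon>) (at_right 0)"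
    by eventually_elim (use \<epsilon> in \<open>auto simp: dist_real_def abs_less_iff\<close>)
qed

text \<open>Convergence of the eigenvalues bounds the energies, so \<open>cpt\<close> applies and
  \<open>limit_eigenfunction\<close> identifies the limit. The norm passes to the limit, which
  excludes the zero function.\<close>

theorem eigenfunctions_subconverge:
  assumes \<sigma>: "\<And>n::nat. 0 < \<sigma> n" "\<And>n. \<sigma> n < s0" "\<sigma> \<longlonglongrightarrow> 0"
    and u: "\<And>n. eigenpair (D (\<sigma> n)) (Q (\<sigma> n)) (u n) (ev k (\<sigma> n))" "\<And>n. ip (u n) (u n) = 1"
  obtains r v where "strict_mono r" "eigenpair (D 0) (Q 0) v (ev k 0)" "ip v v = 1" "L2_lim (\<lambda>n. u (r n)) v"
proof -
  have lim: "(\<lambda>n. ev k (\<sigma> n)) \<longlonglongrightarrow> ev k 0"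
    using ev_tendsto filterlim_at_right_0[OF \<sigma>(1,3)] by (rule filterlim_compose)
  have uD: "u n \<in> D (\<sigma> n)" "\<And>w. w \<in> D (\<sigma> n) \<Longrightarrow> Q (\<sigma> n) (u n) w = ev k (\<sigma> n) * ip (u n) w" for n
    using u(1)[of n] by (auto simp: eigenpair_def)
  obtain C where C: "\<And>n. ev k (\<sigma> n) \<le> C"
  proof -
    have "Bseq (\<lambda>n. ev k (\<sigma> n))" using lim by (intro convergent_imp_Bseq) (auto simp: convergent_def)
    then show ?thesis using that unfolding Bseq_def by (metis abs_le_D1 real_norm_def)
  qed
  obtain r v where r: "strict_mono r" "v \<in> L2" "L2_lim (\<lambda>n. u (r n)) v"
    using cpt[of \<sigma> u C] \<sigma> uD u(2) C by (auto simp: less_imp_le)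
  have v: "v \<in> D 0" "ip v v = 1" "\<And>w. w \<in> D 0 \<Longrightarrow> Q 0 v w = ev k 0 * ip v w"
    using limit_eigenfunction[of "\<lambda>n. \<sigma> (r n)" "\<lambda>n. u (r n)" "\<lambda>n. ev k (\<sigma> (r n))" "ev k 0" v] \<sigma> uD u(2) r
      LIMSEQ_subseq_LIMSEQ[OF \<sigma>(3) r(1)] LIMSEQ_subseq_LIMSEQ[OF lim r(1)] by (auto simp: o_def)
  then have "eigenpair (D 0) (Q 0) v (ev k 0)"
    using ip_eq_0_AE[OF r(2)] by (auto simp: eigenpair_def)
  then show ?thesis using that r v by blast
qed

end

section \<open>Integration on euclidean space\<close>

abbreviation lborel2 :: "('a::euclidean_space \<times> 'a) measure" where
  "lborel2 \<equiv> lborel \<Otimes>\<^sub>M lborel"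

lemma nn_integral_lborel_reflect:
  fixes f :: "'a::euclidean_space \<Rightarrow> ennreal"
  assumes [measurable]: "f \<in> borel_measurable borel"
  shows "(\<integral>\<^sup>+y. f (x - y) \<partial>lborel) = (\<integral>\<^sup>+y. f y \<partial>lborel)"
proof -
  have "(\<integral>\<^sup>+y. f y \<partial>lborel) = (\<integral>\<^sup>+y. f y \<partial>density (distr lborel borel (\<lambda>y. x + (-1) *\<^sub>R y)) (\<lambda>_. \<bar>-1::real\<bar>^DIM('a)))"
    by (subst lborel_affine[of "-1" x]) auto
  also have "\<dots> = (\<integral>\<^sup>+y. f (x - y) \<partial>lborel)"
    by (subst nn_integral_density) (auto simp: nn_integral_distr)
  finally show ?thesis ..
qed

lemma nn_integral_pair_shift:
  fixes F :: "'a::euclidean_space \<times> 'a \<Rightarrow> ennreal"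
  assumes [measurable]: "F \<in> borel_measurable (borel \<Otimes>\<^sub>M borel)"
  shows "(\<integral>\<^sup>+p. F p \<partial>lborel2) = (\<integral>\<^sup>+x. \<integral>\<^sup>+z. F (x, x - z) \<partial>lborel \<partial>lborel)"
proof -
  have "(\<integral>\<^sup>+p. F p \<partial>lborel2) = (\<integral>\<^sup>+x. \<integral>\<^sup>+y. F (x, y) \<partial>lborel \<partial>lborel)"
    by (rule lborel.nn_integral_fst[symmetric]) (use assms in \<open>simp cong: measurable_cong_sets sets_pair_measure_cong\<close>)
  also have "\<dots> = (\<integral>\<^sup>+x. \<integral>\<^sup>+z. F (x, x - z) \<partial>lborel \<partial>lborel)"
    by (intro nn_integral_cong nn_integral_lborel_reflect[symmetric]) measurable
  finally show ?thesis .
qed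

lemma nn_integral_pair_convolution:
  fixes G H :: "'a::euclidean_space \<Rightarrow> ennreal"
  assumes [measurable]: "G \<in> borel_measurable borel" "H \<in> borel_measurable borel"
  shows "(\<integral>\<^sup>+p. G (fst p) * H (fst p - snd p) \<partial>lborel2) = (\<integral>\<^sup>+x. G x \<partial>lborel) * (\<integral>\<^sup>+z. H z \<partial>lborel)"
  by (subst nn_integral_pair_shift) (auto simp: nn_integral_cmult nn_integral_multc)

lemma nn_integral_pair_swap:
  fixes F :: "'a::euclidean_space \<times> 'a \<Rightarrow> ennreal"
  assumes [measurable]: "F \<in> borel_measurable (borel \<Otimes>\<^sub>M borel)"
  shows "(\<integral>\<^sup>+p. F (snd p, fst p) \<partial>lborel2) = (\<integral>\<^sup>+p. F p \<partial>lborel2)"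
proof -
  have F: "F \<in> borel_measurable lborel2"
    using assms by (simp cong: measurable_cong_sets sets_pair_measure_cong)
  have "(\<integral>\<^sup>+p. F p \<partial>lborel2) = (\<integral>\<^sup>+p. F p \<partial>distr lborel2 lborel2 (\<lambda>(x, y). (y, x)))"
    using lborel_pair.distr_pair_swap[where 'a='a and 'b='a] by simp
  also have "\<dots> = (\<integral>\<^sup>+p. F (snd p, fst p) \<partial>lborel2)"
    using F by (subst nn_integral_distr) (auto simp: case_prod_beta)
  finally show ?thesis ..
qed

lemma AE_pair_fst:
  fixes P :: "'a::euclidean_space \<Rightarrow> bool"
  assumes "AE x in lborel. P x"
  shows "AE p in (lborel \<Otimes>\<^sub>M (lborel :: 'a measure)). P (fst p)"
    and "AE p in ((lborel :: 'a measure) \<Otimes>\<^sub>M lborel). P (snd p)"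
proof -
  obtain N where N: "{x. \<not> P x} \<subseteq> N" "emeasure lborel N = 0" "N \<in> sets lborel"
    using assms by (rule AE_E) auto
  have ae: "AE x in lborel. x \<notin> N" using N by (intro AE_not_in) auto
  have [measurable]: "N \<in> sets borel" using N by simp
  have "AE p in (lborel \<Otimes>\<^sub>M (lborel :: 'a measure)). fst p \<notin> N"
  proof (rule lborel_pair.AE_pair_measure)
    show "{p \<in> space (lborel \<Otimes>\<^sub>M (lborel :: 'a measure)). fst p \<notin> N} \<in> sets lborel2" by measurable
  qed (use ae in auto)
  then show "AE p in (lborel \<Otimes>\<^sub>M (lborel :: 'a measure)). P (fst p)" using N by (auto elim: eventually_mono)
  have "AE p in ((lborel :: 'a measure) \<Otimes>\<^sub>M lborel). snd p \<notin> N"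
  proof (rule lborel_pair.AE_pair_measure)
    show "{p \<in> space (lborel \<Otimes>\<^sub>M (lborel :: 'a measure)). snd p \<notin> N} \<in> sets lborel2" by measurable
  qed (use ae in auto)
  then show "AE p in ((lborel :: 'a measure) \<Otimes>\<^sub>M lborel). P (snd p)" using N by (auto elim: eventually_mono)
qed

subsection \<open>Radial integrals\<close>

text \<open>The area of the unit sphere, obtained as the derivative at radius one of the ball
  volume.\<close>

definition sphere_area :: "'a::euclidean_space itself \<Rightarrow> real" where
  "sphere_area T = real DIM('a) * unit_ball_vol (real DIM('a))"

lemma sphere_area_pos: "sphere_area TYPE('a::euclidean_space) > 0"
  by (simp add: sphere_area_def)

text \<open>Polar coordinates for radial functions: the two measures agree on the half-lines, where
  both give ball volumes, and the half-lines generate the Borel sets.\<close>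

lemma distr_norm_lborel:
  "distr lborel borel (norm :: 'a::euclidean_space \<Rightarrow> real) =
     density lborel (\<lambda>t. ennreal (sphere_area TYPE('a) * t ^ (DIM('a) - 1)) * indicator {0..} t)"
    (is "?M = ?N")
proof (rule measure_eqI_generator_eq[where E="range (\<lambda>a. {..a::real})" and \<Omega>=UNIV and A="\<lambda>n. {..real n}"])
  let ?n = "DIM('a)"
  have n: "?n > 0" by simp
  have em: "emeasure ?M {..a} = ennreal (unit_ball_vol (real ?n) * a ^ ?n) * indicator {0..} a" for a
  proof -
    have "emeasure ?M {..a} = emeasure lborel (cball (0::'a) a)"
      by (subst emeasure_distr) (auto simp: cball_def intro!: arg_cong[where f="emeasure lborel"])
    then show ?thesis by (cases "0 \<le> a") (auto simp: emeasure_cball)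
  qed
  have en: "emeasure ?N {..a} = ennreal (unit_ball_vol (real ?n) * a ^ ?n) * indicator {0..} a" for a
  proof (cases "0 \<le> a")
    case True
    have "emeasure ?N {..a} = (\<integral>\<^sup>+t. ennreal (sphere_area TYPE('a) * t ^ (?n - 1)) * indicator {0..a} t \<partial>lborel)"
      by (subst emeasure_density) (auto intro!: nn_integral_cong simp: indicator_def)
    also have "\<dots> = ennreal (unit_ball_vol (real ?n) * a ^ ?n - unit_ball_vol (real ?n) * 0 ^ ?n)"
    proof (rule nn_integral_FTC_Icc)
      fix x :: real assume "x \<in> {0..a}"
      then show "0 \<le> sphere_area TYPE('a) * x ^ (?n - 1)" by (simp add: sphere_area_def)
      show "DERIV (\<lambda>t. unit_ball_vol (real ?n) * t ^ ?n) x :> sphere_area TYPE('a) * x ^ (?n - 1)"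
        unfolding sphere_area_def by (auto intro!: derivative_eq_intros)
    qed (use True in auto)
    finally show ?thesis using True n by simp
  next
    case False
    have "emeasure ?N {..a} = (\<integral>\<^sup>+t. ennreal (sphere_area TYPE('a) * t ^ (?n - 1)) * indicator {0..} t * indicator {..a} t \<partial>lborel)"
      by (subst emeasure_density) auto
    also have "\<dots> = (\<integral>\<^sup>+t. 0 \<partial>(lborel :: real measure))"
      by (intro nn_integral_cong) (use False in \<open>auto split: split_indicator\<close>)
    finally show ?thesis using False by simp
  qed
  show "emeasure ?M X = emeasure ?N X" if "X \<in> range (\<lambda>a. {..a})" for X using that em en by auto
  show "Int_stable (range (\<lambda>a. {..a::real}))"
    by (auto simp: Int_stable_def)
  show "sets ?M = sigma_sets UNIV (range (\<lambda>a. {..a::real}))" by (simp add: borel_eq_atMost)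
  show "sets ?N = sigma_sets UNIV (range (\<lambda>a. {..a::real}))" by (simp add: borel_eq_atMost)
  show "(\<Union>i::nat. {..real i}) = UNIV" using real_arch_simple by auto
  show "emeasure ?M {..real i} \<noteq> \<infinity>" for i by (subst em) (auto simp: indicator_def)
qed auto

lemma nn_integral_radial:
  fixes f :: "real \<Rightarrow> ennreal"
  assumes [measurable]: "f \<in> borel_measurable borel"
  shows "(\<integral>\<^sup>+z. f (norm (z::'a::euclidean_space)) \<partial>lborel) =
    (\<integral>\<^sup>+t. f t * (ennreal (sphere_area TYPE('a) * t powr (real DIM('a) - 1)) * indicator {0<..} t) \<partial>lborel)"
proof -
  have "(\<integral>\<^sup>+z. f (norm (z::'a)) \<partial>lborel) = (\<integral>\<^sup>+t. f t \<partial>distr lborel borel (norm :: 'a \<Rightarrow> real))"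
    by (simp add: nn_integral_distr)
  also have "\<dots> = (\<integral>\<^sup>+t. ennreal (sphere_area TYPE('a) * t ^ (DIM('a) - 1)) * indicator {0..} t * f t \<partial>lborel)"
    unfolding distr_norm_lborel by (subst nn_integral_density) auto
  also have "\<dots> = (\<integral>\<^sup>+t. f t * (ennreal (sphere_area TYPE('a) * t powr (real DIM('a) - 1)) * indicator {0<..} t) \<partial>lborel)"
  proof (rule nn_integral_cong_AE)
    \<comment> \<open>The origin must be discarded: in dimension one the density is
      \<open>0 ^ 0 = 1\<close> there on one side, while \<open>0 powr 0 = 0\<close> on the
      other.\<close>
    have "AE t in lborel. t \<noteq> (0::real)" by (rule AE_lborel_singleton)
    then show "AE t in lborel. ennreal (sphere_area TYPE('a) * t ^ (DIM('a) - 1)) * indicator {0..} t * f t =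
       f t * (ennreal (sphere_area TYPE('a) * t powr (real DIM('a) - 1)) * indicator {0<..} t)"
    proof eventually_elim
      case (elim t)
      have "t powr (real DIM('a) - 1) = t ^ (DIM('a) - 1)" if "t > 0"
        using that powr_realpow[of t "DIM('a) - 1"] DIM_positive[where 'a='a] by (simp add: of_nat_diff Suc_leI)
      then show ?case using elim by (auto simp: indicator_def mult_ac)
    qed
  qed
  finally show ?thesis .
qed

text \<open>Used with \<open>\<beta> = 1\<close> for Lipschitz differences, with
  \<open>\<beta> = 1/2\<close> for cutoffs, and with \<open>\<beta>\<close> tending to zero to see
  the divergence at the critical exponent.\<close>

lemma nn_integral_norm_powr_near:
  fixes \<beta> :: real
  assumes "\<beta> > 0"
  shows "(\<integral>\<^sup>+z. ennreal (indicator {z. norm z < 1} z * norm z powr (\<beta> - real DIM('a))) \<partial>(lborel :: 'a::euclidean_space measure))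
    = ennreal (sphere_area TYPE('a) / \<beta>)"
proof -
  let ?w = "sphere_area TYPE('a)"
  have "(\<integral>\<^sup>+z. ennreal (indicator {z. norm z < 1} z * norm z powr (\<beta> - real DIM('a))) \<partial>(lborel :: 'a measure))
     = (\<integral>\<^sup>+z. ennreal (indicator {..<1} (norm (z::'a)) * norm z powr (\<beta> - real DIM('a))) \<partial>lborel)"
    by (intro nn_integral_cong) (auto simp: indicator_def)
  also have "\<dots> = (\<integral>\<^sup>+t. ennreal (indicator {..<1} t * t powr (\<beta> - real DIM('a))) *
       (ennreal (?w * t powr (real DIM('a) - 1)) * indicator {0<..} t) \<partial>lborel)"
    by (rule nn_integral_radial[of "\<lambda>t. ennreal (indicator {..<1} t * t powr (\<beta> - real DIM('a)))"]) auto
  also have "\<dots> = (\<integral>\<^sup>+t. ennreal (indicator {0..1} t * (?w * t powr (\<beta> - 1))) \<partial>lborel)"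
  proof (rule nn_integral_cong_AE)
    have "AE t in lborel. t \<noteq> (1::real)" by (rule AE_lborel_singleton)
    then show "AE t in lborel. ennreal (indicator {..<1} t * t powr (\<beta> - real DIM('a))) *
       (ennreal (?w * t powr (real DIM('a) - 1)) * indicator {0<..} t) = ennreal (indicator {0..1} t * (?w * t powr (\<beta> - 1)))"
    proof eventually_elim
      case (elim t)
      have "t powr (\<beta> - real DIM('a)) * (?w * t powr (real DIM('a) - 1)) = ?w * t powr (\<beta> - 1)"
        by (simp add: powr_add[symmetric])
      then show ?case using elim sphere_area_pos[where 'a='a]
        by (auto simp: indicator_def ennreal_mult'[symmetric])
    qed
  qed
  also have "\<dots> = ennreal (?w / \<beta>)"
  proof (rule nn_integral_has_integral_lborel)
    have "((\<lambda>t. ?w * t powr (\<beta> - 1)) has_integral ?w * (1 powr (\<beta> - 1 + 1) / (\<beta> - 1 + 1))) {0..1}"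
      by (intro has_integral_mult_right has_integral_powr_from_0) (use assms in auto)
    then have "((\<lambda>t. if t \<in> {0..1} then ?w * t powr (\<beta> - 1) else 0) has_integral ?w / \<beta>) UNIV"
      by (simp only: has_integral_restrict_UNIV) simp
    moreover have "(\<lambda>t. if t \<in> {0..1} then ?w * t powr (\<beta> - 1) else 0) = (\<lambda>t. indicator {0..1} t * (?w * t powr (\<beta> - 1)))"
      by (auto simp: indicator_def)
    ultimately show "((\<lambda>t. indicator {0..1} t * (?w * t powr (\<beta> - 1))) has_integral ?w / \<beta>) UNIV" by simp
  qed (use sphere_area_pos[where 'a='a] in auto)
  finally show ?thesis .
qed

text \<open>The blow-up \<open>1 / (2 * s)\<close> cancels the factor \<open>s\<close> of
  \<open>C_Ns\<close>; this is where the L2 inner product inside \<open>Es\<close> comes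
  from.\<close>

lemma nn_integral_norm_powr_far:
  fixes s :: real
  assumes "s > 0"
  shows "(\<integral>\<^sup>+z. ennreal (indicator {z. norm z \<ge> 1} z / norm z powr (real DIM('a) + 2 * s)) \<partial>(lborel :: 'a::euclidean_space measure))
    = ennreal (sphere_area TYPE('a) / (2 * s))"
proof -
  let ?w = "sphere_area TYPE('a)"
  have "(\<integral>\<^sup>+z. ennreal (indicator {z. norm z \<ge> 1} z / norm z powr (real DIM('a) + 2 * s)) \<partial>(lborel :: 'a measure))
     = (\<integral>\<^sup>+z. ennreal (indicator {1..} (norm (z::'a)) / norm z powr (real DIM('a) + 2 * s)) \<partial>lborel)"
    by (intro nn_integral_cong) (auto simp: indicator_def)
  also have "\<dots> = (\<integral>\<^sup>+t. ennreal (indicator {1..} t / t powr (real DIM('a) + 2 * s)) *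
       (ennreal (?w * t powr (real DIM('a) - 1)) * indicator {0<..} t) \<partial>lborel)"
    by (rule nn_integral_radial[of "\<lambda>t. ennreal (indicator {1..} t / t powr (real DIM('a) + 2 * s))"]) auto
  also have "\<dots> = (\<integral>\<^sup>+t. ennreal (indicator {1..} t * (?w * t powr (- 2 * s - 1))) \<partial>lborel)"
  proof (intro nn_integral_cong)
    fix t :: real
    have "1 / t powr (real DIM('a) + 2 * s) * (?w * t powr (real DIM('a) - 1)) = ?w * t powr (- 2 * s - 1)" if "t \<ge> 1"
    proof -
      have "t powr (real DIM('a) - 1) = t powr (- 2 * s - 1) * t powr (real DIM('a) + 2 * s)"
        by (simp add: powr_add[symmetric])
      then show ?thesis using that by simp
    qed
    then show "ennreal (indicator {1..} t / t powr (real DIM('a) + 2 * s)) *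
       (ennreal (?w * t powr (real DIM('a) - 1)) * indicator {0<..} t) = ennreal (indicator {1..} t * (?w * t powr (- 2 * s - 1)))"
      using sphere_area_pos[where 'a='a] by (auto simp: indicator_def ennreal_mult'[symmetric])
  qed
  also have "\<dots> = ennreal (?w / (2 * s))"
  proof (rule nn_integral_has_integral_lborel)
    have "((\<lambda>t. ?w * t powr (- 2 * s - 1)) has_integral ?w * (- (1 powr (- 2 * s - 1 + 1)) / (- 2 * s - 1 + 1))) {1..}"
      by (intro has_integral_mult_right has_integral_powr_to_inf) (use assms in auto)
    then have "((\<lambda>t. if t \<in> {1..} then ?w * t powr (- 2 * s - 1) else 0) has_integral ?w / (2 * s)) UNIV"
      by (simp only: has_integral_restrict_UNIV) (use assms in simp)
    moreover have "(\<lambda>t. if t \<in> {1..} then ?w * t powr (- 2 * s - 1) else 0) = (\<lambda>t. indicator {1..} t * (?w * t powr (- 2 * s - 1)))"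
      by (auto simp: indicator_def)
    ultimately show "((\<lambda>t. indicator {1..} t * (?w * t powr (- 2 * s - 1))) has_integral ?w / (2 * s)) UNIV" by simp
  qed (use sphere_area_pos[where 'a='a] in auto)
  finally show ?thesis .
qed

text \<open>Inside the unit ball the critical power dominates every subcritical one, and
  \<open>\<beta>\<close> can be chosen so that the subcritical integral is any prescribed
  \<open>n\<close>.\<close>

lemma nn_integral_norm_powr_critical:
  "(\<integral>\<^sup>+z. ennreal (indicator {z. norm z < 1} z / norm z powr real DIM('a)) \<partial>(lborel :: 'a::euclidean_space measure)) = \<infinity>"
    (is "?I = _")
proof -
  have "ennreal (real n) \<le> ?I" if n: "n > 0" for n :: nat
  proof -
    define \<beta> where "\<beta> = sphere_area TYPE('a) / real n"
    have \<beta>: "\<beta> > 0" using sphere_area_pos[where 'a='a] n by (simp add: \<beta>_def)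
    have "ennreal (real n) = ennreal (sphere_area TYPE('a) / \<beta>)"
      using sphere_area_pos[where 'a='a] n by (simp add: \<beta>_def)
    also have "\<dots> = (\<integral>\<^sup>+z. ennreal (indicator {z. norm z < 1} z * norm z powr (\<beta> - real DIM('a))) \<partial>(lborel :: 'a measure))"
      using nn_integral_norm_powr_near[OF \<beta>] ..
    also have "\<dots> \<le> ?I"
    proof (intro nn_integral_mono ennreal_leI)
      fix z :: 'a
      have "norm z powr \<beta> \<le> 1" if "norm z < 1" using that \<beta> powr_mono2[of \<beta> "norm z" 1] by simp
      then show "indicator {z. norm z < 1} z * norm z powr (\<beta> - real DIM('a)) \<le> indicator {z. norm z < 1} z / norm z powr real DIM('a)"
        by (auto simp: indicator_def powr_diff divide_right_mono)
    qed
    finally show ?thesis .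
  qed
  note * = this
  show ?thesis
  proof (rule ccontr)
    assume "?I \<noteq> \<infinity>"
    then have "?I < top" by (simp add: top.not_eq_extremum)
    then obtain n where n: "?I < of_nat n" using ennreal_Ex_less_of_nat by blast
    then have "n > 0" by (cases n) auto
    from *[OF this] n show False by (simp add: ennreal_of_nat_eq_real_of_nat)
  qed
qed

section \<open>The normalised forms\<close>

text \<open>Here \<open>cfun s\<close> is \<open>C_Ns s / s\<close>, continued to \<open>C_N\<close> at \<open>s = 0\<close>. Splitting the kernel at
  \<open>|x - y| = 1\<close> and computing the integral of \<open>|z| powr (- N - 2 s)\<close> over \<open>|z| \<ge> 1\<close> gives
  \<open>Es s u v = ip u v + s * Qf s u v\<close> for \<open>s > 0\<close>, while \<open>EL = Qf 0\<close>.\<close>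

definition near :: "real \<Rightarrow> 'a::euclidean_space \<times> 'a \<Rightarrow> real" where
  "near s p = indicator {p. norm (fst p - snd p) < 1} p / norm (fst p - snd p) powr (real DIM('a) + 2 * s)"

definition far :: "real \<Rightarrow> 'a::euclidean_space \<times> 'a \<Rightarrow> real" where
  "far s p = indicator {p. norm (fst p - snd p) \<ge> 1} p / norm (fst p - snd p) powr (real DIM('a) + 2 * s)"

definition dif :: "('a::euclidean_space \<Rightarrow> real) \<Rightarrow> 'a \<times> 'a \<Rightarrow> real" where
  "dif u p = u (fst p) - u (snd p)"

definition nearE :: "real \<Rightarrow> ('a::euclidean_space \<Rightarrow> real) \<Rightarrow> ('a \<Rightarrow> real) \<Rightarrow> real" where
  "nearE s u v = (\<integral>p. near s p * (dif u p * dif v p) \<partial>lborel2)"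

definition farB :: "real \<Rightarrow> ('a::euclidean_space \<Rightarrow> real) \<Rightarrow> ('a \<Rightarrow> real) \<Rightarrow> real" where
  "farB s u v = (\<integral>p. far s p * (u (fst p) * v (snd p)) \<partial>lborel2)"

definition cfun :: "'a::euclidean_space itself \<Rightarrow> real \<Rightarrow> real" where
  "cfun T s = 4 powr s * Gamma (dimN T / 2 + s) / (pi powr (dimN T / 2) * Gamma (1 - s))"

text \<open>The difference quotient of \<open>cfun / C_N\<close> at the origin, completed by the
  derivative as its value at zero; this keeps \<open>Qf\<close> continuous in the parameter.\<close>

definition rhof :: "'a::euclidean_space itself \<Rightarrow> real \<Rightarrow> real" where
  "rhof T s = (if s = 0 then rho_N T else (cfun T s / C_N T - 1) / s)"

definition Qf :: "real \<Rightarrow> ('a::euclidean_space \<Rightarrow> real) \<Rightarrow> ('a \<Rightarrow> real) \<Rightarrow> real" where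
  "Qf s u v = cfun TYPE('a) s / 2 * nearE s u v - cfun TYPE('a) s * farB s u v + rhof TYPE('a) s * ip u v"

text \<open>Only the near part of the energy is constrained. For \<open>s > 0\<close> the far part
  is finite on all of L2, and for \<open>s = 0\<close> the logarithmic space is defined by the near
  part alone, so one definition covers every parameter.\<close>

definition Dom :: "'a::euclidean_space set \<Rightarrow> real \<Rightarrow> ('a \<Rightarrow> real) set" where
  "Dom \<Omega> s = {u\<in>L2. vanishes_off \<Omega> u \<and> integrable lborel2 (\<lambda>p. near s p * (dif u p)\<^sup>2)}"

section \<open>Kernels, near energy and its domain\<close>

lemma near_measurable [measurable]: "near s \<in> borel_measurable (borel \<Otimes>\<^sub>M borel)"
  unfolding near_def by measurable

lemma far_measurable [measurable]: "far s \<in> borel_measurable (borel \<Otimes>\<^sub>M borel)"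
  unfolding far_def by measurable

lemma dif_measurable [measurable]:
  assumes [measurable]: "u \<in> borel_measurable borel"
  shows "dif u \<in> borel_measurable (borel \<Otimes>\<^sub>M borel)"
  unfolding dif_def by measurable

lemma near_nonneg [simp]: "0 \<le> near s p" by (simp add: near_def)
lemma far_nonneg [simp]: "0 \<le> far s p" by (simp add: far_def)

text \<open>At distances below one a larger exponent means a larger kernel. Hence the domains are
  nested, and energy bounds descend to \<open>s = 0\<close>.\<close>

lemma near_mono:
  assumes "s \<le> t" shows "near s p \<le> near t (p :: 'a::euclidean_space \<times> 'a)"
\<comment> \<open>On the diagonal \<open>0 powr _ = 0\<close> and division by zero make the kernel
  vanish, so these points need their own case.\<close>
proof (cases "norm (fst p - snd p) < 1 \<and> fst p \<noteq> snd p")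
  case True
  then have "norm (fst p - snd p) powr (real DIM('a) + 2 * t) \<le> norm (fst p - snd p) powr (real DIM('a) + 2 * s)"
    using assms by (intro powr_mono') auto
  then show ?thesis using True by (auto simp: near_def intro!: divide_left_mono)
qed (auto simp: near_def)

lemma far_le_1:
  assumes "0 \<le> s" shows "far s (p :: 'a::euclidean_space \<times> 'a) \<le> 1"
proof (cases "norm (fst p - snd p) \<ge> 1")
  case True
  then have "1 \<le> norm (fst p - snd p) powr (real DIM('a) + 2 * s)"
    using assms by (intro ge_one_powr_ge_zero) auto
  then have "1 / norm (fst p - snd p) powr (real DIM('a) + 2 * s) \<le> 1 / 1"
    by (intro divide_left_mono) auto
  then show ?thesis using True by (auto simp: far_def)
qed (auto simp: far_def)

lemma dif_lin: "dif (\<lambda>x. a * u x + b * v x) p = a * dif u p + b * dif v p"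
  by (simp add: dif_def algebra_simps)

lemma near_mult_integrable:
  assumes "u \<in> borel_measurable borel" "v \<in> borel_measurable borel"
    "integrable lborel2 (\<lambda>p. near s p * (dif u p)\<^sup>2)"
    "integrable lborel2 (\<lambda>p. near s p * (dif v p)\<^sup>2)"
  shows "integrable lborel2 (\<lambda>p. near s p * (dif u p * dif v p))"
proof (rule Bochner_Integration.integrable_bound)
  show "integrable lborel2 (\<lambda>p. near s p * (dif u p)\<^sup>2 + near s p * (dif v p)\<^sup>2)"
    using assms by auto
  show "(\<lambda>p. near s p * (dif u p * dif v p)) \<in> borel_measurable lborel2"
    using assms(1,2) by measurable
  show "AE p in lborel2. norm (near s p * (dif u p * dif v p)) \<le> norm (near s p * (dif u p)\<^sup>2 + near s p * (dif v p)\<^sup>2)"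
  proof (rule AE_I2)
    fix p
    have "2 * \<bar>dif u p * dif v p\<bar> \<le> (dif u p)\<^sup>2 + (dif v p)\<^sup>2"
      using sum_squares_bound[of "\<bar>dif u p\<bar>" "\<bar>dif v p\<bar>"] by (simp add: abs_mult)
    then have "near s p * \<bar>dif u p * dif v p\<bar> \<le> near s p * ((dif u p)\<^sup>2 + (dif v p)\<^sup>2)"
      by (intro mult_left_mono) auto
    then show "norm (near s p * (dif u p * dif v p)) \<le> norm (near s p * (dif u p)\<^sup>2 + near s p * (dif v p)\<^sup>2)"
      using near_nonneg[of s p] by (simp add: abs_mult distrib_left)
  qed
qed

lemma vanishes_off_lin: "vanishes_off \<Omega> u \<Longrightarrow> vanishes_off \<Omega> v \<Longrightarrow> vanishes_off \<Omega> (\<lambda>x. a * u x + b * v x)"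
  unfolding vanishes_off_def by (erule eventually_elim2, assumption) auto

lemma DomD:
  assumes "u \<in> Dom \<Omega> s"
  shows "u \<in> L2" "vanishes_off \<Omega> u" "u \<in> borel_measurable borel"
    "integrable lborel2 (\<lambda>p. near s p * (dif u p)\<^sup>2)"
  using assms by (auto simp: Dom_def L2_def)

lemma Dom_near_integrable:
  "u \<in> Dom \<Omega> s \<Longrightarrow> v \<in> Dom \<Omega> s \<Longrightarrow> integrable lborel2 (\<lambda>p. near s p * (dif u p * dif v p))"
  using near_mult_integrable[of u v s] by (auto dest: DomD)

lemma Dom_lin:
  assumes "u \<in> Dom \<Omega> s" "v \<in> Dom \<Omega> s"
  shows "(\<lambda>x. a * u x + b * v x) \<in> Dom \<Omega> s"
proof -
  have "integrable lborel2 (\<lambda>p. a\<^sup>2 * (near s p * (dif u p)\<^sup>2) + 2 * a * b * (near s p * (dif u p * dif v p)) + b\<^sup>2 * (near s p * (dif v p)\<^sup>2))"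
    using DomD(4)[OF assms(1)] DomD(4)[OF assms(2)] Dom_near_integrable[OF assms]
    by (intro Bochner_Integration.integrable_add integrable_mult_right)
  then have "integrable lborel2 (\<lambda>p. near s p * (dif (\<lambda>x. a * u x + b * v x) p)\<^sup>2)"
    by (rule Bochner_Integration.integrable_cong[THEN iffD1, rotated -1])
      (auto simp: dif_lin power2_eq_square algebra_simps)
  then show ?thesis using assms by (auto simp: Dom_def intro: L2_lin vanishes_off_lin)
qed

lemma Dom_zero: "(\<lambda>x. 0) \<in> Dom \<Omega> s"
  by (auto simp: Dom_def L2_zero vanishes_off_def dif_def)

lemma nearE_commute: "nearE s u v = nearE s v u"
  by (simp add: nearE_def mult.commute)

lemma nearE_lin:
  assumes "u \<in> Dom \<Omega> s" "v \<in> Dom \<Omega> s" "w \<in> Dom \<Omega> s"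
  shows "nearE s (\<lambda>x. a * u x + b * v x) w = a * nearE s u w + b * nearE s v w"
proof -
  have "nearE s (\<lambda>x. a * u x + b * v x) w = (\<integral>p. a * (near s p * (dif u p * dif w p)) + b * (near s p * (dif v p * dif w p)) \<partial>lborel2)"
    unfolding nearE_def dif_lin by (intro Bochner_Integration.integral_cong) (auto simp: algebra_simps)
  also have "\<dots> = a * nearE s u w + b * nearE s v w"
    unfolding nearE_def using Dom_near_integrable assms by (subst Bochner_Integration.integral_add) auto
  finally show ?thesis .
qed

lemma nearE_nonneg: "0 \<le> nearE s u u"
  unfolding nearE_def by (intro integral_nonneg_AE AE_I2) simp

lemma near_psd_form: "psd_form (Dom \<Omega> s) (nearE s)"
  by unfold_locales (auto simp: Dom_zero Dom_lin nearE_lin nearE_nonneg intro: nearE_commute)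

lemma nearE_eq_nn:
  assumes "u \<in> Dom \<Omega> s"
  shows "ennreal (nearE s u u) = (\<integral>\<^sup>+p. ennreal (near s p * (dif u p)\<^sup>2) \<partial>lborel2)"
  unfolding nearE_def power2_eq_square[symmetric]
  using DomD(4)[OF assms] by (intro nn_integral_eq_integral[symmetric]) auto

lemma Dom_mono:
  assumes "s \<le> t" "u \<in> Dom \<Omega> t"
  shows "u \<in> Dom \<Omega> s" "nearE s u u \<le> nearE t u u"
proof -
  have le: "near s p * (dif u p)\<^sup>2 \<le> near t p * (dif u p)\<^sup>2" for p
    using near_mono[OF assms(1), of p] by (intro mult_right_mono) auto
  have int: "integrable lborel2 (\<lambda>p. near s p * (dif u p)\<^sup>2)"
  proof (rule Bochner_Integration.integrable_bound[OF DomD(4)[OF assms(2)]])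
    show "(\<lambda>p. near s p * (dif u p)\<^sup>2) \<in> borel_measurable lborel2"
      using DomD(3)[OF assms(2)] by measurable
  qed (use le in simp)
  then show "u \<in> Dom \<Omega> s" using DomD[OF assms(2)] by (auto simp: Dom_def)
  show "nearE s u u \<le> nearE t u u"
    unfolding nearE_def power2_eq_square[symmetric]
    using int DomD(4)[OF assms(2)] le by (intro integral_mono) auto
qed

lemma DomI_nn:
  assumes "u \<in> L2" "vanishes_off \<Omega> u" "(\<integral>\<^sup>+p. ennreal (near s p * (dif u p)\<^sup>2) \<partial>lborel2) \<le> ennreal C" "0 \<le> C"
  shows "u \<in> Dom \<Omega> s" "nearE s u u \<le> C"
proof -
  have [measurable]: "u \<in> borel_measurable borel" using assms(1) by (simp add: L2_def)
  have int: "integrable lborel2 (\<lambda>p. near s p * (dif u p)\<^sup>2)"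
  proof (rule integrableI_nonneg)
    show "(\<integral>\<^sup>+p. ennreal (near s p * (dif u p)\<^sup>2) \<partial>lborel2) < \<infinity>"
      using assms(3) by (simp add: le_less_trans)
  qed auto
  then show D: "u \<in> Dom \<Omega> s" using assms by (auto simp: Dom_def)
  show "nearE s u u \<le> C" using assms(3,4) by (simp add: nearE_eq_nn[OF D, symmetric])
qed

subsection \<open>The far part\<close>

lemma prod_integrable:
  fixes u v :: "'a::euclidean_space \<Rightarrow> real"
  assumes "integrable lborel u" "integrable lborel v"
  shows "integrable lborel2 (\<lambda>p. u (fst p) * v (snd p))"
    and "(\<integral>\<^sup>+p. ennreal \<bar>u (fst p) * v (snd p)\<bar> \<partial>lborel2) = ennreal ((\<integral>x. \<bar>u x\<bar> \<partial>lborel) * (\<integral>x. \<bar>v x\<bar> \<partial>lborel))"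
proof -
  have [measurable]: "u \<in> borel_measurable borel" "v \<in> borel_measurable borel"
    using borel_measurable_integrable[OF assms(1)] borel_measurable_integrable[OF assms(2)] by auto
  have "(\<integral>\<^sup>+p. ennreal \<bar>u (fst p) * v (snd p)\<bar> \<partial>lborel2) = (\<integral>\<^sup>+x. \<integral>\<^sup>+y. ennreal \<bar>u x\<bar> * ennreal \<bar>v y\<bar> \<partial>lborel \<partial>lborel)"
    by (subst lborel.nn_integral_fst[symmetric]) (auto simp: abs_mult ennreal_mult)
  also have "\<dots> = (\<integral>\<^sup>+x. ennreal \<bar>u x\<bar> \<partial>lborel) * (\<integral>\<^sup>+y. ennreal \<bar>v y\<bar> \<partial>lborel)"
    by (simp add: nn_integral_cmult nn_integral_multc)
  also have "\<dots> = ennreal ((\<integral>x. \<bar>u x\<bar> \<partial>lborel) * (\<integral>x. \<bar>v x\<bar> \<partial>lborel))"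
    using assms by (simp add: nn_integral_eq_integral ennreal_mult)
  finally show eq: "(\<integral>\<^sup>+p. ennreal \<bar>u (fst p) * v (snd p)\<bar> \<partial>lborel2) = ennreal ((\<integral>x. \<bar>u x\<bar> \<partial>lborel) * (\<integral>x. \<bar>v x\<bar> \<partial>lborel))" .
  show "integrable lborel2 (\<lambda>p. u (fst p) * v (snd p))"
    by (rule integrableI_bounded) (auto simp: eq)
qed

text \<open>At \<open>s = 0\<close> the far kernel is no longer integrable, so integrability has to
  come from \<open>u\<close> and \<open>v\<close>; the kernel contributes only the bound one, which
  is uniform in \<open>s\<close>.\<close>

lemma far_integrable:
  fixes u v :: "'a::euclidean_space \<Rightarrow> real"
  assumes "0 \<le> s" "integrable lborel u" "integrable lborel v"
  shows "integrable lborel2 (\<lambda>p. far s p * (u (fst p) * v (snd p)))"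
    and "\<bar>farB s u v\<bar> \<le> (\<integral>x. \<bar>u x\<bar> \<partial>lborel) * (\<integral>x. \<bar>v x\<bar> \<partial>lborel)"
proof -
  have le: "\<bar>far s p * (u (fst p) * v (snd p))\<bar> \<le> \<bar>u (fst p) * v (snd p)\<bar>" for p
    using far_le_1[OF assms(1), of p] far_nonneg[of s p] by (simp add: abs_mult mult_left_le_one_le)
  have [measurable]: "u \<in> borel_measurable borel" "v \<in> borel_measurable borel"
    using borel_measurable_integrable[OF assms(2)] borel_measurable_integrable[OF assms(3)] by auto
  show int: "integrable lborel2 (\<lambda>p. far s p * (u (fst p) * v (snd p)))"
    by (rule Bochner_Integration.integrable_bound[OF prod_integrable(1)[OF assms(2,3)]]) (use le in auto)
  have "ennreal \<bar>farB s u v\<bar> \<le> (\<integral>\<^sup>+p. ennreal \<bar>far s p * (u (fst p) * v (snd p))\<bar> \<partial>lborel2)"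
    unfolding farB_def using integral_norm_bound_ennreal[OF int] by simp
  also have "\<dots> \<le> (\<integral>\<^sup>+p. ennreal \<bar>u (fst p) * v (snd p)\<bar> \<partial>lborel2)"
    by (intro nn_integral_mono ennreal_leI le)
  also have "\<dots> = ennreal ((\<integral>x. \<bar>u x\<bar> \<partial>lborel) * (\<integral>x. \<bar>v x\<bar> \<partial>lborel))"
    by (rule prod_integrable(2)[OF assms(2,3)])
  finally show "\<bar>farB s u v\<bar> \<le> (\<integral>x. \<bar>u x\<bar> \<partial>lborel) * (\<integral>x. \<bar>v x\<bar> \<partial>lborel)"
    by (subst (asm) ennreal_le_iff) (auto intro!: mult_nonneg_nonneg integral_nonneg_AE)
qed

lemma far_swap: "far s (snd p, fst p) = far s p"
  by (simp add: far_def norm_minus_commute indicator_def)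

lemma farB_commute:
  fixes u v :: "'a::euclidean_space \<Rightarrow> real"
  assumes "u \<in> borel_measurable borel" "v \<in> borel_measurable borel"
  shows "farB s u v = farB s v u"
proof -
  have "(\<lambda>p. far s p * (u (fst p) * v (snd p))) \<in> borel_measurable (lborel \<Otimes>\<^sub>M (lborel :: 'a measure))"
    using assms by measurable
  from lborel_pair.integral_product_swap[OF this]
  show ?thesis unfolding farB_def
    by (simp add: case_prod_beta' far_swap mult.commute)
qed

lemma farB_lin:
  assumes "0 \<le> s" "integrable lborel u" "integrable lborel v" "integrable lborel w"
  shows "farB s (\<lambda>x. a * u x + b * v x) w = a * farB s u w + b * farB s v w"
proof -
  have "farB s (\<lambda>x. a * u x + b * v x) w = (\<integral>p. a * (far s p * (u (fst p) * w (snd p))) + b * (far s p * (v (fst p) * w (snd p))) \<partial>lborel2)"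
    unfolding farB_def by (intro Bochner_Integration.integral_cong) (auto simp: algebra_simps)
  also have "\<dots> = a * farB s u w + b * farB s v w"
    unfolding farB_def using far_integrable(1) assms by (subst Bochner_Integration.integral_add) auto
  finally show ?thesis .
qed

lemma far_slice:
  fixes x :: "'a::euclidean_space"
  assumes "s > 0"
  shows "(\<integral>\<^sup>+y. ennreal (far s (x, y)) \<partial>lborel) = ennreal (sphere_area TYPE('a) / (2 * s))"
proof -
  have "(\<integral>\<^sup>+y. ennreal (far s (x, y)) \<partial>lborel) = (\<integral>\<^sup>+y. ennreal (far s (x, x - y)) \<partial>lborel)"
    by (rule nn_integral_lborel_reflect[symmetric]) measurable
  also have "\<dots> = (\<integral>\<^sup>+z. ennreal (indicator {z. norm z \<ge> 1} z / norm z powr (real DIM('a) + 2 * s)) \<partial>(lborel :: 'a measure))"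
    by (auto simp: far_def indicator_def intro!: nn_integral_cong)
  finally show ?thesis using nn_integral_norm_powr_far[OF assms] by simp
qed

text \<open>These are the products \<open>u x * v x\<close> and \<open>u y * v y\<close> that arise
  from expanding the differences on the far part; each slice integrates the kernel to the same
  constant, finite for \<open>s > 0\<close>.\<close>

lemma far_diagonal:
  fixes f :: "'a::euclidean_space \<Rightarrow> real"
  assumes s: "s > 0" and f: "integrable lborel f"
  shows "integrable lborel2 (\<lambda>p. far s p * f (fst p))" (is ?int)
    "(\<integral>p. far s p * f (fst p) \<partial>lborel2) = sphere_area TYPE('a) / (2 * s) * (\<integral>x. f x \<partial>lborel)"
    "integrable lborel2 (\<lambda>p. far s p * f (snd p))"
    "(\<integral>p. far s p * f (snd p) \<partial>lborel2) = sphere_area TYPE('a) / (2 * s) * (\<integral>x. f x \<partial>lborel)"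
proof -
  let ?T = "sphere_area TYPE('a) / (2 * s)"
  have T: "0 \<le> ?T" using sphere_area_pos[where 'a='a] s by simp
  have [measurable]: "f \<in> borel_measurable borel"
    using borel_measurable_integrable[OF f] by auto
  have slice: "(\<integral>y. far s (x, y) \<partial>lborel) = ?T" for x :: 'a
    by (subst integral_eq_nn_integral) (use far_slice[OF s, of x] T in \<open>auto\<close>)
  show int: ?int
  proof (rule integrableI_bounded)
    have "(\<integral>\<^sup>+p. ennreal (norm (far s p * f (fst p))) \<partial>lborel2) = (\<integral>\<^sup>+x. \<integral>\<^sup>+y. ennreal \<bar>f x\<bar> * ennreal (far s (x, y)) \<partial>lborel \<partial>lborel)"
      by (subst lborel.nn_integral_fst[symmetric]) (auto simp: abs_mult far_nonneg ennreal_mult'[symmetric] mult.commute)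
    also have "\<dots> = (\<integral>\<^sup>+x. ennreal \<bar>f x\<bar> * ennreal ?T \<partial>lborel)"
      by (subst nn_integral_cmult) (auto simp: far_slice[OF s])
    also have "\<dots> < \<infinity>"
      using f by (simp add: nn_integral_multc integrable_iff_bounded ennreal_mult_less_top)
    finally show "(\<integral>\<^sup>+p. ennreal (norm (far s p * f (fst p))) \<partial>lborel2) < \<infinity>" .
  qed measurable
  show eq: "(\<integral>p. far s p * f (fst p) \<partial>lborel2) = ?T * (\<integral>x. f x \<partial>lborel)"
    by (subst lborel_pair.integral_fst'[OF int, symmetric]) (simp add: slice)
  have m: "(\<lambda>p. far s p * f (fst p)) \<in> borel_measurable (lborel \<Otimes>\<^sub>M (lborel :: 'a measure))" by measurable
  show "integrable lborel2 (\<lambda>p. far s p * f (snd p))"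
    using lborel_pair.integrable_product_swap[OF int] by (simp add: case_prod_beta' far_swap)
  show "(\<integral>p. far s p * f (snd p) \<partial>lborel2) = ?T * (\<integral>x. f x \<partial>lborel)"
    using lborel_pair.integral_product_swap[OF m] eq by (simp add: case_prod_beta' far_swap)
qed

text \<open>It turns the diagonal far contribution \<open>cfun s * sphere_area / 2\<close> into
  \<open>cfun s / C_N\<close>, which is \<open>1 + s * rhof s\<close>: the identity plus the
  zeroth-order term of \<open>Qf\<close>.\<close>

lemma C_N_sphere_area: "C_N TYPE('a::euclidean_space) * sphere_area TYPE('a) = 2"
proof -
  have eq: "Gamma (real DIM('a) / 2 + 1) = real DIM('a) / 2 * Gamma (real DIM('a) / 2)"
    by (rule Gamma_plus1) (use DIM_positive[where 'a='a] nonpos_Ints_nonpos[of "real DIM('a) / 2"] in auto)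
  have "Gamma (real DIM('a) / 2) \<noteq> 0"
    using Gamma_real_pos[of "real DIM('a) / 2"] DIM_positive[where 'a='a] by (metis divide_pos_pos less_irrefl of_nat_0_less_iff zero_less_numeral)
  then show ?thesis
    unfolding C_N_def sphere_area_def unit_ball_vol_def dimN_def eq
    by (simp add: powr_minus)
qed

lemma C_N_pos: "C_N TYPE('a::euclidean_space) > 0"
  using C_N_sphere_area[where 'a='a] sphere_area_pos[where 'a='a] by (metis zero_less_mult_pos2 zero_less_numeral)

lemma C_Ns_eq: "C_Ns T s = s * cfun T s" by (simp add: C_Ns_def cfun_def)
lemma cfun_0: "cfun T 0 = C_N T" by (simp add: cfun_def C_N_def powr_minus field_simps)

lemma Es_eq_Qf:
  fixes u v :: "'a::euclidean_space \<Rightarrow> real"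
  assumes s: "s > 0" and u: "u \<in> Dom \<Omega> s" and v: "v \<in> Dom \<Omega> s"
    and L1: "integrable lborel u" "integrable lborel v"
  shows "Es s u v = ip u v + s * Qf s u v"
proof -
  let ?P = "lborel2 :: ('a \<times> 'a) measure"
  let ?T = "sphere_area TYPE('a) / (2 * s)"
  define n where "n p = near s p * (dif u p * dif v p)" for p
  define d1 where "d1 p = far s p * (u (fst p) * v (fst p))" for p
  define d2 where "d2 p = far s p * (u (snd p) * v (snd p))" for p
  define o1 where "o1 p = far s p * (u (fst p) * v (snd p))" for p
  define o2 where "o2 p = far s p * (v (fst p) * u (snd p))" for p
  have uv: "integrable lborel (\<lambda>x. u x * v x)" using DomD(1)[OF u] DomD(1)[OF v] by (rule L2_mult_integrable)
  have int: "integrable ?P n" "integrable ?P d1" "integrable ?P d2" "integrable ?P o1" "integrable ?P o2"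
    unfolding n_def d1_def d2_def o1_def o2_def
    using Dom_near_integrable[OF u v] far_diagonal[OF s uv] far_integrable(1)[of s] s L1 by auto
  have val: "integral\<^sup>L ?P n = nearE s u v" "integral\<^sup>L ?P d1 = ?T * ip u v" "integral\<^sup>L ?P d2 = ?T * ip u v"
    "integral\<^sup>L ?P o1 = farB s u v" "integral\<^sup>L ?P o2 = farB s v u"
    unfolding n_def d1_def d2_def o1_def o2_def nearE_def ip_def farB_def
    using far_diagonal[OF s uv] by auto
  have "(\<lambda>(x, y). (u x - u y) * (v x - v y) / norm (x - y) powr (real DIM('a) + 2 * s)) = (\<lambda>p. n p + d1 p + d2 p - o1 p - o2 p)"
    by (rule ext) (auto simp: n_def d1_def d2_def o1_def o2_def near_def far_def dif_def indicator_def divide_simps algebra_simps)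
  then have "Es s u v = C_Ns TYPE('a) s / 2 * (\<integral>p. n p + d1 p + d2 p - o1 p - o2 p \<partial>?P)"
    unfolding Es_def by (simp only:)
  also have "(\<integral>p. n p + d1 p + d2 p - o1 p - o2 p \<partial>?P) = nearE s u v + ?T * ip u v + ?T * ip u v - farB s u v - farB s u v"
    using int val farB_commute[of u v s] DomD(3)[OF u] DomD(3)[OF v] by simp
  also have "C_Ns TYPE('a) s / 2 * \<dots> = ip u v + s * Qf s u v"
  proof -
    have w: "sphere_area TYPE('a) = 2 / C_N TYPE('a)"
      using C_N_sphere_area[where 'a='a] C_N_pos[where 'a='a] by (simp add: field_simps)
    show ?thesis unfolding Qf_def rhof_def C_Ns_eq w using s C_N_pos[where 'a='a] by (simp add: field_simps)
  qed
  finally show ?thesis .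
qed

lemma EL_eq_Qf: "EL u v = Qf 0 u v"
proof -
  have "(\<lambda>(x::'a,y). indicator {p. norm (fst p - snd p) < 1} (x, y) * ((u x - u y) * (v x - v y) / norm (x - y) powr real DIM('a)))
     = (\<lambda>p. near 0 p * (dif u p * dif v p))"
    "(\<lambda>(x::'a,y). indicator {p. norm (fst p - snd p) \<ge> 1} (x, y) * (u x * v y / norm (x - y) powr real DIM('a)))
     = (\<lambda>p. far 0 p * (u (fst p) * v (snd p)))"
    by (auto simp: near_def far_def dif_def fun_eq_iff)
  then show ?thesis unfolding EL_def Qf_def nearE_def farB_def ip_def cfun_0 rhof_def by simp
qed

lemma H00_eq_Dom: "H00 \<Omega> = Dom \<Omega> 0"
proof -
  have "(\<integral>\<^sup>+ x. \<integral>\<^sup>+ y. ennreal (indicator {p. norm (fst p - snd p) < 1} (x, y) * (u x - u y)\<^sup>2 / norm (x - y) powr real DIM('a)) \<partial>lborel \<partial>lborel) < \<infinity>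
     \<longleftrightarrow> integrable lborel2 (\<lambda>p. near 0 p * (dif u p)\<^sup>2)" if "u \<in> L2" for u :: "'a \<Rightarrow> real"
  proof -
    have [measurable]: "u \<in> borel_measurable borel" using that by (simp add: L2_def)
    have "(\<integral>\<^sup>+ x. \<integral>\<^sup>+ y. ennreal (indicator {p. norm (fst p - snd p) < 1} (x, y) * (u x - u y)\<^sup>2 / norm (x - y) powr real DIM('a)) \<partial>lborel \<partial>lborel)
      = (\<integral>\<^sup>+ x. \<integral>\<^sup>+ y. ennreal (near 0 (x, y) * (dif u (x, y))\<^sup>2) \<partial>lborel \<partial>lborel)"
      by (simp add: near_def dif_def)
    also have "\<dots> = (\<integral>\<^sup>+p. ennreal (near 0 p * (dif u p)\<^sup>2) \<partial>lborel2)"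
      by (subst lborel.nn_integral_fst) auto
    finally show ?thesis by (auto simp: integrable_iff_bounded near_nonneg abs_mult)
  qed
  then show ?thesis by (auto simp: H00_def Dom_def)
qed

text \<open>On the far part the squared difference is at most twice the sum of the squares, which
  \<open>far_diagonal\<close> integrates. So the near part alone decides whether the full energy is
  finite.\<close>

lemma Hs0_eq_Dom:
  assumes s: "s > 0"
  shows "Hs0 s \<Omega> = Dom \<Omega> (s :: real) "
proof -
  have "(\<integral>\<^sup>+ x. \<integral>\<^sup>+ y. ennreal ((u x - u y)\<^sup>2 / norm (x - y) powr (real DIM('a) + 2 * s)) \<partial>lborel \<partial>lborel) < \<infinity>
     \<longleftrightarrow> integrable lborel2 (\<lambda>p. near s p * (dif u p)\<^sup>2)" (is "?I < \<infinity> \<longleftrightarrow> _")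
    if "u \<in> L2" for u :: "'a \<Rightarrow> real"
  proof -
    have [measurable]: "u \<in> borel_measurable borel" using that by (simp add: L2_def)
    have u2: "integrable lborel (\<lambda>x. (u x)\<^sup>2)" using that by (simp add: L2_def)
    have eq: "?I = (\<integral>\<^sup>+p. ennreal (near s p * (dif u p)\<^sup>2) + ennreal (far s p * (dif u p)\<^sup>2) \<partial>lborel2)"
    proof -
      have "?I = (\<integral>\<^sup>+ x. \<integral>\<^sup>+ y. ennreal (near s (x, y) * (dif u (x, y))\<^sup>2) + ennreal (far s (x, y) * (dif u (x, y))\<^sup>2) \<partial>lborel \<partial>lborel)"
        by (intro nn_integral_cong) (auto simp: near_def far_def dif_def indicator_def)
      also have "\<dots> = (\<integral>\<^sup>+p. ennreal (near s p * (dif u p)\<^sup>2) + ennreal (far s p * (dif u p)\<^sup>2) \<partial>lborel2)"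
        by (subst lborel.nn_integral_fst) auto
      finally show ?thesis .
    qed
    have sum: "(\<integral>\<^sup>+p. ennreal (near s p * (dif u p)\<^sup>2) + ennreal (far s p * (dif u p)\<^sup>2) \<partial>lborel2)
      = (\<integral>\<^sup>+p. ennreal (near s p * (dif u p)\<^sup>2) \<partial>lborel2) + (\<integral>\<^sup>+p. ennreal (far s p * (dif u p)\<^sup>2) \<partial>lborel2)"
      by (rule nn_integral_add) auto
    have fin: "(\<integral>\<^sup>+p. ennreal (far s p * (dif u p)\<^sup>2) \<partial>lborel2) < \<infinity>"
    proof -
      have "integrable lborel2 (\<lambda>p. far s p * (dif u p)\<^sup>2)"
      proof (rule Bochner_Integration.integrable_bound)
        show "integrable lborel2 (\<lambda>p. 2 * (far s p * (u (fst p))\<^sup>2) + 2 * (far s p * (u (snd p))\<^sup>2))"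
          using far_diagonal[OF s u2] by auto
        show "AE p in lborel2. norm (far s p * (dif u p)\<^sup>2) \<le> norm (2 * (far s p * (u (fst p))\<^sup>2) + 2 * (far s p * (u (snd p))\<^sup>2))"
        proof (rule AE_I2)
          fix p :: "'a \<times> 'a"
          have "(dif u p)\<^sup>2 \<le> 2 * (u (fst p))\<^sup>2 + 2 * (u (snd p))\<^sup>2"
            using zero_le_power2[of "u (fst p) + u (snd p)"] by (simp add: dif_def power2_eq_square algebra_simps)
          then have "far s p * (dif u p)\<^sup>2 \<le> far s p * (2 * (u (fst p))\<^sup>2 + 2 * (u (snd p))\<^sup>2)"
            using far_nonneg by (rule mult_left_mono)
          then show "norm (far s p * (dif u p)\<^sup>2) \<le> norm (2 * (far s p * (u (fst p))\<^sup>2) + 2 * (far s p * (u (snd p))\<^sup>2))"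
            using far_nonneg[of s p] by (simp add: algebra_simps)
        qed
      qed measurable
      then show ?thesis by (simp add: integrable_iff_bounded far_nonneg abs_mult)
    qed
    have "?I < \<infinity> \<longleftrightarrow> (\<integral>\<^sup>+p. ennreal (near s p * (dif u p)\<^sup>2) \<partial>lborel2) < \<infinity>"
      unfolding eq sum using fin by simp
    then show ?thesis by (simp add: integrable_iff_bounded abs_mult)
  qed
  then show ?thesis by (auto simp: Hs0_def Hs_def Dom_def)
qed

subsection \<open>The constants\<close>

lemma cfun_pos: "0 \<le> s \<Longrightarrow> s < 1 \<Longrightarrow> cfun TYPE('a::euclidean_space) s > 0"
  unfolding cfun_def dimN_def
  by (intro divide_pos_pos mult_pos_pos Gamma_real_pos) (auto intro!: add_pos_nonneg)

lemma DERIV_cfun: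
  assumes "0 \<le> s" "s < 1"
  shows "\<exists>d. DERIV (cfun TYPE('a::euclidean_space)) s :> d"
proof -
  let ?n = "real DIM('a) / 2"
  have n: "?n > 0" using DIM_positive[where 'a='a] by simp
  have "?n + s > 0" "1 - s > 0" using n assms by linarith+
  then have ni: "?n + s \<notin> \<int>\<^sub>\<le>\<^sub>0" "1 - s \<notin> \<int>\<^sub>\<le>\<^sub>0"
    by (metis nonpos_Ints_nonpos not_less)+
  have g: "Gamma (1 - s) > 0" using assms by (intro Gamma_real_pos) auto
  show ?thesis unfolding cfun_def dimN_def
    by (rule exI) (rule derivative_eq_intros refl | use ni g in \<open>simp; fail\<close>)+
qed

lemma isCont_cfun: "0 \<le> s \<Longrightarrow> s < 1 \<Longrightarrow> isCont (cfun TYPE('a::euclidean_space)) s"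
  using DERIV_cfun[where 'a='a] DERIV_isCont by blast

text \<open>The constant \<^const>\<open>rho_N\<close> is the logarithmic derivative of \<^const>\<open>cfun\<close> at the origin.\<close>

lemma DERIV_cfun_0: "DERIV (\<lambda>s. cfun TYPE('a::euclidean_space) s / C_N TYPE('a)) 0 :> rho_N TYPE('a)"
proof -
  let ?n = "real DIM('a) / 2"
  have n: "?n > 0" using DIM_positive[where 'a='a] by simp
  have ni: "?n \<notin> \<int>\<^sub>\<le>\<^sub>0" "1 \<notin> (\<int>\<^sub>\<le>\<^sub>0 :: real set)" using n nonpos_Ints_nonpos[of ?n] by auto
  have g: "Gamma ?n \<noteq> 0" using Gamma_real_pos[OF n] by (metis less_irrefl)
  \<comment> \<open>The three factors produce the three summands of \<open>rho_N\<close>: the power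
    of 4 gives \<open>2 * ln 2\<close>, the first Gamma factor the digamma value, and
    \<open>Gamma (1 - s)\<close> in the denominator minus the Euler constant.\<close>
  have eq: "(\<lambda>s. cfun TYPE('a) s / C_N TYPE('a)) = (\<lambda>s. exp (s * ln 4) * (Gamma (?n + s) / Gamma ?n) / Gamma (1 - s))"
    using g by (auto simp: fun_eq_iff cfun_def C_N_def dimN_def powr_minus powr_def[of 4] field_simps)
  have d1: "DERIV (\<lambda>s. Gamma (?n + s)) 0 :> Gamma ?n * Digamma ?n"
    using ni by (auto intro!: derivative_eq_intros)
  have d2: "DERIV (\<lambda>s. Gamma (1 - s)) 0 :> euler_mascheroni"
    using ni by (auto intro!: derivative_eq_intros simp: Digamma_1 Gamma_1)
  have "DERIV (\<lambda>s. exp (s * ln 4) * (Gamma (?n + s) / Gamma ?n) / Gamma (1 - s)) 0 :>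
     ((exp (0 * ln 4) * ln 4 * (Gamma (?n + 0) / Gamma ?n) + Gamma ?n * Digamma ?n / Gamma ?n * exp (0 * ln 4)) * Gamma (1 - 0)
       - exp (0 * ln 4) * (Gamma (?n + 0) / Gamma ?n) * euler_mascheroni) / (Gamma (1 - 0) * Gamma (1 - 0))"
    by (intro DERIV_divide DERIV_mult DERIV_cdivide d1 d2) (auto intro!: derivative_eq_intros)
  moreover have "ln 4 = 2 * ln (2::real)" using ln_realpow[of 2 2] by simp
  ultimately show ?thesis unfolding eq using g by (simp add: rho_N_def dimN_def)
qed

lemma isCont_rhof: 
  assumes "0 \<le> s" "s < 1" shows "isCont (rhof TYPE('a::euclidean_space)) s"
proof (cases "s = 0")
  case True
  have C: "C_N TYPE('a) \<noteq> 0" using C_N_pos[where 'a='a] by simp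
  have "(\<lambda>h. (cfun TYPE('a) (0 + h) / C_N TYPE('a) - cfun TYPE('a) 0 / C_N TYPE('a)) / h) \<midarrow>0\<rightarrow> rho_N TYPE('a)"
    using DERIV_cfun_0[where 'a='a] unfolding DERIV_def .
  then have "rhof TYPE('a) \<midarrow>0\<rightarrow> rho_N TYPE('a)"
    by (rule Lim_transform_eventually) (auto simp: rhof_def cfun_0 C eventually_at_filter)
  then show ?thesis using True by (simp add: isCont_def rhof_def)
next
  case False
  have "isCont (\<lambda>s. (cfun TYPE('a) s / C_N TYPE('a) - 1) / s) s"
    using False isCont_cfun[OF assms] C_N_pos[where 'a='a] by (intro continuous_intros) auto
  moreover have "\<forall>\<^sub>F x in nhds s. (cfun TYPE('a) x / C_N TYPE('a) - 1) / x = rhof TYPE('a) x"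
  proof -
    have "\<forall>\<^sub>F x in nhds s. x \<in> - {0}" by (rule eventually_nhds_in_open) (use False in auto)
    then show ?thesis by eventually_elim (simp add: rhof_def)
  qed
  ultimately show ?thesis by (rule iffD1[OF isCont_cong, rotated])
qed

text \<open>The interval stays away from \<open>s = 1\<close>, where \<open>cfun\<close> degenerates
  to zero; continuity on a compact interval then gives uniform constants.\<close>

lemma constants_bounded:
  obtains c C where "0 < c" "\<And>s. 0 \<le> s \<Longrightarrow> s \<le> 1/2 \<Longrightarrow> c \<le> cfun TYPE('a::euclidean_space) s"
    "\<And>s. 0 \<le> s \<Longrightarrow> s \<le> 1/2 \<Longrightarrow> cfun TYPE('a) s \<le> C"
    "\<And>s. 0 \<le> s \<Longrightarrow> s \<le> 1/2 \<Longrightarrow> \<bar>rhof TYPE('a) s\<bar> \<le> C"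
proof -
  have c: "continuous_on {0..1/2} (cfun TYPE('a))" "continuous_on {0..1/2} (\<lambda>s. \<bar>rhof TYPE('a) s\<bar>)"
    using isCont_cfun[where 'a='a] isCont_rhof[where 'a='a] by (auto intro!: continuous_at_imp_continuous_on continuous_intros)
  have ne: "compact {0..1/2::real}" "{0..1/2::real} \<noteq> {}" by auto
  obtain a where a: "a \<in> {0..1/2}" "\<And>s. s \<in> {0..1/2} \<Longrightarrow> cfun TYPE('a) a \<le> cfun TYPE('a) s"
    using continuous_attains_inf[OF ne c(1)] by blast
  obtain b where b: "\<And>s. s \<in> {0..1/2} \<Longrightarrow> cfun TYPE('a) s \<le> cfun TYPE('a) b"
    using continuous_attains_sup[OF ne c(1)] by blast
  obtain d where d: "\<And>s. s \<in> {0..1/2} \<Longrightarrow> \<bar>rhof TYPE('a) s\<bar> \<le> \<bar>rhof TYPE('a) d\<bar>"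
    using continuous_attains_sup[OF ne c(2)] by blast
  show ?thesis
  proof (rule that[of "cfun TYPE('a) a" "max (cfun TYPE('a) b) \<bar>rhof TYPE('a) d\<bar>"])
    show "0 < cfun TYPE('a) a" using a(1) by (intro cfun_pos) auto
  qed (use a b d in \<open>auto simp: le_max_iff_disj\<close>)
qed

section \<open>Lower semicontinuity\<close>

locale bounded_open =
  fixes \<Omega> :: "'a::euclidean_space set"
  assumes open_\<Omega>: "open \<Omega>" and bounded_\<Omega>: "bounded \<Omega>"
begin

lemma \<Omega>_borel [measurable]: "\<Omega> \<in> sets borel" using open_\<Omega> by auto

lemma \<Omega>_finite: "emeasure lborel \<Omega> < \<infinity>"
  using emeasure_bounded_finite[OF bounded_\<Omega>] by simp

lemma indicator_L2: "indicator \<Omega> \<in> L2"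
proof -
  have "(\<lambda>x. (indicator \<Omega> x :: real)\<^sup>2) = indicator \<Omega>" by (auto simp: fun_eq_iff indicator_def)
  then show ?thesis using \<Omega>_finite by (simp add: L2_def integrable_real_indicator)
qed

lemma ip_indicator: "ip (indicator \<Omega>) (indicator \<Omega>) = measure lborel \<Omega>"
  by (simp add: ip_def flip: indicator_inter_arith)

text \<open>Cauchy-Schwarz against the indicator of \<Omega>: finite volume converts L2 control into
  L1 control, which the far form and the convolutions need.\<close>

lemma L1_bound:
  assumes "u \<in> L2" "vanishes_off \<Omega> u"
  shows "integrable lborel u" "(\<integral>x. \<bar>u x\<bar> \<partial>lborel) \<le> sqrt (measure lborel \<Omega>) * sqrt (ip u u)"
proof -
  have [measurable]: "u \<in> borel_measurable borel" using assms by (simp add: L2_def)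
  have abs: "(\<lambda>x. \<bar>u x\<bar>) \<in> L2" using assms(1) by (auto simp: L2_def)
  have int: "integrable lborel (\<lambda>x. \<bar>u x\<bar> * indicator \<Omega> x)" using abs indicator_L2 by (rule L2_mult_integrable)
  have ae: "AE x in lborel. \<bar>u x\<bar> * indicator \<Omega> x = \<bar>u x\<bar>"
    using assms(2) unfolding vanishes_off_def by eventually_elim (auto simp: indicator_def)
  have "integrable lborel (\<lambda>x. \<bar>u x\<bar>)"
    using int by (rule integrable_cong_AE_imp) (use ae in auto)
  then show "integrable lborel u" by (simp add: integrable_abs_iff)
  have "(\<integral>x. \<bar>u x\<bar> \<partial>lborel) = ip (\<lambda>x. \<bar>u x\<bar>) (indicator \<Omega>)"
    unfolding ip_def by (rule integral_cong_AE) (use ae in auto)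
  also have "\<dots> \<le> sqrt (ip (\<lambda>x. \<bar>u x\<bar>) (\<lambda>x. \<bar>u x\<bar>)) * sqrt (ip (indicator \<Omega>) (indicator \<Omega>))"
    using ip.cauchy_schwarz[OF abs indicator_L2] by simp
  also have "ip (\<lambda>x. \<bar>u x\<bar>) (\<lambda>x. \<bar>u x\<bar>) = ip u u" by (simp add: ip_def)
  finally show "(\<integral>x. \<bar>u x\<bar> \<partial>lborel) \<le> sqrt (measure lborel \<Omega>) * sqrt (ip u u)"
    unfolding ip_indicator by (simp add: mult.commute)
qed

lemma Dom_integrable: "u \<in> Dom \<Omega> s \<Longrightarrow> integrable lborel u"
  using L1_bound(1) DomD by blast

lemma Qf_form: "0 \<le> s \<Longrightarrow> sym_form (Dom \<Omega> s) (Qf s)"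
proof unfold_locales
  fix f g h and a b :: real assume s: "0 \<le> s" and f: "f \<in> Dom \<Omega> s" and g: "g \<in> Dom \<Omega> s"
  show "Qf s f g = Qf s g f"
    unfolding Qf_def using nearE_commute ip_commute farB_commute DomD(3)[OF f] DomD(3)[OF g] by metis
  assume h: "h \<in> Dom \<Omega> s"
  show "Qf s (\<lambda>x. a * f x + b * g x) h = a * Qf s f h + b * Qf s g h"
    unfolding Qf_def nearE_lin[OF f g h] farB_lin[OF s f[THEN Dom_integrable] g[THEN Dom_integrable] h[THEN Dom_integrable]]
      ip_lin[OF f[THEN DomD(1)] g[THEN DomD(1)] h[THEN DomD(1)]]
    by (simp add: algebra_simps)
qed (auto simp: Dom_zero Dom_lin)

lemma farB_bound:
  assumes "0 \<le> s" "u \<in> L2" "vanishes_off \<Omega> u" "v \<in> L2" "vanishes_off \<Omega> v"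
  shows "\<bar>farB s u v\<bar> \<le> measure lborel \<Omega> * (sqrt (ip u u) * sqrt (ip v v))"
proof -
  have "\<bar>farB s u v\<bar> \<le> (\<integral>x. \<bar>u x\<bar> \<partial>lborel) * (\<integral>x. \<bar>v x\<bar> \<partial>lborel)"
    using far_integrable(2) assms L1_bound(1) by blast
  also have "\<dots> \<le> (sqrt (measure lborel \<Omega>) * sqrt (ip u u)) * (sqrt (measure lborel \<Omega>) * sqrt (ip v v))"
    using assms L1_bound(2) by (intro mult_mono) (auto simp: ip_nonneg intro!: integral_nonneg_AE)
  also have "\<dots> = measure lborel \<Omega> * (sqrt (ip u u) * sqrt (ip v v))"
    by (simp add: algebra_simps)
  finally show ?thesis .
qed

text \<open>A Garding inequality, uniform in \<open>s\<close>: the far part and the zeroth-order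
  term are at most a constant times the squared L2 norm. It yields both the common lower bound and
  the energy bound for compactness.\<close>

lemma near_control:
  obtains c M where "0 < c" "0 \<le> M"
    "\<And>s u. 0 \<le> s \<Longrightarrow> s \<le> 1/2 \<Longrightarrow> u \<in> Dom \<Omega> s \<Longrightarrow> c * nearE s u u \<le> Qf s u u + M * ip u u"
proof -
  obtain c C where c: "0 < c" "\<And>s. 0 \<le> s \<Longrightarrow> s \<le> 1/2 \<Longrightarrow> c \<le> cfun TYPE('a) s"
    "\<And>s. 0 \<le> s \<Longrightarrow> s \<le> 1/2 \<Longrightarrow> cfun TYPE('a) s \<le> C"
    "\<And>s. 0 \<le> s \<Longrightarrow> s \<le> 1/2 \<Longrightarrow> \<bar>rhof TYPE('a) s\<bar> \<le> C"
    using constants_bounded[where 'a='a] by blast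
  have C: "0 < C" using c(1) c(2)[of 0] c(3)[of 0] by simp
  show ?thesis
  proof (rule that[of "c / 2" "C * measure lborel \<Omega> + C"])
    fix s u assume s: "0 \<le> s" "s \<le> 1/2" and u: "u \<in> Dom \<Omega> s"
    have "c / 2 * nearE s u u \<le> cfun TYPE('a) s / 2 * nearE s u u"
      using c(2)[OF s] nearE_nonneg by (intro mult_right_mono) auto
    moreover have "cfun TYPE('a) s * farB s u u \<le> C * (measure lborel \<Omega> * ip u u)"
    proof -
      have "\<bar>farB s u u\<bar> \<le> measure lborel \<Omega> * ip u u"
        using farB_bound[OF s(1) DomD(1,2)[OF u] DomD(1,2)[OF u]] ip_nonneg[of u] by simp
      then have "cfun TYPE('a) s * farB s u u \<le> cfun TYPE('a) s * (measure lborel \<Omega> * ip u u)"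
        using cfun_pos[of s, where 'a='a] s by (intro mult_left_mono) auto
      also have "\<dots> \<le> C * (measure lborel \<Omega> * ip u u)"
        using c(3)[OF s] ip_nonneg[of u] by (intro mult_right_mono) auto
      finally show ?thesis .
    qed
    moreover have "- C * ip u u \<le> rhof TYPE('a) s * ip u u"
      using c(4)[OF s] ip_nonneg[of u] by (intro mult_right_mono) auto
    ultimately show "c / 2 * nearE s u u \<le> Qf s u u + (C * measure lborel \<Omega> + C) * ip u u"
      unfolding Qf_def by (simp add: algebra_simps)
  qed (use c C in auto)
qed

lemma L2_lim_vanishes:
  assumes "\<And>n. u n \<in> L2" "\<And>n. vanishes_off \<Omega> (u n)" "v \<in> L2" "L2_lim u v"
  shows "vanishes_off \<Omega> v"
proof -
  have [measurable]: "v \<in> borel_measurable borel" "\<And>n. u n \<in> borel_measurable borel" using assms by (auto simp: L2_def)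
  let ?I = "\<integral>x. indicator (- \<Omega>) x * (v x)\<^sup>2 \<partial>lborel"
  have int: "integrable lborel (\<lambda>x. indicator (- \<Omega>) x * (v x)\<^sup>2)"
    by (rule Bochner_Integration.integrable_bound[of _ "\<lambda>x. (v x)\<^sup>2"]) (use assms(3) in \<open>auto simp: L2_def indicator_def\<close>)
  have "?I \<le> on_diff ip (u n) v" for n
    unfolding ip_def
  proof (rule integral_mono_AE[OF int])
    show "integrable lborel (\<lambda>x. (u n x - v x) * (u n x - v x))"
      using assms by (intro L2_mult_integrable L2_diff)
    show "AE x in lborel. indicator (- \<Omega>) x * (v x)\<^sup>2 \<le> (u n x - v x) * (u n x - v x)"
      using assms(2)[of n] unfolding vanishes_off_def
      by eventually_elim (auto simp: indicator_def power2_eq_square)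
  qed
  then have "?I \<le> 0" using assms(4) unfolding L2_lim_def by (intro LIMSEQ_le_const) auto
  moreover have "0 \<le> ?I" by (intro integral_nonneg_AE) auto
  ultimately have "?I = 0" by simp
  then have "AE x in lborel. indicator (- \<Omega>) x * (v x)\<^sup>2 = 0"
    using int by (subst (asm) integral_nonneg_eq_0_iff_AE) auto
  then show ?thesis unfolding vanishes_off_def by eventually_elim (auto simp: indicator_def split: if_splits)
qed

end

lemma L2_lim_AE_subseq:
  fixes u :: "nat \<Rightarrow> 'a::euclidean_space \<Rightarrow> real"
  assumes "\<And>n. u n \<in> L2" "v \<in> L2" "L2_lim u v"
  obtains r where "strict_mono r" "AE x in lborel. (\<lambda>n. u (r n) x) \<longlonglongrightarrow> v x"
proof -
  have "\<exists>r. strict_mono r \<and> (AE x in lborel. (\<lambda>n. (u (r n) x - v x) * (u (r n) x - v x)) \<longlonglongrightarrow> 0)"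
    by (rule tendsto_L1_AE_subseq)
      (use assms in \<open>auto simp: L2_lim_def ip_def intro!: L2_mult_integrable L2_diff\<close>)
  then obtain r where r: "strict_mono r" "AE x in lborel. (\<lambda>n. (u (r n) x - v x) * (u (r n) x - v x)) \<longlonglongrightarrow> 0" by blast
  from r(2) have "AE x in lborel. (\<lambda>n. u (r n) x) \<longlonglongrightarrow> v x"
  proof eventually_elim
    case (elim x)
    then have "(\<lambda>n. sqrt ((u (r n) x - v x)\<^sup>2)) \<longlonglongrightarrow> sqrt 0"
      by (intro tendsto_real_sqrt) (simp add: power2_eq_square)
    then have "(\<lambda>n. u (r n) x - v x) \<longlonglongrightarrow> 0" by (simp add: tendsto_rabs_zero_iff)
    then show ?case by (simp add: LIM_zero_iff)
  qed
  then show ?thesis using that r by blast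
qed

context bounded_open
begin

section \<open>Limits along varying exponents\<close>

lemma near_tendsto:
  assumes "\<sigma> \<longlonglongrightarrow> t" shows "(\<lambda>n. near (\<sigma> n) p) \<longlonglongrightarrow> near t (p :: 'a \<times> 'a)"
proof (cases "fst p = snd p")
  case False
  then show ?thesis unfolding near_def using assms by (intro tendsto_intros) auto
qed (simp add: near_def)

lemma far_tendsto:
  assumes "\<sigma> \<longlonglongrightarrow> t" shows "(\<lambda>n. far (\<sigma> n) p) \<longlonglongrightarrow> far t (p :: 'a \<times> 'a)"
proof (cases "fst p = snd p")
  case False
  then show ?thesis unfolding far_def using assms by (intro tendsto_intros) auto
qed (simp add: far_def)

text \<open>Fatou is applied to the varying kernels and the varying functions at the same time,
  along a subsequence that converges almost everywhere; since \<open>C\<close> bounds every term,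
  passing to the subsequence is harmless.\<close>

lemma nearE_fatou:
  assumes \<sigma>: "\<sigma> \<longlonglongrightarrow> t" and u: "\<And>n. u n \<in> Dom \<Omega> (\<sigma> n)" "v \<in> L2" "L2_lim u v"
    and C: "\<And>n. nearE (\<sigma> n) (u n) (u n) \<le> C"
  shows "v \<in> Dom \<Omega> t" "nearE t v v \<le> C"
proof -
  have uL: "u n \<in> L2" for n using DomD(1)[OF u(1)] .
  have [measurable]: "v \<in> borel_measurable borel" "\<And>n. u n \<in> borel_measurable borel"
    using u uL by (auto simp: L2_def)
  have C0: "0 \<le> C" using C[of 0] nearE_nonneg[of "\<sigma> 0" "u 0"] by simp
  have van: "vanishes_off \<Omega> v" using L2_lim_vanishes[OF uL DomD(2)[OF u(1)] u(2,3)] .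
  obtain r where r: "strict_mono r" "AE x in lborel. (\<lambda>n. u (r n) x) \<longlonglongrightarrow> v x"
    using L2_lim_AE_subseq[OF uL u(2,3)] by blast
  have \<sigma>r: "(\<lambda>n. \<sigma> (r n)) \<longlonglongrightarrow> t" using LIMSEQ_subseq_LIMSEQ[OF \<sigma> r(1)] by (simp add: o_def)
  have ae: "AE p in lborel2. ennreal (near t p * (dif v p)\<^sup>2) = liminf (\<lambda>n. ennreal (near (\<sigma> (r n)) p * (dif (u (r n)) p)\<^sup>2))"
    using AE_pair_fst[OF r(2)]
  proof eventually_elim
    case (elim p)
    have "(\<lambda>n. ennreal (near (\<sigma> (r n)) p * (dif (u (r n)) p)\<^sup>2)) \<longlonglongrightarrow> ennreal (near t p * (dif v p)\<^sup>2)"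
      unfolding dif_def using elim near_tendsto[OF \<sigma>r] by (intro tendsto_intros)
    then show ?case by (intro lim_imp_Liminf[symmetric]) auto
  qed
  have "(\<integral>\<^sup>+p. ennreal (near t p * (dif v p)\<^sup>2) \<partial>lborel2)
     = (\<integral>\<^sup>+p. liminf (\<lambda>n. ennreal (near (\<sigma> (r n)) p * (dif (u (r n)) p)\<^sup>2)) \<partial>lborel2)"
    using ae by (rule nn_integral_cong_AE)
  also have "\<dots> \<le> liminf (\<lambda>n. \<integral>\<^sup>+p. ennreal (near (\<sigma> (r n)) p * (dif (u (r n)) p)\<^sup>2) \<partial>lborel2)"
    by (rule nn_integral_liminf) measurable
  also have "\<dots> \<le> liminf (\<lambda>n. ennreal C)"
    by (intro Liminf_mono always_eventually allI) (simp add: nearE_eq_nn[OF u(1), symmetric] C ennreal_leI)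
  also have "\<dots> = ennreal C" by (simp add: Liminf_const)
  finally show "v \<in> Dom \<Omega> t" "nearE t v v \<le> C"
    using DomI_nn[OF u(2) van _ C0] by blast+
qed

text \<open>The far part is continuous, not merely lower semicontinuous: it is bounded on L2
  uniformly in the exponent, so \<open>u n\<close> may be replaced by \<open>v\<close>, and
  dominated convergence handles the kernel.\<close>

lemma farB_tendsto:
  assumes \<sigma>: "\<And>n. 0 \<le> \<sigma> n" "\<sigma> \<longlonglongrightarrow> t" and u: "\<And>n. u n \<in> L2" "\<And>n. vanishes_off \<Omega> (u n)" and v: "v \<in> L2" "L2_lim u v"
  shows "(\<lambda>n. farB (\<sigma> n) (u n) (u n)) \<longlonglongrightarrow> farB t v v"
proof -
  have [measurable]: "v \<in> borel_measurable borel" "\<And>n. u n \<in> borel_measurable borel"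
    using u v by (auto simp: L2_def)
  have van: "vanishes_off \<Omega> v" using L2_lim_vanishes[OF u v] .
  have Lv: "integrable lborel v" using L1_bound v van by blast
  have Lu: "integrable lborel (u n)" for n using L1_bound u by blast
  let ?w = "\<lambda>n x. u n x - v x"
  have w: "?w n \<in> L2" "vanishes_off \<Omega> (?w n)" for n
    using L2_diff[OF u(1) v(1)] vanishes_off_lin[OF u(2) van, of 1 n "-1"] by auto
  have Lw: "integrable lborel (?w n)" for n using L1_bound w by blast
  have 1: "(\<lambda>n. farB (\<sigma> n) v v) \<longlonglongrightarrow> farB t v v"
    unfolding farB_def
  proof (rule integral_dominated_convergence[where w="\<lambda>p. \<bar>v (fst p) * v (snd p)\<bar>"])
    show "integrable lborel2 (\<lambda>p. \<bar>v (fst p) * v (snd p)\<bar>)" using prod_integrable(1)[OF Lv Lv] by simp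
    show "AE p in lborel2. (\<lambda>n. far (\<sigma> n) p * (v (fst p) * v (snd p))) \<longlonglongrightarrow> far t p * (v (fst p) * v (snd p))"
      by (intro AE_I2 tendsto_intros far_tendsto \<sigma>)
    show "AE p in lborel2. norm (far (\<sigma> n) p * (v (fst p) * v (snd p))) \<le> \<bar>v (fst p) * v (snd p)\<bar>" for n
    proof (rule AE_I2)
      fix p :: "'a \<times> 'a"
      show "norm (far (\<sigma> n) p * (v (fst p) * v (snd p))) \<le> \<bar>v (fst p) * v (snd p)\<bar>"
        unfolding real_norm_def abs_mult[of "far (\<sigma> n) p"] using far_le_1[OF \<sigma>(1)[of n], of p] by (intro mult_left_le_one_le) auto
    qed
  qed measurable
  have eq: "farB (\<sigma> n) (u n) (u n) = farB (\<sigma> n) (?w n) (u n) + farB (\<sigma> n) (?w n) v + farB (\<sigma> n) v v" for n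
  proof -
    have "farB (\<sigma> n) (?w n) h = farB (\<sigma> n) (u n) h - farB (\<sigma> n) v h" if "integrable lborel h" for h
      using farB_lin[OF \<sigma>(1) Lu Lv that, of n 1 n "-1"] by simp
    then show ?thesis using Lu Lv farB_commute[of "u n" v] by simp
  qed
  have sw: "(\<lambda>n. sqrt (ip (?w n) (?w n))) \<longlonglongrightarrow> 0" using tendsto_real_sqrt[OF v(2)[unfolded L2_lim_def]] by simp
  have su: "(\<lambda>n. sqrt (ip (u n) (u n))) \<longlonglongrightarrow> sqrt (ip v v)" using ip_tendsto[OF u(1) u(1) v(1) v(1) v(2) v(2)] by (rule tendsto_real_sqrt)
  have 2: "(\<lambda>n. farB (\<sigma> n) (?w n) (u n)) \<longlonglongrightarrow> 0"
  proof (rule Lim_null_comparison)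
    show "\<forall>\<^sub>F n in sequentially. norm (farB (\<sigma> n) (?w n) (u n)) \<le> measure lborel \<Omega> * (sqrt (ip (?w n) (?w n)) * sqrt (ip (u n) (u n)))"
      using farB_bound[OF \<sigma>(1) w u] by (intro always_eventually) auto
    show "(\<lambda>n. measure lborel \<Omega> * (sqrt (ip (?w n) (?w n)) * sqrt (ip (u n) (u n)))) \<longlonglongrightarrow> 0"
      using tendsto_mult_right_zero[OF tendsto_mult[OF sw su, simplified]] by simp
  qed
  have 3: "(\<lambda>n. farB (\<sigma> n) (?w n) v) \<longlonglongrightarrow> 0"
  proof (rule Lim_null_comparison)
    show "\<forall>\<^sub>F n in sequentially. norm (farB (\<sigma> n) (?w n) v) \<le> measure lborel \<Omega> * (sqrt (ip (?w n) (?w n)) * sqrt (ip v v))"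
      using farB_bound[OF \<sigma>(1) w v(1) van] by (intro always_eventually) auto
    show "(\<lambda>n. measure lborel \<Omega> * (sqrt (ip (?w n) (?w n)) * sqrt (ip v v))) \<longlonglongrightarrow> 0"
      using tendsto_mult_right_zero[OF tendsto_mult[OF sw tendsto_const, simplified]] by simp
  qed
  show ?thesis unfolding eq using tendsto_add[OF tendsto_add[OF 2 3] 1] by simp
qed

text \<open>All terms except the near energy converge, so convergence of \<open>Qf\<close> forces
  the near energies to converge to some \<open>L\<close>. Dropping finitely many terms gives the
  bound \<open>L + \<epsilon>\<close> to which \<open>nearE_fatou\<close> applies.\<close>

lemma Qf_lsc:
  assumes \<sigma>: "\<And>n. 0 \<le> \<sigma> n" "\<And>n. \<sigma> n < 1/2" "\<sigma> \<longlonglongrightarrow> t" "0 \<le> t" "t < 1/2"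
    and u: "\<And>n. u n \<in> Dom \<Omega> (\<sigma> n)" "v \<in> L2" "L2_lim u v" "(\<lambda>n. Qf (\<sigma> n) (u n) (u n)) \<longlonglongrightarrow> c"
  shows "v \<in> Dom \<Omega> t \<and> Qf t v v \<le> c"
proof -
  let ?c = "cfun TYPE('a)" and ?\<rho> = "rhof TYPE('a)"
  have uL: "u n \<in> L2" for n using DomD(1)[OF u(1)] .
  have ct: "?c t > 0" using cfun_pos[of t, where 'a='a] \<sigma> by simp
  have c: "(\<lambda>n. ?c (\<sigma> n)) \<longlonglongrightarrow> ?c t" using isCont_tendsto_compose[OF isCont_cfun \<sigma>(3)] \<sigma> by simp
  have \<rho>: "(\<lambda>n. ?\<rho> (\<sigma> n)) \<longlonglongrightarrow> ?\<rho> t" using isCont_tendsto_compose[OF isCont_rhof \<sigma>(3)] \<sigma> by simp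
  have ip: "(\<lambda>n. ip (u n) (u n)) \<longlonglongrightarrow> ip v v" by (rule ip_tendsto[OF uL uL u(2) u(2) u(3) u(3)])
  have far: "(\<lambda>n. farB (\<sigma> n) (u n) (u n)) \<longlonglongrightarrow> farB t v v"
    by (rule farB_tendsto[OF \<sigma>(1,3) uL DomD(2)[OF u(1)] u(2,3)])
  define L where "L = (c + ?c t * farB t v v - ?\<rho> t * ip v v) / (?c t / 2)"
  have "(\<lambda>n. (Qf (\<sigma> n) (u n) (u n) + ?c (\<sigma> n) * farB (\<sigma> n) (u n) (u n) - ?\<rho> (\<sigma> n) * ip (u n) (u n)) / (?c (\<sigma> n) / 2)) \<longlonglongrightarrow> L"
    unfolding L_def using ct c \<rho> ip far u(4) by (intro tendsto_intros) auto
  moreover have "(Qf (\<sigma> n) (u n) (u n) + ?c (\<sigma> n) * farB (\<sigma> n) (u n) (u n) - ?\<rho> (\<sigma> n) * ip (u n) (u n)) / (?c (\<sigma> n) / 2) = nearE (\<sigma> n) (u n) (u n)" for n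
    using cfun_pos[of "\<sigma> n", where 'a='a] \<sigma>(1,2)[of n] by (simp add: Qf_def field_simps)
  ultimately have near: "(\<lambda>n. nearE (\<sigma> n) (u n) (u n)) \<longlonglongrightarrow> L" by simp
  have *: "v \<in> Dom \<Omega> t \<and> nearE t v v \<le> L + \<epsilon>" if \<epsilon>: "\<epsilon> > 0" for \<epsilon>
  proof -
    have "eventually (\<lambda>n. nearE (\<sigma> n) (u n) (u n) < L + \<epsilon>) sequentially"
      using near \<epsilon> by (intro order_tendstoD(2)[of _ L]) auto
    then obtain m where m: "\<And>n. n \<ge> m \<Longrightarrow> nearE (\<sigma> n) (u n) (u n) < L + \<epsilon>" by (auto simp: eventually_sequentially)
    have "(\<lambda>n. \<sigma> (n + m)) \<longlonglongrightarrow> t" using \<sigma>(3) by (rule LIMSEQ_ignore_initial_segment)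
    moreover have "L2_lim (\<lambda>n. u (n + m)) v" using u(3) unfolding L2_lim_def by (rule LIMSEQ_ignore_initial_segment)
    moreover have "nearE (\<sigma> (n + m)) (u (n + m)) (u (n + m)) \<le> L + \<epsilon>" for n using m[of "n + m"] by simp
    ultimately show ?thesis
      using nearE_fatou[of "\<lambda>n. \<sigma> (n + m)" t "\<lambda>n. u (n + m)" v "L + \<epsilon>"] u(1,2) by blast
  qed
  have D: "v \<in> Dom \<Omega> t" using *[of 1] by simp
  have "nearE t v v \<le> L" by (rule field_le_epsilon) (use * in blast)
  then have "?c t / 2 * nearE t v v \<le> ?c t / 2 * L" using ct by (intro mult_left_mono) auto
  also have "?c t / 2 * L = c + ?c t * farB t v v - ?\<rho> t * ip v v" using ct by (simp add: L_def)
  finally have "Qf t v v \<le> c" by (simp add: Qf_def)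
  then show ?thesis using D by simp
qed

end

section \<open>Convolution and compactness\<close>

lemma weighted_cauchy_schwarz:
  fixes w f :: "'a \<Rightarrow> real"
  assumes "\<And>x. 0 \<le> w x" "integrable M w" "integrable M (\<lambda>x. w x * f x)" "integrable M (\<lambda>x. w x * (f x)\<^sup>2)"
  shows "(\<integral>x. w x * f x \<partial>M)\<^sup>2 \<le> (\<integral>x. w x \<partial>M) * (\<integral>x. w x * (f x)\<^sup>2 \<partial>M)"
proof -
  have "(\<integral>x. w x * f x \<partial>M)\<^sup>2 \<le> (\<integral>x. w x * (f x)\<^sup>2 \<partial>M) * (\<integral>x. w x \<partial>M)"
  proof (rule quadratic_nonneg_coeff)
    fix t
    have "0 \<le> (\<integral>x. w x * (f x + t)\<^sup>2 \<partial>M)"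
      using assms(1) by (intro integral_nonneg_AE AE_I2 mult_nonneg_nonneg) auto
    also have "\<dots> = (\<integral>x. w x * (f x)\<^sup>2 + 2 * t * (w x * f x) + t\<^sup>2 * w x \<partial>M)"
      by (intro Bochner_Integration.integral_cong) (auto simp: power2_eq_square algebra_simps)
    also have "\<dots> = (\<integral>x. w x * (f x)\<^sup>2 \<partial>M) + 2 * t * (\<integral>x. w x * f x \<partial>M) + t\<^sup>2 * (\<integral>x. w x \<partial>M)"
      using assms by simp
    finally show "0 \<le> (\<integral>x. w x * (f x)\<^sup>2 \<partial>M) + 2 * t * (\<integral>x. w x * f x \<partial>M) + t\<^sup>2 * (\<integral>x. w x \<partial>M)" .
  qed
  then show ?thesis by (simp add: mult.commute)
qed

lemma integrable_lborel_reflect: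
  fixes f :: "'a::euclidean_space \<Rightarrow> real"
  assumes "integrable lborel f"
  shows "integrable lborel (\<lambda>y. f (x - y))"
proof -
  have [measurable]: "f \<in> borel_measurable borel" using borel_measurable_integrable[OF assms] by simp
  show ?thesis
    using assms nn_integral_lborel_reflect[of "\<lambda>y. ennreal (norm (f y))" x] by (simp add: integrable_iff_bounded)
qed

lemma integral_lborel_reflect:
  fixes f :: "'a::euclidean_space \<Rightarrow> real"
  assumes [measurable]: "f \<in> borel_measurable borel"
  shows "(\<integral>y. f (x - y) \<partial>lborel) = (\<integral>y. f y \<partial>lborel)"
proof -
  have "(\<integral>y. f y \<partial>lborel) = (\<integral>y. f y \<partial>density (distr lborel borel (\<lambda>y. x + (-1) *\<^sub>R y)) (\<lambda>_. \<bar>-1::real\<bar>^DIM('a)))"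
    by (subst lborel_affine[of "-1" x]) auto
  also have "\<dots> = (\<integral>y. f (x - y) \<partial>lborel)"
    by (simp add: density_1 integral_distr)
  finally show ?thesis ..
qed

text \<open>Just what makes convolutions of an L1-bounded sequence uniformly bounded and
  equicontinuous. The kernels are not normalised, so \<open>mass\<close> appears explicitly in the
  estimates.\<close>

locale lipschitz_kernel =
  fixes k :: "'a::euclidean_space \<Rightarrow> real" and B L :: real
  assumes k_nonneg: "0 \<le> k z" and k_le: "k z \<le> B"
    and k_lip: "\<bar>k y - k z\<bar> \<le> L * norm (y - z)" and k_int: "integrable lborel k"
begin

definition mass :: real where "mass = (\<integral>z. k z \<partial>lborel)"

definition conv :: "('a \<Rightarrow> real) \<Rightarrow> 'a \<Rightarrow> real" where
  "conv u x = (\<integral>y. k (x - y) * u y \<partial>lborel)"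

lemma k_measurable [measurable]: "k \<in> borel_measurable borel"
  using borel_measurable_integrable[OF k_int] by simp

lemma L_nonneg: "0 \<le> L"
proof -
  obtain b :: 'a where "b \<in> Basis" using nonempty_Basis by blast
  then have "norm b = 1" by simp
  then show ?thesis using k_lip[of b 0] by simp
qed

lemma mult_integrable:
  assumes "integrable lborel u" shows "integrable lborel (\<lambda>y. k (x - y) * u y)"
proof (rule Bochner_Integration.integrable_bound)
  have [measurable]: "u \<in> borel_measurable borel" using borel_measurable_integrable[OF assms] by simp
  show "integrable lborel (\<lambda>y. B * u y)" using assms by simp
  show "(\<lambda>y. k (x - y) * u y) \<in> borel_measurable lborel" by measurable
  show "AE y in lborel. norm (k (x - y) * u y) \<le> norm (B * u y)"
  proof (rule AE_I2)
    fix y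
    have "\<bar>k (x - y)\<bar> \<le> \<bar>B\<bar>" using k_nonneg[of "x - y"] k_le[of "x - y"] by simp
    then show "norm (k (x - y) * u y) \<le> norm (B * u y)" by (simp add: abs_mult mult_right_mono)
  qed
qed

lemma conv_lipschitz:
  assumes u: "integrable lborel u"
  shows "\<bar>conv u x - conv u x'\<bar> \<le> L * (\<integral>y. \<bar>u y\<bar> \<partial>lborel) * norm (x - x')"
proof -
  have "conv u x - conv u x' = (\<integral>y. (k (x - y) - k (x' - y)) * u y \<partial>lborel)"
    unfolding conv_def left_diff_distrib using mult_integrable[OF u] by simp
  also have "\<bar>\<dots>\<bar> \<le> (\<integral>y. \<bar>(k (x - y) - k (x' - y)) * u y\<bar> \<partial>lborel)" by (rule integral_abs_bound)
  also have "\<dots> \<le> (\<integral>y. L * norm (x - x') * \<bar>u y\<bar> \<partial>lborel)"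
  proof (rule integral_mono)
    have "integrable lborel (\<lambda>y. k (x - y) * u y - k (x' - y) * u y)" using mult_integrable[OF u] by simp
    then show "integrable lborel (\<lambda>y. \<bar>(k (x - y) - k (x' - y)) * u y\<bar>)" by (simp add: left_diff_distrib)
    show "\<bar>(k (x - y) - k (x' - y)) * u y\<bar> \<le> L * norm (x - x') * \<bar>u y\<bar>" for y
      unfolding abs_mult using k_lip[of "x - y" "x' - y"] by (intro mult_right_mono) auto
  qed (use u in auto)
  finally show ?thesis by (simp add: mult_ac)
qed

lemma conv_bound:
  assumes u: "integrable lborel u"
  shows "\<bar>conv u x\<bar> \<le> B * (\<integral>y. \<bar>u y\<bar> \<partial>lborel)"
proof -
  have "\<bar>conv u x\<bar> \<le> (\<integral>y. \<bar>k (x - y) * u y\<bar> \<partial>lborel)" unfolding conv_def by (rule integral_abs_bound)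
  also have "\<dots> \<le> (\<integral>y. B * \<bar>u y\<bar> \<partial>lborel)"
  proof (rule integral_mono)
    show "\<bar>k (x - y) * u y\<bar> \<le> B * \<bar>u y\<bar>" for y
      unfolding abs_mult using k_nonneg[of "x - y"] k_le[of "x - y"] by (intro mult_right_mono) auto
  qed (use u mult_integrable[OF u] in auto)
  finally show ?thesis by simp
qed

lemma conv_measurable [measurable]:
  assumes "integrable lborel u" shows "conv u \<in> borel_measurable borel"
proof (rule borel_measurable_continuous_onI)
  have "(L * (\<integral>y. \<bar>u y\<bar> \<partial>lborel))-lipschitz_on UNIV (conv u)"
    using conv_lipschitz[OF assms] L_nonneg by (intro lipschitz_onI) (auto simp: dist_norm intro!: mult_nonneg_nonneg integral_nonneg_AE)
  then show "continuous_on UNIV (conv u)" by (rule lipschitz_on_continuous_on)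
qed

lemma reflected_integrable: "integrable lborel (\<lambda>y. k (x - y))"
  and reflected_integral: "(\<integral>y. k (x - y) \<partial>lborel) = mass"
  using integrable_lborel_reflect[OF k_int] integral_lborel_reflect[of k] by (auto simp: mass_def)

lemma mass_nonneg: "0 \<le> mass" unfolding mass_def using k_nonneg by (intro integral_nonneg_AE) auto

lemma square_integrable:
  assumes "integrable lborel u" "u \<in> L2"
  shows "integrable lborel (\<lambda>y. k (x - y) * (c - u y))" "integrable lborel (\<lambda>y. k (x - y) * (c - u y)\<^sup>2)"
proof -
  have "integrable lborel (\<lambda>y. c * k (x - y) - k (x - y) * u y)"
    using mult_integrable[OF assms(1)] reflected_integrable by simp
  then show "integrable lborel (\<lambda>y. k (x - y) * (c - u y))" by (simp add: algebra_simps)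
  have "integrable lborel (\<lambda>y. (u y)\<^sup>2)" using assms(2) by (simp add: L2_def)
  then have "integrable lborel (\<lambda>y. c\<^sup>2 * k (x - y) - 2 * c * (k (x - y) * u y) + k (x - y) * (u y)\<^sup>2)"
    using mult_integrable[OF assms(1)] mult_integrable reflected_integrable by simp
  then show "integrable lborel (\<lambda>y. k (x - y) * (c - u y)\<^sup>2)" by (simp add: algebra_simps power2_eq_square)
qed

text \<open>The error at \<open>x\<close> is the \<open>k\<close>-weighted integral of
  \<open>u x - u y\<close>, to which weighted Cauchy-Schwarz applies. The mass enters squared on the
  left and once on the right: after normalisation the error is the \<open>k\<close>-energy over
  \<open>mass\<close>, small for large mass.\<close>

lemma conv_error:
  assumes u: "integrable lborel u" "u \<in> L2"
  shows "(\<integral>\<^sup>+x. ennreal ((mass * u x - conv u x)\<^sup>2) \<partial>lborel) \<le>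
     ennreal mass * (\<integral>\<^sup>+p. ennreal (k (fst p - snd p) * (dif u p)\<^sup>2) \<partial>lborel2)"
proof -
  have [measurable]: "u \<in> borel_measurable borel" using u by (simp add: L2_def)
  have "ennreal ((mass * u x - conv u x)\<^sup>2) \<le> ennreal mass * (\<integral>\<^sup>+y. ennreal (k (x - y) * (u x - u y)\<^sup>2) \<partial>lborel)" for x
  proof -
    have "mass * u x - conv u x = (\<integral>y. k (x - y) * (u x - u y) \<partial>lborel)"
    proof -
      have "(\<integral>y. k (x - y) * (u x - u y) \<partial>lborel) = (\<integral>y. k (x - y) * u x - k (x - y) * u y \<partial>lborel)"
        by (simp add: right_diff_distrib)
      also have "\<dots> = mass * u x - conv u x"
        unfolding conv_def using mult_integrable[OF u(1)] reflected_integrable by (simp add: reflected_integral)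
      finally show ?thesis ..
    qed
    then have "(mass * u x - conv u x)\<^sup>2 \<le> mass * (\<integral>y. k (x - y) * (u x - u y)\<^sup>2 \<partial>lborel)"
      using weighted_cauchy_schwarz[of "\<lambda>y. k (x - y)" lborel "\<lambda>y. u x - u y", OF k_nonneg reflected_integrable square_integrable[OF u]]
      by (simp add: reflected_integral)
    then have "ennreal ((mass * u x - conv u x)\<^sup>2) \<le> ennreal (mass * (\<integral>y. k (x - y) * (u x - u y)\<^sup>2 \<partial>lborel))" by (rule ennreal_leI)
    also have "\<dots> = ennreal mass * ennreal (\<integral>y. k (x - y) * (u x - u y)\<^sup>2 \<partial>lborel)"
      using mass_nonneg by (rule ennreal_mult')
    also have "ennreal (\<integral>y. k (x - y) * (u x - u y)\<^sup>2 \<partial>lborel) = (\<integral>\<^sup>+y. ennreal (k (x - y) * (u x - u y)\<^sup>2) \<partial>lborel)"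
      using square_integrable(2)[OF u] k_nonneg by (intro nn_integral_eq_integral[symmetric]) auto
    finally show ?thesis .
  qed
  then have "(\<integral>\<^sup>+x. ennreal ((mass * u x - conv u x)\<^sup>2) \<partial>lborel) \<le> (\<integral>\<^sup>+x. ennreal mass * (\<integral>\<^sup>+y. ennreal (k (x - y) * (u x - u y)\<^sup>2) \<partial>lborel) \<partial>lborel)"
    by (intro nn_integral_mono)
  also have "\<dots> = ennreal mass * (\<integral>\<^sup>+x. \<integral>\<^sup>+y. ennreal (k (x - y) * (u x - u y)\<^sup>2) \<partial>lborel \<partial>lborel)"
    by (rule nn_integral_cmult) measurable
  also have "(\<integral>\<^sup>+x. \<integral>\<^sup>+y. ennreal (k (x - y) * (u x - u y)\<^sup>2) \<partial>lborel \<partial>lborel) = (\<integral>\<^sup>+p. ennreal (k (fst p - snd p) * (dif u p)\<^sup>2) \<partial>lborel2)"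
    by (subst lborel.nn_integral_fst[symmetric]) (auto simp: dif_def)
  finally show ?thesis .
qed

end

subsection \<open>A family of kernels below the critical one with unbounded mass\<close>

text \<open>The critical power truncated near the origin. Subtracting one brings it continuously to
  zero at the unit sphere, so the kernel is Lipschitz with support in the closed unit ball.\<close>

definition jker :: "real \<Rightarrow> 'a::euclidean_space \<Rightarrow> real" where
  "jker \<delta> z = max 0 (max (norm z) \<delta> powr (- real DIM('a)) - 1)"

lemma jker_kernel:
  assumes \<delta>: "0 < \<delta>"
  shows "lipschitz_kernel (jker \<delta> :: 'a::euclidean_space \<Rightarrow> real) (\<delta> powr (- real DIM('a))) (real DIM('a) * \<delta> powr (- real DIM('a) - 1))"
proof
  let ?n = "real DIM('a)"
  fix y z :: 'a
  show "0 \<le> jker \<delta> z" by (simp add: jker_def)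
  show le: "jker \<delta> z \<le> \<delta> powr (- ?n)" for z :: 'a
  proof -
    have "max (norm z) \<delta> powr (- ?n) \<le> \<delta> powr (- ?n)" using \<delta> by (intro powr_mono2') auto
    then show ?thesis by (simp add: jker_def)
  qed
  have "norm (max (norm y) \<delta> powr (- ?n) - max (norm z) \<delta> powr (- ?n)) \<le> (?n * \<delta> powr (- ?n - 1)) * norm (max (norm y) \<delta> - max (norm z) \<delta>)"
  proof (rule field_differentiable_bound[of "{\<delta>..}" _ "\<lambda>t. - ?n * t powr (- ?n - 1)"])
    fix t assume "t \<in> {\<delta>..}"
    then have t: "t \<ge> \<delta>" by simp
    then show "((\<lambda>t. t powr (- ?n)) has_field_derivative - ?n * t powr (- ?n - 1)) (at t within {\<delta>..})"
      using \<delta> by (auto intro!: derivative_eq_intros)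
    have "t powr (- ?n - 1) \<le> \<delta> powr (- ?n - 1)" using \<delta> t by (intro powr_mono2') auto
    then show "norm (- ?n * t powr (- ?n - 1)) \<le> ?n * \<delta> powr (- ?n - 1)" by (simp add: abs_mult)
  qed auto
  moreover have "norm (max (norm y) \<delta> - max (norm z) \<delta>) \<le> norm (y - z)"
    using norm_triangle_ineq3[of y z] by (auto simp: max_def)
  then have "(?n * \<delta> powr (- ?n - 1)) * norm (max (norm y) \<delta> - max (norm z) \<delta>) \<le> (?n * \<delta> powr (- ?n - 1)) * norm (y - z)"
    by (intro mult_left_mono) auto
  ultimately have "\<bar>max (norm y) \<delta> powr (- ?n) - max (norm z) \<delta> powr (- ?n)\<bar> \<le> (?n * \<delta> powr (- ?n - 1)) * norm (y - z)"
    unfolding real_norm_def by linarith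
  then show "\<bar>jker \<delta> y - jker \<delta> z\<bar> \<le> ?n * \<delta> powr (- ?n - 1) * norm (y - z)"
  proof -
    have "\<bar>max 0 (a - 1) - max 0 (b - 1)\<bar> \<le> \<bar>a - b\<bar>" for a b :: real by (auto simp: max_def)
    then show ?thesis unfolding jker_def by (rule order_trans) fact
  qed
  show "integrable lborel (jker \<delta> :: 'a \<Rightarrow> real)"
  proof (rule Bochner_Integration.integrable_bound)
    show "integrable lborel (\<lambda>z. \<delta> powr (- ?n) * indicator (cball 0 1) (z::'a))"
      using emeasure_bounded_finite[of "cball (0::'a) 1"] by (intro integrable_mult_right integrable_real_indicator) auto
    show "(jker \<delta> :: 'a \<Rightarrow> real) \<in> borel_measurable lborel" unfolding jker_def by measurable
    show "AE z in lborel. norm (jker \<delta> (z::'a)) \<le> norm (\<delta> powr (- ?n) * indicator (cball 0 1) z)"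
    proof (rule AE_I2)
      fix z :: 'a
      have "jker \<delta> z = 0" if "norm z > 1"
      proof -
        have "max (norm z) \<delta> powr (- ?n) \<le> 1 powr (- ?n)" using that by (intro powr_mono2') auto
        then show ?thesis by (simp add: jker_def)
      qed
      moreover have "0 \<le> jker \<delta> z" by (simp add: jker_def)
      ultimately show "norm (jker \<delta> z) \<le> norm (\<delta> powr (- ?n) * indicator (cball 0 1) z)"
        using le[of z] by (cases "norm z > 1") (auto simp: indicator_def)
    qed
  qed
qed

text \<open>The squared difference cannot be cancelled: on the diagonal \<open>near\<close> is zero
  by convention while \<open>jker\<close> may be positive, and there \<open>dif\<close>
  vanishes.\<close>

lemma jker_le_near: "jker \<delta> (fst p - snd p) * (dif u p)\<^sup>2 \<le> near 0 p * (dif u p)\<^sup>2"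
  for p :: "'a::euclidean_space \<times> 'a"
proof (cases "fst p = snd p")
  case False
  let ?d = "norm (fst p - snd p)"
  have d: "?d > 0" using False by simp
  have m: "max ?d \<delta> powr (- real DIM('a)) \<le> ?d powr (- real DIM('a))" using d by (intro powr_mono2') auto
  have "jker \<delta> (fst p - snd p) \<le> near 0 p"
  proof (cases "?d < 1")
    case True
    then have "near 0 p = ?d powr (- real DIM('a))" by (simp add: near_def powr_minus_divide)
    then show ?thesis using m by (simp add: jker_def)
  next
    case False
    then have "max ?d \<delta> powr (- real DIM('a)) \<le> 1 powr (- real DIM('a))" by (intro powr_mono2') auto
    then show ?thesis by (simp add: jker_def)
  qed
  then show ?thesis by (intro mult_right_mono) auto
qed (simp add: dif_def)

text \<open>If the masses were bounded, Fatou along \<open>\<delta> = 1 / (n + 1)\<close> would make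
  the critical power integrable at the origin.\<close>

lemma jker_mass_unbounded:
  "\<exists>\<delta>. 0 < \<delta> \<and> M \<le> (\<integral>z. jker \<delta> (z :: 'a::euclidean_space) \<partial>lborel)"
proof (rule ccontr)
  assume neg: "\<not> ?thesis"
  let ?d = "\<lambda>n::nat. 1 / real (Suc n)"
  have le: "(\<integral>\<^sup>+z. ennreal (jker (?d n) (z::'a)) \<partial>lborel) \<le> ennreal M" for n
  proof -
    interpret lipschitz_kernel "jker (?d n) :: 'a \<Rightarrow> real" "?d n powr (- real DIM('a))" "real DIM('a) * ?d n powr (- real DIM('a) - 1)"
      by (rule jker_kernel) simp
    have "(\<integral>\<^sup>+z. ennreal (jker (?d n) (z::'a)) \<partial>lborel) = ennreal (\<integral>z. jker (?d n) (z::'a) \<partial>lborel)"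
      using k_int k_nonneg by (intro nn_integral_eq_integral) auto
    also have "\<dots> \<le> ennreal M" using neg by (intro ennreal_leI) (meson divide_pos_pos not_le_imp_less less_imp_le of_nat_0_less_iff zero_less_Suc zero_less_one)
    finally show ?thesis .
  qed
  have [measurable]: "cball (0::'a) 1 \<in> sets borel" by simp
  have m [measurable]: "(jker d :: 'a \<Rightarrow> real) \<in> borel_measurable borel" for d unfolding jker_def by measurable
  \<comment> \<open>The added indicator pays back the one subtracted in \<open>jker\<close>; its
    integral is finite.\<close>
  have pt: "ennreal (indicator {z. norm z < 1} z / norm z powr real DIM('a)) \<le> liminf (\<lambda>n. ennreal (jker (?d n) z)) + indicator (cball 0 1) z" for z :: 'a
  proof (cases "0 < norm z \<and> norm z < 1")
    case True
    have "?d \<longlonglongrightarrow> 0" by (rule LIMSEQ_Suc[OF lim_1_over_n])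
    then have "eventually (\<lambda>n. ?d n < norm z) sequentially" using True by (intro order_tendstoD(2)[of _ 0]) auto
    then have ev: "eventually (\<lambda>n. ennreal (norm z powr (- real DIM('a)) - 1) \<le> ennreal (jker (?d n) z)) sequentially"
      by eventually_elim (simp add: jker_def max_def)
    have "ennreal (norm z powr (- real DIM('a)) - 1) \<le> liminf (\<lambda>n. ennreal (jker (?d n) z))"
      using ev by (intro Liminf_bounded)
    moreover have "norm z powr (- real DIM('a)) \<ge> 1"
      using True powr_mono2'[of "- real DIM('a)" "norm z" 1] by simp
    then have "ennreal (norm z powr (- real DIM('a))) = ennreal (norm z powr (- real DIM('a)) - 1) + 1"
      by (simp add: ennreal_plus[symmetric] flip: ennreal_1 del: ennreal_plus)
    ultimately have "ennreal (norm z powr (- real DIM('a))) \<le> liminf (\<lambda>n. ennreal (jker (?d n) z)) + 1"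
      by (simp add: add_right_mono)
    then show ?thesis using True by (simp add: powr_minus_divide)
  qed (auto simp: indicator_def)
  have "(\<infinity> :: ennreal) = (\<integral>\<^sup>+z. ennreal (indicator {z. norm z < 1} z / norm z powr real DIM('a)) \<partial>(lborel :: 'a measure))"
    by (rule nn_integral_norm_powr_critical[symmetric])
  also have "\<dots> \<le> (\<integral>\<^sup>+z. liminf (\<lambda>n. ennreal (jker (?d n) z)) + indicator (cball 0 1) z \<partial>(lborel :: 'a measure))"
    by (intro nn_integral_mono pt)
  also have "\<dots> = (\<integral>\<^sup>+z. liminf (\<lambda>n. ennreal (jker (?d n) z)) \<partial>(lborel :: 'a measure)) + emeasure lborel (cball (0::'a) 1)"
    by (subst nn_integral_add) auto
  also have "(\<integral>\<^sup>+z. liminf (\<lambda>n. ennreal (jker (?d n) z)) \<partial>(lborel :: 'a measure)) \<le> liminf (\<lambda>n. \<integral>\<^sup>+z. ennreal (jker (?d n) (z::'a)) \<partial>lborel)"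
    by (rule nn_integral_liminf) measurable
  also have "\<dots> \<le> liminf (\<lambda>n. ennreal M)" by (intro Liminf_mono always_eventually allI le)
  also have "\<dots> = ennreal M" by (simp add: Liminf_const)
  also have "ennreal M + emeasure lborel (cball (0::'a) 1) < \<infinity>"
    using emeasure_bounded_finite[of "cball (0::'a) 1"] by (simp add: ennreal_add_less_top)
  finally show False by simp
qed

subsection \<open>Compactness\<close>

lemma L2I_nn:
  assumes [measurable]: "f \<in> borel_measurable borel" and "(\<integral>\<^sup>+x. ennreal ((f x)\<^sup>2) \<partial>lborel) \<le> ennreal C" "0 \<le> C"
  shows "f \<in> L2" "ip f f \<le> C"
proof -
  have int: "integrable lborel (\<lambda>x. (f x)\<^sup>2)"
    by (rule integrableI_nonneg) (use assms in \<open>auto simp: le_less_trans\<close>)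
  then show "f \<in> L2" by (simp add: L2_def)
  have "ennreal (ip f f) = (\<integral>\<^sup>+x. ennreal ((f x)\<^sup>2) \<partial>lborel)"
    unfolding ip_def power2_eq_square[symmetric] using int by (intro nn_integral_eq_integral[symmetric]) auto
  then have "ennreal (ip f f) \<le> ennreal C" using assms(2) by simp
  then show "ip f f \<le> C" using assms(3) by simp
qed

lemma ip_eq_nn: "f \<in> L2 \<Longrightarrow> ennreal (ip f f) = (\<integral>\<^sup>+x. ennreal ((f x)\<^sup>2) \<partial>lborel)"
  unfolding ip_def power2_eq_square[symmetric] by (intro nn_integral_eq_integral[symmetric]) (auto simp: L2_def)

context bounded_open
begin

text \<open>The Riesz-Fischer argument. Squared distances of order \<open>(1/4)^n\<close> give L1
  increments of order \<open>(1/2)^n\<close>, whose sum is finite; this produces the pointwise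
  limit, and Fatou controls the distance to it.\<close>

lemma L2_fast_cauchy_converges:
  fixes t :: "nat \<Rightarrow> 'a \<Rightarrow> real"
  assumes t: "\<And>n. t n \<in> L2" "\<And>n. vanishes_off \<Omega> (t n)"
    and cauchy: "\<And>n i j. n \<le> i \<Longrightarrow> n \<le> j \<Longrightarrow> on_diff ip (t i) (t j) \<le> (1/4)^n"
  shows "\<exists>v\<in>L2. L2_lim t v"
proof -
  have [measurable]: "t n \<in> borel_measurable borel" for n using t(1)[of n] by (simp add: L2_def)
  let ?K = "sqrt (measure lborel \<Omega>)"
  have d: "(\<lambda>x. t (Suc n) x - t n x) \<in> L2" "vanishes_off \<Omega> (\<lambda>x. t (Suc n) x - t n x)" for n
    using L2_diff[OF t(1) t(1)] vanishes_off_lin[OF t(2) t(2), of 1 "Suc n" "-1" n] by auto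
  have L1: "(\<integral>\<^sup>+x. ennreal \<bar>t (Suc n) x - t n x\<bar> \<partial>lborel) \<le> ennreal (?K * (1/2)^n)" for n
  proof -
    have "sqrt (on_diff ip (t (Suc n)) (t n)) \<le> sqrt ((1/4)^n)"
      using cauchy[of n "Suc n" n] by (intro real_sqrt_le_mono) auto
    also have "\<dots> = (1/2)^n" by (simp add: real_sqrt_power real_sqrt_divide)
    finally have "?K * sqrt (on_diff ip (t (Suc n)) (t n)) \<le> ?K * (1/2)^n"
      by (intro mult_left_mono) auto
    then have "(\<integral>x. \<bar>t (Suc n) x - t n x\<bar> \<partial>lborel) \<le> ?K * (1/2)^n" using L1_bound(2)[OF d[of n]] by linarith
    then show ?thesis
      using L1_bound(1)[OF d[of n]] by (subst nn_integral_eq_integral) (auto intro: ennreal_leI)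
  qed
  have "(\<integral>\<^sup>+x. (\<Sum>n. ennreal \<bar>t (Suc n) x - t n x\<bar>) \<partial>lborel) = (\<Sum>n. \<integral>\<^sup>+x. ennreal \<bar>t (Suc n) x - t n x\<bar> \<partial>lborel)"
    by (rule nn_integral_suminf) measurable
  also have "\<dots> \<le> (\<Sum>n. ennreal (?K * (1/2)^n))" by (intro suminf_le L1) auto
  also have "\<dots> = ennreal (\<Sum>n. ?K * (1/2)^n)" by (intro suminf_ennreal2 summable_mult summable_geometric) auto
  also have "\<dots> < \<infinity>" by simp
  finally have "(\<integral>\<^sup>+x. (\<Sum>n. ennreal \<bar>t (Suc n) x - t n x\<bar>) \<partial>lborel) \<noteq> \<infinity>" by simp
  then have "AE x in lborel. (\<Sum>n. ennreal \<bar>t (Suc n) x - t n x\<bar>) \<noteq> \<infinity>"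
    by (intro nn_integral_PInf_AE) auto
  then have conv: "AE x in lborel. convergent (\<lambda>n. t n x)"
  proof eventually_elim
    case (elim x)
    have "summable (\<lambda>n. \<bar>t (Suc n) x - t n x\<bar>)"
      using elim by (intro summable_suminf_not_top) (auto simp: top_neq_ennreal)
    then have "summable (\<lambda>n. t (Suc n) x - t n x)" by (rule summable_rabs_cancel)
    then obtain l where "(\<lambda>m. \<Sum>n<m. t (Suc n) x - t n x) \<longlonglongrightarrow> l"
      using summable_LIMSEQ by blast
    then have "(\<lambda>m. (t m x - t 0 x) + t 0 x) \<longlonglongrightarrow> l + t 0 x"
      using sum_lessThan_telescope[of "\<lambda>n. t n x"] by (intro tendsto_add tendsto_const) simp
    then show ?case by (auto simp: convergent_def)
  qed
  define v where "v x = lim (\<lambda>n. t n x)" for x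
  have [measurable]: "v \<in> borel_measurable borel" unfolding v_def by measurable
  have tv: "(\<integral>\<^sup>+x. ennreal ((t n x - v x)\<^sup>2) \<partial>lborel) \<le> ennreal ((1/4)^n)" for n
  proof -
    have "AE x in lborel. ennreal ((t n x - v x)\<^sup>2) = liminf (\<lambda>m. ennreal ((t n x - t m x)\<^sup>2))"
      using conv
    proof eventually_elim
      case (elim x)
      then have "(\<lambda>m. t m x) \<longlonglongrightarrow> v x" by (simp add: v_def convergent_LIMSEQ_iff)
      then have "(\<lambda>m. ennreal ((t n x - t m x)\<^sup>2)) \<longlonglongrightarrow> ennreal ((t n x - v x)\<^sup>2)" by (intro tendsto_intros)
      then show ?case by (intro lim_imp_Liminf[symmetric]) auto
    qed
    then have "(\<integral>\<^sup>+x. ennreal ((t n x - v x)\<^sup>2) \<partial>lborel) = (\<integral>\<^sup>+x. liminf (\<lambda>m. ennreal ((t n x - t m x)\<^sup>2)) \<partial>lborel)"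
      by (rule nn_integral_cong_AE)
    also have "\<dots> \<le> liminf (\<lambda>m. \<integral>\<^sup>+x. ennreal ((t n x - t m x)\<^sup>2) \<partial>lborel)" by (rule nn_integral_liminf) measurable
    also have "\<dots> \<le> liminf (\<lambda>m. ennreal ((1/4)^n))"
    proof (rule Liminf_mono)
      show "\<forall>\<^sub>F m in sequentially. (\<integral>\<^sup>+x. ennreal ((t n x - t m x)\<^sup>2) \<partial>lborel) \<le> ennreal ((1/4)^n)"
        using eventually_ge_at_top[of n]
        by eventually_elim (use cauchy[of n n] in \<open>simp add: ip_eq_nn[OF L2_diff[OF t(1) t(1)], symmetric] ennreal_leI\<close>)
    qed
    also have "\<dots> = ennreal ((1/4)^n)" by (simp add: Liminf_const)
    finally show ?thesis .
  qed
  have D: "(\<lambda>x. t n x - v x) \<in> L2" "on_diff ip (t n) v \<le> (1/4)^n" for n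
    using L2I_nn[OF _ tv] by auto
  have "v \<in> L2" using L2_diff[OF t(1)[of 0] D(1)[of 0]] by simp
  moreover have "L2_lim t v" unfolding L2_lim_def
  proof (rule tendsto_sandwich[of "\<lambda>_. 0" _ _ "\<lambda>n. (1/4)^n"])
    show "(\<lambda>n. (1/4::real)^n) \<longlonglongrightarrow> 0" by (rule LIMSEQ_power_zero) simp
  qed (use D in \<open>auto simp: ip_nonneg\<close>)
  ultimately show ?thesis by blast
qed

text \<open>The kernel scale \<open>\<delta>\<close> depends on \<open>\<epsilon>\<close>, so one
  application of Arzela-Ascoli yields only a subsequence with mutual distances at most
  \<open>\<epsilon>\<close>; a diagonal sequence finishes the argument.\<close>

lemma near_precompact_step:
  fixes u :: "nat \<Rightarrow> 'a \<Rightarrow> real"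
  assumes u: "\<And>n. u n \<in> Dom \<Omega> 0" "\<And>n. ip (u n) (u n) \<le> C1" "\<And>n. nearE 0 (u n) (u n) \<le> C2" and \<epsilon>: "\<epsilon> > 0"
  shows "\<exists>r :: nat \<Rightarrow> nat. strict_mono r \<and> (\<forall>i j. on_diff ip (u (r i)) (u (r j)) \<le> \<epsilon>)"
proof -
  let ?K = "measure lborel \<Omega>"
  have C: "0 \<le> C1" "0 \<le> C2" using u(2,3)[of 0] ip_nonneg[of "u 0"] nearE_nonneg[of 0 "u 0"] by auto
  \<comment> \<open>The two convolution errors, each with factor 3, contribute
    \<open>6 * mass * C2\<close>; the bound 12 keeps this below half of
    \<open>mass\<^sup>2 * \<epsilon>\<close>. Mass at least one serves the other half.\<close>
  obtain \<delta> where \<delta>: "0 < \<delta>" "max 1 (12 * C2 / \<epsilon>) \<le> (\<integral>z. jker \<delta> (z :: 'a) \<partial>lborel)"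
    using jker_mass_unbounded by blast
  interpret lipschitz_kernel "jker \<delta> :: 'a \<Rightarrow> real" "\<delta> powr (- real DIM('a))" "real DIM('a) * \<delta> powr (- real DIM('a) - 1)"
    using \<delta>(1) by (rule jker_kernel)
  let ?B = "\<delta> powr (- real DIM('a))" and ?L = "real DIM('a) * \<delta> powr (- real DIM('a) - 1)"
  have J: "mass \<ge> 1" "12 * C2 \<le> mass * \<epsilon>" using \<delta>(2) \<epsilon> by (auto simp: mass_def field_simps)
  have L1: "integrable lborel (u n)" for n using Dom_integrable u(1) by blast
  let ?S = "sqrt ?K * sqrt C1"
  have S: "(\<integral>y. \<bar>u n y\<bar> \<partial>lborel) \<le> ?S" for n
  proof -
    have "sqrt ?K * sqrt (ip (u n) (u n)) \<le> ?S" using u(2)[of n] by (intro mult_left_mono real_sqrt_le_mono) auto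
    then show ?thesis using L1_bound(2)[OF DomD(1,2)[OF u(1)], of n] by linarith
  qed
  have S0: "0 \<le> ?S" using C by simp
  obtain g r where g: "strict_mono (r :: nat \<Rightarrow> nat)"
    "\<And>e. 0 < e \<Longrightarrow> \<exists>N. \<forall>n x. n \<ge> N \<and> x \<in> closure \<Omega> \<longrightarrow> norm (conv (u (r n)) x - g x) < e"
  proof (rule Arzela_Ascoli[of "closure \<Omega>" "\<lambda>n. conv (u n)" "?B * ?S"])
    show "compact (closure \<Omega>)" using bounded_\<Omega> by simp
    show "norm (conv (u n) x) \<le> ?B * ?S" for n x
    proof -
      have "?B * (\<integral>y. \<bar>u n y\<bar> \<partial>lborel) \<le> ?B * ?S" using S by (intro mult_left_mono) auto
      then show ?thesis using conv_bound[OF L1, of n x] unfolding real_norm_def by linarith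
    qed
    fix x e :: real and x0 :: 'a assume e: "0 < e"
    have lip: "norm (conv (u n) x0 - conv (u n) y) \<le> ?L * ?S * norm (x0 - y)" for n y
    proof -
      have "?L * (\<integral>y. \<bar>u n y\<bar> \<partial>lborel) * norm (x0 - y) \<le> ?L * ?S * norm (x0 - y)"
        using S L_nonneg by (intro mult_right_mono mult_left_mono) auto
      then show ?thesis using conv_lipschitz[OF L1, of n x0 y] unfolding real_norm_def by linarith
    qed
    show "\<exists>d>0. \<forall>n y. y \<in> closure \<Omega> \<and> norm (x0 - y) < d \<longrightarrow> norm (conv (u n) x0 - conv (u n) y) < e"
    proof (intro exI conjI allI impI)
      have p: "?L * ?S + 1 > 0" using L_nonneg S0 by (metis add_nonneg_pos mult_nonneg_nonneg zero_less_one)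
      then show "e / (?L * ?S + 1) > 0" using e by simp
      fix n y assume y: "y \<in> closure \<Omega> \<and> norm (x0 - y) < e / (?L * ?S + 1)"
      have "?L * ?S * norm (x0 - y) \<le> (?L * ?S + 1) * norm (x0 - y)" by (intro mult_right_mono) auto
      also have "\<dots> < e" using y p by (simp add: pos_less_divide_eq mult.commute)
      finally show "norm (conv (u n) x0 - conv (u n) y) < e" using lip[of n y] by linarith
    qed
  qed blast
  \<comment> \<open>Uniform closeness \<open>2 * \<eta>\<close> of two convolutions contributes
    \<open>3 * (2 * \<eta>)\<^sup>2\<close> times the volume, that is
    \<open>12 * \<eta>\<^sup>2 * ?K\<close>, to be at most \<epsilon>/2.\<close>
  define \<eta> where "\<eta> = sqrt (\<epsilon> / (24 * (?K + 1)))"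
  have K: "0 \<le> ?K" by simp
  have \<eta>: "\<eta> > 0" "12 * \<eta>\<^sup>2 * ?K \<le> \<epsilon> / 2"
  proof -
    have K1: "?K + 1 > 0" using K by linarith
    show "\<eta> > 0" unfolding \<eta>_def using \<epsilon> K1 by (intro real_sqrt_gt_zero divide_pos_pos mult_pos_pos) auto
    have "\<eta>\<^sup>2 = \<epsilon> / (24 * (?K + 1))" unfolding \<eta>_def using \<epsilon> K1 by (intro real_sqrt_pow2 divide_nonneg_nonneg mult_nonneg_nonneg) auto
    moreover have "12 * (\<epsilon> / (24 * q)) * ?K = (\<epsilon> / 2) * (?K / q)" for q by simp
    ultimately have "12 * \<eta>\<^sup>2 * ?K = (\<epsilon> / 2) * (?K / (?K + 1))" by (simp only:)
    also have "\<dots> \<le> (\<epsilon> / 2) * 1" using \<epsilon> K1 by (intro mult_left_mono) (auto simp: divide_le_eq_1)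
    finally show "12 * \<eta>\<^sup>2 * ?K \<le> \<epsilon> / 2" by simp
  qed
  obtain N where N: "\<And>n x. n \<ge> N \<Longrightarrow> x \<in> closure \<Omega> \<Longrightarrow> norm (conv (u (r n)) x - g x) < \<eta>" using g(2)[OF \<eta>(1)] by blast
  have err: "(\<integral>\<^sup>+x. ennreal ((mass * u n x - conv (u n) x)\<^sup>2) \<partial>lborel) \<le> ennreal (mass * C2)" for n
  proof -
    have "(\<integral>\<^sup>+x. ennreal ((mass * u n x - conv (u n) x)\<^sup>2) \<partial>lborel) \<le>
       ennreal mass * (\<integral>\<^sup>+p. ennreal (jker \<delta> (fst p - snd p) * (dif (u n) p)\<^sup>2) \<partial>lborel2)"
      by (rule conv_error[OF L1 DomD(1)[OF u(1)]])
    also have "\<dots> \<le> ennreal mass * (\<integral>\<^sup>+p. ennreal (near 0 p * (dif (u n) p)\<^sup>2) \<partial>lborel2)"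
      by (intro mult_left_mono nn_integral_mono ennreal_leI jker_le_near) auto
    also have "\<dots> \<le> ennreal mass * ennreal C2"
      unfolding nearE_eq_nn[OF u(1), symmetric] using u(3) by (intro mult_left_mono ennreal_leI) auto
    also have "\<dots> = ennreal (mass * C2)" using mass_nonneg by (rule ennreal_mult'[symmetric])
    finally show ?thesis .
  qed
  have main: "on_diff ip (u (r i)) (u (r j)) \<le> \<epsilon>" if ij: "i \<ge> N" "j \<ge> N" for i j
  proof -
    define a b where "a = u (r i)" and "b = u (r j)"
    have ab: "a \<in> L2" "b \<in> L2" "vanishes_off \<Omega> a" "vanishes_off \<Omega> b" "integrable lborel a" "integrable lborel b"
      using DomD[OF u(1)] L1 by (auto simp: a_def b_def)
    have [measurable]: "a \<in> borel_measurable borel" "b \<in> borel_measurable borel" using ab by (auto simp: L2_def)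
    have [measurable]: "conv a \<in> borel_measurable borel" "conv b \<in> borel_measurable borel" using ab conv_measurable by auto
    \<comment> \<open>Both functions vanish almost everywhere off \<Omega>, so uniform closeness is
      used only on \<Omega>, where its cost is a finite volume.\<close>
    have ae: "AE x in lborel. ennreal (mass\<^sup>2 * (a x - b x)\<^sup>2) \<le>
        ennreal 3 * ennreal ((mass * a x - conv a x)\<^sup>2) + ennreal 3 * ennreal ((mass * b x - conv b x)\<^sup>2) + ennreal (12 * \<eta>\<^sup>2) * indicator \<Omega> x"
      using ab(3,4) unfolding vanishes_off_def
    proof eventually_elim
      case (elim x)
      show ?case
      proof (cases "x \<in> \<Omega>")
        case True
        then have x: "x \<in> closure \<Omega>" using closure_subset by blast
        have "\<bar>conv a x - conv b x\<bar> \<le> 2 * \<eta>" using N[OF ij(1) x] N[OF ij(2) x] unfolding a_def b_def by auto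
        then have "\<bar>conv a x - conv b x\<bar>\<^sup>2 \<le> (2 * \<eta>)\<^sup>2" by (intro power_mono) auto
        then have c: "(conv a x - conv b x)\<^sup>2 \<le> 4 * \<eta>\<^sup>2" by (simp add: power_mult_distrib)
        have three: "(p + q + s)\<^sup>2 \<le> 3 * p\<^sup>2 + 3 * q\<^sup>2 + 3 * s\<^sup>2" for p q s :: real
          using zero_le_power2[of "p - q"] zero_le_power2[of "p - s"] zero_le_power2[of "q - s"]
          by (simp add: power2_eq_square algebra_simps)
        have "mass\<^sup>2 * (a x - b x)\<^sup>2 = ((mass * a x - conv a x) + (conv b x - mass * b x) + (conv a x - conv b x))\<^sup>2"
          by (simp add: power2_eq_square algebra_simps)
        also have "\<dots> \<le> 3 * (mass * a x - conv a x)\<^sup>2 + 3 * (mass * b x - conv b x)\<^sup>2 + 12 * \<eta>\<^sup>2"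
          using three[of "mass * a x - conv a x" "conv b x - mass * b x" "conv a x - conv b x"] c
          by (simp add: power2_commute[of "conv b x"])
        finally have "ennreal (mass\<^sup>2 * (a x - b x)\<^sup>2) \<le> ennreal (3 * (mass * a x - conv a x)\<^sup>2 + 3 * (mass * b x - conv b x)\<^sup>2 + 12 * \<eta>\<^sup>2)"
          by (rule ennreal_leI)
        also have "\<dots> = ennreal 3 * ennreal ((mass * a x - conv a x)\<^sup>2) + ennreal 3 * ennreal ((mass * b x - conv b x)\<^sup>2) + ennreal (12 * \<eta>\<^sup>2)"
          by (simp only: ennreal_mult'[symmetric] ennreal_plus[symmetric] zero_le_power2 zero_le_mult_iff zero_le_numeral add_nonneg_nonneg simp_thms)
        finally show ?thesis using True by simp
      next
        case False
        then show ?thesis using elim by simp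
      qed
    qed
    have "ennreal (mass\<^sup>2) * ennreal (on_diff ip a b) = (\<integral>\<^sup>+x. ennreal (mass\<^sup>2 * (a x - b x)\<^sup>2) \<partial>lborel)"
      unfolding ip_eq_nn[OF L2_diff[OF ab(1,2)]] by (simp add: ennreal_mult' nn_integral_cmult)
    also have "\<dots> \<le> (\<integral>\<^sup>+x. ennreal 3 * ennreal ((mass * a x - conv a x)\<^sup>2) + ennreal 3 * ennreal ((mass * b x - conv b x)\<^sup>2) + ennreal (12 * \<eta>\<^sup>2) * indicator \<Omega> x \<partial>lborel)"
      using ae by (rule nn_integral_mono_AE)
    also have "\<dots> = ennreal 3 * (\<integral>\<^sup>+x. ennreal ((mass * a x - conv a x)\<^sup>2) \<partial>lborel) + ennreal 3 * (\<integral>\<^sup>+x. ennreal ((mass * b x - conv b x)\<^sup>2) \<partial>lborel) + ennreal (12 * \<eta>\<^sup>2) * emeasure lborel \<Omega>"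
      by (simp add: nn_integral_add nn_integral_cmult nn_integral_cmult_indicator)
    also have "\<dots> \<le> ennreal 3 * ennreal (mass * C2) + ennreal 3 * ennreal (mass * C2) + ennreal (12 * \<eta>\<^sup>2) * ennreal ?K"
      using err[of "r i"] err[of "r j"] \<Omega>_finite unfolding a_def b_def
      by (intro add_mono mult_left_mono) (auto simp: emeasure_eq_ennreal_measure)
    also have "\<dots> = ennreal (3 * (mass * C2)) + ennreal (3 * (mass * C2)) + ennreal (12 * \<eta>\<^sup>2 * ?K)"
      by (simp only: ennreal_mult'[symmetric] zero_le_numeral zero_le_power2 mult_nonneg_nonneg)
    also have "\<dots> = ennreal (3 * (mass * C2) + 3 * (mass * C2) + 12 * \<eta>\<^sup>2 * ?K)"
      using mass_nonneg C by (simp only: ennreal_plus mult_nonneg_nonneg add_nonneg_nonneg zero_le_numeral zero_le_power2 K)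
    also have "3 * (mass * C2) + 3 * (mass * C2) + 12 * \<eta>\<^sup>2 * ?K = 6 * (mass * C2) + 12 * \<eta>\<^sup>2 * ?K" by simp
    finally have "ennreal (mass\<^sup>2 * on_diff ip a b) \<le> ennreal (6 * (mass * C2) + 12 * \<eta>\<^sup>2 * ?K)"
      by (simp add: ennreal_mult')
    then have "mass\<^sup>2 * on_diff ip a b \<le> 6 * (mass * C2) + 12 * \<eta>\<^sup>2 * ?K"
      using mass_nonneg C by (subst (asm) ennreal_le_iff) auto
    also have "\<dots> \<le> mass * (mass * \<epsilon>) / 2 + \<epsilon> / 2"
    proof -
      have "mass * (12 * C2) \<le> mass * (mass * \<epsilon>)" using J mass_nonneg by (intro mult_left_mono) auto
      then show ?thesis using \<eta>(2) by simp
    qed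
    also have "\<dots> \<le> mass\<^sup>2 * \<epsilon>"
    proof -
      have "1 \<le> mass\<^sup>2" using J(1) by simp
      then have "1 * \<epsilon> \<le> mass\<^sup>2 * \<epsilon>" using \<epsilon> by (intro mult_right_mono) auto
      then show ?thesis by (simp add: power2_eq_square)
    qed
    finally have "on_diff ip a b \<le> \<epsilon>"
      using J(1) by (subst (asm) mult_le_cancel_left_pos) auto
    then show ?thesis by (simp add: a_def b_def)
  qed
  have "strict_mono (\<lambda>n. r (n + N))" using g(1) by (auto simp: strict_mono_def)
  moreover have "\<forall>i j. ip (\<lambda>x. u (r (i + N)) x - u (r (j + N)) x) (\<lambda>x. u (r (i + N)) x - u (r (j + N)) x) \<le> \<epsilon>"
    by (intro allI main) simp_all
  ultimately show ?thesis by (intro exI[of _ "\<lambda>n. r (n + N)"] conjI)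
qed

theorem near_compact:
  fixes u :: "nat \<Rightarrow> 'a \<Rightarrow> real"
  assumes u: "\<And>n. u n \<in> Dom \<Omega> 0" "\<And>n. ip (u n) (u n) \<le> C1" "\<And>n. nearE 0 (u n) (u n) \<le> C2"
  shows "\<exists>r v. strict_mono r \<and> v \<in> L2 \<and> L2_lim (\<lambda>n. u (r n)) v"
proof -
  define P where "P n s \<longleftrightarrow> (\<forall>i j. on_diff ip (u (s i)) (u (s j)) \<le> (1/4)^n)"
    for n :: nat and s :: "nat \<Rightarrow> nat"
  interpret subseqs P
  proof
    fix n and s :: "nat \<Rightarrow> nat"
    show "\<exists>r'. strict_mono r' \<and> P n (s \<circ> r')"
      using near_precompact_step[of "\<lambda>n. u (s n)" C1 C2 "(1/4)^n"] u by (auto simp: P_def)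
  qed
  have P: "P n (diagseq \<circ> (+) (Suc n))" for n
    by (rule diagseq_holds) (auto simp: P_def)
  \<comment> \<open>The diagonal sequence is known to satisfy \<open>P n\<close> only from index
    \<open>Suc n\<close> on; the shift makes the Cauchy estimate start at \<open>n\<close>.\<close>
  define t where "t n = u (diagseq (Suc n))" for n
  have "on_diff ip (t i) (t j) \<le> (1/4)^n" if "n \<le> i" "n \<le> j" for n i j
  proof -
    have "ip (\<lambda>x. u (diagseq (Suc n + (i - n))) x - u (diagseq (Suc n + (j - n))) x)
        (\<lambda>x. u (diagseq (Suc n + (i - n))) x - u (diagseq (Suc n + (j - n))) x) \<le> (1/4)^n"
      using P[of n] unfolding P_def by (simp only: o_def)
    then show ?thesis using that by (simp add: t_def)
  qed
  moreover have "t n \<in> L2" "vanishes_off \<Omega> (t n)" for n using DomD[OF u(1)] by (auto simp: t_def)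
  ultimately obtain v where v: "v \<in> L2" "L2_lim t v" using L2_fast_cauchy_converges[of t] by blast
  have "strict_mono (\<lambda>n. diagseq (Suc n))" using subseq_diagseq by (simp add: strict_mono_def)
  then show ?thesis using v unfolding t_def by blast
qed

end

section \<open>The core of Lipschitz functions\<close>

text \<open>The Lipschitz bound holds on the whole space and the vanishing is pointwise, so
  differences across the boundary of \<Omega> are controlled as well.\<close>

definition lip_core :: "'a::euclidean_space set \<Rightarrow> ('a \<Rightarrow> real) set" where
  "lip_core \<Omega> = {v. (\<exists>L\<ge>0. \<forall>x y. \<bar>v x - v y\<bar> \<le> L * norm (x - y)) \<and> (\<forall>x. x \<notin> \<Omega> \<longrightarrow> v x = 0)}"

lemma lip_core_lin:
  assumes "u \<in> lip_core \<Omega>" "v \<in> lip_core \<Omega>"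
  shows "(\<lambda>x. a * u x + b * v x) \<in> lip_core \<Omega>"
proof -
  obtain L where L: "L \<ge> 0" "\<And>x y. \<bar>u x - u y\<bar> \<le> L * norm (x - y)" using assms by (auto simp: lip_core_def)
  obtain K where K: "K \<ge> 0" "\<And>x y. \<bar>v x - v y\<bar> \<le> K * norm (x - y)" using assms by (auto simp: lip_core_def)
  have "\<bar>(a * u x + b * v x) - (a * u y + b * v y)\<bar> \<le> (\<bar>a\<bar> * L + \<bar>b\<bar> * K) * norm (x - y)" for x y
  proof -
    have "\<bar>(a * u x + b * v x) - (a * u y + b * v y)\<bar> = \<bar>a * (u x - u y) + b * (v x - v y)\<bar>" by (simp add: algebra_simps)
    also have "\<dots> \<le> \<bar>a\<bar> * \<bar>u x - u y\<bar> + \<bar>b\<bar> * \<bar>v x - v y\<bar>" by (metis abs_mult abs_triangle_ineq)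
    also have "\<dots> \<le> \<bar>a\<bar> * (L * norm (x - y)) + \<bar>b\<bar> * (K * norm (x - y))"
      using L K by (intro add_mono mult_left_mono) auto
    finally show ?thesis by (simp add: algebra_simps)
  qed
  then show ?thesis using assms L(1) K(1) unfolding lip_core_def
    by (auto intro!: exI[of _ "\<bar>a\<bar> * L + \<bar>b\<bar> * K"])
qed

lemma lip_core_continuous: "v \<in> lip_core \<Omega> \<Longrightarrow> continuous_on A v"
proof -
  assume "v \<in> lip_core \<Omega>"
  then obtain L where "L \<ge> 0" "\<And>x y. \<bar>v x - v y\<bar> \<le> L * norm (x - y)" by (auto simp: lip_core_def)
  then have "L-lipschitz_on A v" by (intro lipschitz_onI) (auto simp: dist_norm)
  then show "continuous_on A v" by (rule lipschitz_on_continuous_on)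
qed

text \<open>Serves for majorants supported on pairs with at least one point in \<open>S\<close>: all
  of \<Omega> for the core, the boundary strip for cutoffs.\<close>

lemma nn_integral_pair_indicator:
  fixes S :: "'a::euclidean_space set" and h :: "'a \<Rightarrow> real"
  assumes [measurable]: "S \<in> sets borel" "h \<in> borel_measurable borel" and h: "\<And>z. 0 \<le> h z" "\<And>z. h (- z) = h z"
  shows "(\<integral>\<^sup>+p. ennreal ((indicator S (fst p) + indicator S (snd p)) * h (fst p - snd p)) \<partial>lborel2)
    = 2 * (emeasure lborel S * (\<integral>\<^sup>+z. ennreal (h z) \<partial>lborel))"
proof -
  let ?F = "\<lambda>p. ennreal (indicator S (fst p)) * ennreal (h (fst p - snd p))"
  have 1: "(\<integral>\<^sup>+p. ?F p \<partial>lborel2) = emeasure lborel S * (\<integral>\<^sup>+z. ennreal (h z) \<partial>lborel)"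
    using nn_integral_pair_convolution[of "\<lambda>x. ennreal (indicator S x)" "\<lambda>z. ennreal (h z)"]
    by (simp add: ennreal_indicator)
  have hs: "h (y - x) = h (x - y)" for x y using h(2)[of "x - y"] by simp
  have "(\<integral>\<^sup>+p. ennreal ((indicator S (fst p) + indicator S (snd p)) * h (fst p - snd p)) \<partial>lborel2)
     = (\<integral>\<^sup>+p. ?F p + ?F (snd p, fst p) \<partial>lborel2)"
    using h by (intro nn_integral_cong) (simp add: hs distrib_right ennreal_mult'[symmetric])
  also have "\<dots> = (\<integral>\<^sup>+p. ?F p \<partial>lborel2) + (\<integral>\<^sup>+p. ?F (snd p, fst p) \<partial>lborel2)"
    by (rule nn_integral_add) measurable
  also have "(\<integral>\<^sup>+p. ?F (snd p, fst p) \<partial>lborel2) = (\<integral>\<^sup>+p. ?F p \<partial>lborel2)"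
    by (rule nn_integral_pair_swap) measurable
  finally show ?thesis unfolding 1 by (simp add: mult_2)
qed

context bounded_open
begin

lemma lip_core_L2:
  assumes v: "v \<in> lip_core \<Omega>"
  shows "v \<in> L2" "vanishes_off \<Omega> v"
proof -
  have c: "continuous_on UNIV v" using lip_core_continuous[OF v] .
  have [measurable]: "v \<in> borel_measurable borel" using c by (rule borel_measurable_continuous_onI)
  have z: "v x = 0" if "x \<notin> \<Omega>" for x using v that by (simp add: lip_core_def)
  have "compact (v ` closure \<Omega>)" using bounded_\<Omega> lip_core_continuous[OF v] by (intro compact_continuous_image) auto
  then have "bounded (v ` closure \<Omega>)" by (rule compact_imp_bounded)
  then obtain B where B: "\<And>x. x \<in> closure \<Omega> \<Longrightarrow> \<bar>v x\<bar> \<le> B" by (auto simp: bounded_iff)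
  have "integrable lborel (\<lambda>x. (v x)\<^sup>2)"
  proof (rule Bochner_Integration.integrable_bound)
    show "integrable lborel (\<lambda>x. B\<^sup>2 * indicator \<Omega> x :: real)"
      using \<Omega>_finite by (intro integrable_mult_right integrable_real_indicator) auto
    show "AE x in lborel. norm ((v x)\<^sup>2) \<le> norm (B\<^sup>2 * indicator \<Omega> x)"
    proof (rule AE_I2)
      fix x
      show "norm ((v x)\<^sup>2) \<le> norm (B\<^sup>2 * indicator \<Omega> x)"
      proof (cases "x \<in> \<Omega>")
        case True
        then have "\<bar>v x\<bar> \<le> \<bar>B\<bar>" using B[of x] closure_subset[of \<Omega>] by fastforce
        then show ?thesis using True by (simp add: abs_le_square_iff)
      qed (simp add: z)
    qed
  qed measurable
  then show "v \<in> L2" by (simp add: L2_def)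
  show "vanishes_off \<Omega> v" using z by (simp add: vanishes_off_def)
qed

text \<open>A majorant independent of \<open>s\<close>: two Lipschitz differences gain the square of
  the distance \<open>d\<close>, and \<open>d powr (2 - N - 2 * s)\<close> is at most
  \<open>d powr (1 - N)\<close> for \<open>d < 1\<close> and \<open>s \<le> 1/2\<close>. This is
  where the parameter range up to 1/2 comes from.\<close>

definition dom_fun :: "'a \<times> 'a \<Rightarrow> real" where
  "dom_fun p = (indicator \<Omega> (fst p) + indicator \<Omega> (snd p)) *
     (indicator {z. norm z < 1} (fst p - snd p) * norm (fst p - snd p) powr (1 - real DIM('a)))"

lemma dom_fun_integrable: "integrable lborel2 dom_fun"
proof (rule integrableI_nonneg)
  show "dom_fun \<in> borel_measurable lborel2" unfolding dom_fun_def by measurable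
  show "(\<integral>\<^sup>+p. ennreal (dom_fun p) \<partial>lborel2) < \<infinity>"
    unfolding dom_fun_def using \<Omega>_finite nn_integral_norm_powr_near[of 1, where 'a='a]
    by (subst nn_integral_pair_indicator) (auto simp: indicator_def ennreal_mult_less_top)
qed (auto simp: dom_fun_def)

lemma near_le_dom_fun:
  assumes s: "s \<le> 1/2"
    and u: "\<And>x y. \<bar>u x - u y\<bar> \<le> L * norm (x - y)" "\<And>x. x \<notin> \<Omega> \<Longrightarrow> u x = 0" "0 \<le> L"
    and v: "\<And>x y. \<bar>v x - v y\<bar> \<le> K * norm (x - y)" "\<And>x. x \<notin> \<Omega> \<Longrightarrow> v x = 0" "0 \<le> K"
  shows "\<bar>near s p * (dif u p * dif v p)\<bar> \<le> L * K * dom_fun p"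
proof (cases "fst p \<noteq> snd p \<and> norm (fst p - snd p) < 1 \<and> (fst p \<in> \<Omega> \<or> snd p \<in> \<Omega>)")
  case False
  then show ?thesis using u v by (auto simp: near_def dif_def dom_fun_def)
next
  case True
  define d where "d = norm (fst p - snd p)"
  have d: "0 < d" "d < 1" using True by (auto simp: d_def)
  have "\<bar>dif u p\<bar> \<le> L * d" "\<bar>dif v p\<bar> \<le> K * d" unfolding dif_def d_def using u v by auto
  then have "\<bar>dif u p\<bar> * \<bar>dif v p\<bar> \<le> (L * d) * (K * d)" using u(3) d by (intro mult_mono) auto
  then have "near s p * (\<bar>dif u p\<bar> * \<bar>dif v p\<bar>) \<le> near s p * ((L * d) * (K * d))" by (intro mult_left_mono) auto
  then have *: "near s p * (\<bar>dif u p\<bar> * \<bar>dif v p\<bar>) \<le> d powr (- real DIM('a) - 2 * s) * ((L * d) * (K * d))"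
    using True by (simp add: near_def d_def powr_minus_divide[symmetric])
  note *
  also have "d powr (- real DIM('a) - 2 * s) * ((L * d) * (K * d)) = L * K * (d powr (- real DIM('a) - 2 * s) * d powr 2)" using d by (simp add: power2_eq_square)
  also have "d powr (- real DIM('a) - 2 * s) * d powr 2 = d powr (2 - real DIM('a) - 2 * s)"
    by (simp add: powr_add[symmetric] algebra_simps)
  also have "L * K * \<dots> \<le> L * K * d powr (1 - real DIM('a))"
    using d s u(3) v(3) by (intro mult_left_mono powr_mono') auto
  also have "\<dots> \<le> L * K * dom_fun p"
  proof (rule mult_left_mono)
    have "1 \<le> (indicator \<Omega> (fst p) + indicator \<Omega> (snd p) :: real)" using True by (auto simp: indicator_def)
    then have "1 * d powr (1 - real DIM('a)) \<le> (indicator \<Omega> (fst p) + indicator \<Omega> (snd p)) * d powr (1 - real DIM('a))"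
      by (intro mult_right_mono) auto
    then show "d powr (1 - real DIM('a)) \<le> dom_fun p" using True by (simp add: dom_fun_def d_def)
  qed (use u v in auto)
  finally show ?thesis by (simp add: abs_mult)
qed

lemma lip_core_Dom:
  assumes v: "v \<in> lip_core \<Omega>" and s: "s \<le> 1/2"
  shows "v \<in> Dom \<Omega> s"
proof -
  obtain L where L: "L \<ge> 0" "\<And>x y. \<bar>v x - v y\<bar> \<le> L * norm (x - y)" "\<And>x. x \<notin> \<Omega> \<Longrightarrow> v x = 0"
    using v by (auto simp: lip_core_def)
  have [measurable]: "v \<in> borel_measurable borel" using lip_core_L2[OF v] by (simp add: L2_def)
  have "integrable lborel2 (\<lambda>p. near s p * (dif v p)\<^sup>2)"
  proof (rule Bochner_Integration.integrable_bound)
    show "integrable lborel2 (\<lambda>p. L * L * dom_fun p)" using dom_fun_integrable by simp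
    show "AE p in lborel2. norm (near s p * (dif v p)\<^sup>2) \<le> norm (L * L * dom_fun p)"
      using near_le_dom_fun[OF s L(2,3,1) L(2,3,1)] unfolding power2_eq_square
      by (intro AE_I2) (metis abs_ge_self order_trans real_norm_def)
  qed measurable
  then show ?thesis using lip_core_L2[OF v] by (simp add: Dom_def)
qed

lemma Qf_core_tendsto:
  assumes v: "v \<in> lip_core \<Omega>" and w: "w \<in> lip_core \<Omega>"
  shows "((\<lambda>s. Qf s v w) \<longlongrightarrow> Qf 0 v w) (at_right 0)"
proof -
  obtain L where L: "L \<ge> 0" "\<And>x y. \<bar>v x - v y\<bar> \<le> L * norm (x - y)" "\<And>x. x \<notin> \<Omega> \<Longrightarrow> v x = 0"
    using v by (auto simp: lip_core_def)
  obtain K where K: "K \<ge> 0" "\<And>x y. \<bar>w x - w y\<bar> \<le> K * norm (x - y)" "\<And>x. x \<notin> \<Omega> \<Longrightarrow> w x = 0"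
    using w by (auto simp: lip_core_def)
  have [measurable]: "v \<in> borel_measurable borel" "w \<in> borel_measurable borel"
    using lip_core_L2[OF v] lip_core_L2[OF w] by (auto simp: L2_def)
  have Lv: "integrable lborel v" "integrable lborel w" using L1_bound(1) lip_core_L2 v w by blast+
  have "((\<lambda>s. Qf s v w) \<longlongrightarrow> Qf 0 v w) (at 0 within {0..1/2})"
    unfolding tendsto_at_iff_sequentially
  proof (intro allI impI)
    fix X :: "nat \<Rightarrow> real" assume X: "\<forall>i. X i \<in> {0..1/2} - {0}" "X \<longlonglongrightarrow> 0"
    have X0: "0 \<le> X i" "X i \<le> 1/2" for i using X(1) by (auto intro: less_imp_le)
    have near: "(\<lambda>n. nearE (X n) v w) \<longlonglongrightarrow> nearE 0 v w"
      unfolding nearE_def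
    proof (rule integral_dominated_convergence[where w="\<lambda>p. L * K * dom_fun p"])
      show "integrable lborel2 (\<lambda>p. L * K * dom_fun p)" using dom_fun_integrable by simp
      show "AE p in lborel2. (\<lambda>n. near (X n) p * (dif v p * dif w p)) \<longlonglongrightarrow> near 0 p * (dif v p * dif w p)"
        by (intro AE_I2 tendsto_mult near_tendsto X tendsto_const)
      show "AE p in lborel2. norm (near (X n) p * (dif v p * dif w p)) \<le> L * K * dom_fun p" for n
        using near_le_dom_fun[OF X0(2) L(2,3,1) K(2,3,1)] by simp
    qed measurable
    have far: "(\<lambda>n. farB (X n) v w) \<longlonglongrightarrow> farB 0 v w"
      unfolding farB_def
    proof (rule integral_dominated_convergence[where w="\<lambda>p. \<bar>v (fst p) * w (snd p)\<bar>"])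
      show "integrable lborel2 (\<lambda>p. \<bar>v (fst p) * w (snd p)\<bar>)" using prod_integrable(1)[OF Lv] by simp
      show "AE p in lborel2. (\<lambda>n. far (X n) p * (v (fst p) * w (snd p))) \<longlonglongrightarrow> far 0 p * (v (fst p) * w (snd p))"
        by (intro AE_I2 tendsto_mult far_tendsto X tendsto_const)
      show "AE p in lborel2. norm (far (X n) p * (v (fst p) * w (snd p))) \<le> \<bar>v (fst p) * w (snd p)\<bar>" for n
      proof (rule AE_I2)
        fix p :: "'a \<times> 'a"
        show "norm (far (X n) p * (v (fst p) * w (snd p))) \<le> \<bar>v (fst p) * w (snd p)\<bar>"
          unfolding real_norm_def abs_mult[of "far (X n) p"] using far_le_1[OF X0(1)[of n], of p] by (intro mult_left_le_one_le) auto
      qed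
    qed measurable
    have "(\<lambda>n. cfun TYPE('a) (X n)) \<longlonglongrightarrow> cfun TYPE('a) 0" "(\<lambda>n. rhof TYPE('a) (X n)) \<longlonglongrightarrow> rhof TYPE('a) 0"
      using isCont_tendsto_compose[OF isCont_cfun X(2)] isCont_tendsto_compose[OF isCont_rhof X(2)] by simp_all
    then show "((\<lambda>s. Qf s v w) \<circ> X) \<longlonglongrightarrow> Qf 0 v w"
      unfolding Qf_def o_def using near far by (intro tendsto_intros) auto
  qed
  then show ?thesis using at_within_Icc_at_right[of 0 "1/2 :: real"] by simp
qed

text \<open>Cones over disjoint balls lined up inside one ball of \<Omega>; disjoint supports make
  them orthogonal.\<close>

lemma lip_core_infinite_dim:
  assumes "\<Omega> \<noteq> {}"
  shows "\<exists>f. \<forall>i<k::nat. f i \<in> lip_core \<Omega> \<and> (\<forall>j<k. ip (f i) (f j) = (if i = j then 1 else 0))"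
proof -
  obtain x0 where "x0 \<in> \<Omega>" using assms by blast
  then obtain r where r: "r > 0" "ball x0 r \<subseteq> \<Omega>" using open_\<Omega> by (meson open_contains_ball)
  obtain b :: 'a where b: "norm b = 1" using nonempty_Basis norm_Basis by blast
  \<comment> \<open>Centres \<open>2 * \<rho>\<close> apart starting at \<open>x0\<close> stay, with
    their balls, within distance \<open>2 * \<rho> * (k + 1) = r\<close>.\<close>
  define \<rho> where "\<rho> = r / (2 * (real k + 1))"
  have \<rho>: "\<rho> > 0" using r by (simp add: \<rho>_def)
  define c where "c i = x0 + (2 * \<rho> * real i) *\<^sub>R b" for i :: nat
  have sub: "ball (c i) \<rho> \<subseteq> \<Omega>" if "i < k" for i
  proof -
    have "2 * \<rho> * real i + \<rho> < 2 * \<rho> * (real k + 1)"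
    proof -
      have "2 * \<rho> * real i \<le> 2 * \<rho> * real k" using that \<rho> by (intro mult_left_mono) auto
      moreover have "2 * \<rho> * (real k + 1) = 2 * \<rho> * real k + 2 * \<rho>" by (simp add: algebra_simps)
      ultimately show ?thesis using \<rho> by linarith
    qed
    also have "\<dots> = r"
    proof -
      have "2 * (r / (2 * q)) * q = r" if "q \<noteq> 0" for q using that by simp
      then show ?thesis unfolding \<rho>_def by (metis of_nat_Suc of_nat_eq_0_iff nat.distinct(1) add.commute)
    qed
    finally have "dist x0 (c i) + \<rho> \<le> r" using \<rho> b by (simp add: c_def dist_norm)
    then have "ball (c i) \<rho> \<subseteq> ball x0 r" by (intro ball_subset_ball_iff[THEN iffD2]) (auto simp: dist_commute)
    then show ?thesis using r by blast
  qed
  define g where "g i x = max 0 (\<rho> - dist x (c i))" for i and x :: 'a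
  have gc: "g i \<in> lip_core \<Omega>" if "i < k" for i
  proof -
    have a: "\<bar>g i x - g i y\<bar> \<le> 1 * norm (x - y)" for x y
    proof -
      have "\<bar>max 0 a - max 0 b\<bar> \<le> \<bar>a - b\<bar>" for a b :: real by (auto simp: max_def)
      moreover have "\<bar>(\<rho> - dist x (c i)) - (\<rho> - dist y (c i))\<bar> \<le> dist x y"
        using dist_triangle[of x "c i" y] dist_triangle[of y "c i" x] by (simp add: dist_commute[of y x])
      ultimately show ?thesis unfolding g_def by (metis dist_norm mult_1 order_trans)
    qed
    have b: "g i x = 0" if "x \<notin> \<Omega>" for x
    proof -
      have "x \<notin> ball (c i) \<rho>" using sub[OF \<open>i < k\<close>] that by blast
      then show ?thesis by (simp add: g_def dist_commute)
    qed
    show ?thesis unfolding lip_core_def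
      by (intro CollectI conjI exI[of _ "1::real"] allI impI) (rule zero_le_one a b, assumption?)+
  qed
  have pos: "ip (g i) (g i) > 0" if "i < k" for i
  proof (rule ccontr)
    assume "\<not> ip (g i) (g i) > 0"
    then have "ip (g i) (g i) = 0" using ip_nonneg[of "g i"] by simp
    then have "AE x in lborel. g i x = 0" using ip_eq_0_AE lip_core_L2(1)[OF gc[OF that]] by blast
    then have "AE x in lborel. x \<notin> ball (c i) \<rho>"
      by eventually_elim (auto simp: g_def dist_commute max_def split: if_splits)
    then have "emeasure lborel (ball (c i) \<rho>) = 0"
      by (subst (asm) AE_iff_measurable[of "ball (c i) \<rho>"]) auto
    moreover have "unit_ball_vol (real DIM('a)) \<noteq> 0"
      using unit_ball_vol_pos[of "real DIM('a)"] by (metis less_irrefl of_nat_0_le_iff)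
    ultimately show False using \<rho> by (simp add: emeasure_ball)
  qed
  have orth: "ip (g i) (g j) = 0" if "i \<noteq> j" for i j
  proof -
    have "g i x * g j x = 0" for x
    proof (rule ccontr)
      assume "g i x * g j x \<noteq> 0"
      then have "dist x (c i) < \<rho>" "dist x (c j) < \<rho>" by (auto simp: g_def max_def split: if_splits)
      then have lt: "dist (c i) (c j) < 2 * \<rho>" using dist_triangle[of "c i" "c j" x] by (simp add: dist_commute)
      have "c i - c j = (2 * \<rho> * (real i - real j)) *\<^sub>R b" by (simp add: c_def algebra_simps)
      then have "dist (c i) (c j) = 2 * \<rho> * \<bar>real i - real j\<bar>" using b \<rho> by (simp add: dist_norm abs_mult)
      moreover have "\<bar>real i - real j\<bar> \<ge> 1" using that by linarith
      then have "2 * \<rho> * 1 \<le> 2 * \<rho> * \<bar>real i - real j\<bar>" using \<rho> by (intro mult_left_mono) auto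
      ultimately show False using lt by simp
    qed
    then show ?thesis unfolding ip_def by (simp only: Bochner_Integration.integral_zero)
  qed
  define f where "f i x = 1 / sqrt (ip (g i) (g i)) * g i x" for i x
  have "f i \<in> lip_core \<Omega>" if "i < k" for i
    using lip_core_lin[OF gc gc, OF that that, of "1 / sqrt (ip (g i) (g i))" 0] unfolding f_def by simp
  moreover have "ip (f i) (f j) = (if i = j then 1 else 0)" if "i < k" "j < k" for i j
  proof -
    have "ip (f i) (f j) = (1 / sqrt (ip (g i) (g i))) * (1 / sqrt (ip (g j) (g j))) * ip (g i) (g j)"
      unfolding f_def ip_def by (simp flip: integral_mult_right_zero add: mult_ac)
    then show ?thesis using orth[of i j] pos[OF that(1)] by auto
  qed
  ultimately show ?thesis by blast
qed

section \<open>Density of the core\<close>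

text \<open>A form of the principle that weak convergence and convergence of norms give strong
  convergence. The parallelogram law bounds the energy of \<open>v n - u\<close> from above once
  that of \<open>v n + u\<close> is bounded from below, and Fatou does so because
  \<open>v n + u\<close> tends to \<open>2 u\<close>.\<close>

lemma near_strong_convergence:
  assumes u: "u \<in> Dom \<Omega> 0" and v: "\<And>n. v n \<in> Dom \<Omega> 0" "L2_lim v u"
    and ev: "\<And>\<epsilon>. \<epsilon> > 0 \<Longrightarrow> eventually (\<lambda>n. nearE 0 (v n) (v n) \<le> nearE 0 u u + \<epsilon>) sequentially"
  shows "(\<lambda>n. on_diff (nearE 0) (v n) u) \<longlonglongrightarrow> 0"
proof -
  interpret N: psd_form "Dom \<Omega> 0" "nearE 0" by (rule near_psd_form)
  define E where "E = nearE 0 u u"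
  have plus: "nearE 0 (\<lambda>x. v n x + u x) (\<lambda>x. v n x + u x) = nearE 0 (v n) (v n) + 2 * nearE 0 (v n) u + E" for n
    using N.Q_add_scaled[OF v(1) u, of n 1] by (simp add: E_def)
  have minus: "on_diff (nearE 0) (v n) u = nearE 0 (v n) (v n) - 2 * nearE 0 (v n) u + E" for n
    using N.Q_add_scaled[OF v(1) u, of n "-1"] by (simp add: E_def)
  have twou: "nearE 0 (\<lambda>x. 2 * u x) (\<lambda>x. 2 * u x) = 4 * E"
    using N.Q_add_scaled[OF N.zero u, of 2] N.Q_zero[OF N.zero] N.Q_zero[OF u] by (simp add: E_def)
  have D: "(\<lambda>x. v n x + u x) \<in> Dom \<Omega> 0" for n using N.lin[OF v(1) u, of 1 n 1] by simp
  have uL: "u \<in> L2" using DomD(1)[OF u] .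
  have u2L: "(\<lambda>x. 2 * u x) \<in> L2" using L2_lin[OF uL uL, of 2 0] by simp
  have "eventually (\<lambda>n. on_diff (nearE 0) (v n) u < \<epsilon>) sequentially" if \<epsilon>: "\<epsilon> > 0" for \<epsilon>
  proof (rule ccontr)
    assume "\<not> ?thesis"
    then have "frequently (\<lambda>n. on_diff (nearE 0) (v n) u \<ge> \<epsilon>) sequentially"
      by (simp add: not_eventually not_less)
    moreover have "eventually (\<lambda>n. nearE 0 (v n) (v n) \<le> E + \<epsilon> / 4) sequentially" unfolding E_def using \<epsilon> by (intro ev) simp
    ultimately have "frequently (\<lambda>n. on_diff (nearE 0) (v n) u \<ge> \<epsilon> \<and> nearE 0 (v n) (v n) \<le> E + \<epsilon> / 4) sequentially"
      by (rule frequently_eventually_frequently)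
    note * = this
    define S where "S = {n. on_diff (nearE 0) (v n) u \<ge> \<epsilon> \<and> nearE 0 (v n) (v n) \<le> E + \<epsilon> / 4}"
    have "infinite S" using * unfolding S_def
      by (simp add: frequently_cofinite flip: cofinite_eq_sequentially)
    then obtain r :: "nat \<Rightarrow> nat" where r: "strict_mono r" "\<And>n. r n \<in> S"
      using infinite_enumerate[of S] by blast
    \<comment> \<open>On the subsequence the parallelogram law gives at most
      \<open>2 * (E + \<epsilon> / 4) + 2 * E - \<epsilon>\<close>, below the true value
      \<open>4 * E\<close>.\<close>
    have "nearE 0 (\<lambda>x. 2 * u x) (\<lambda>x. 2 * u x) \<le> 4 * E - \<epsilon> / 2"
    proof (rule nearE_fatou(2)[of "\<lambda>_. 0" 0 "\<lambda>n x. v (r n) x + u x"])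
      show "L2_lim (\<lambda>n x. v (r n) x + u x) (\<lambda>x. 2 * u x)"
        using L2_lim_subseq[OF v(2) r(1)] by (simp add: L2_lim_def)
      show "nearE 0 (\<lambda>x. v (r n) x + u x) (\<lambda>x. v (r n) x + u x) \<le> 4 * E - \<epsilon> / 2" for n
        using r(2)[of n, unfolded S_def] plus[of "r n"] minus[of "r n"] by simp
    qed (use D u2L in auto)
    then show False using twou \<epsilon> by simp
  qed
  note upper = this
  show ?thesis
  proof (rule order_tendstoI)
    fix a :: real assume "a < 0"
    then have "a < on_diff (nearE 0) (v n) u" for n
      using nearE_nonneg[of 0 "\<lambda>x. v n x - u x"] by linarith
    then show "eventually (\<lambda>n. a < on_diff (nearE 0) (v n) u) sequentially" by simp
  qed (rule upper)
qed

definition approximable :: "('a \<Rightarrow> real) \<Rightarrow> bool" where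
  "approximable u \<longleftrightarrow> (\<forall>\<epsilon>>0. \<exists>v\<in>lip_core \<Omega>. on_diff ip v u < \<epsilon> \<and> on_diff (nearE 0) v u < \<epsilon>)"

text \<open>The common last step of mollification, cutoff and truncation: for each of them it
  remains to check L2 convergence and that the near energy does not increase in the limit.\<close>

lemma approximable_limit:
  assumes u: "u \<in> Dom \<Omega> 0" and v: "\<And>n. v n \<in> Dom \<Omega> 0" "L2_lim v u" "\<And>n. approximable (v n)"
    and ev: "\<And>\<epsilon>. \<epsilon> > 0 \<Longrightarrow> eventually (\<lambda>n. nearE 0 (v n) (v n) \<le> nearE 0 u u + \<epsilon>) sequentially"
  shows "approximable u"
  unfolding approximable_def
proof (intro allI impI)
  fix \<epsilon> :: real assume \<epsilon>: "\<epsilon> > 0"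
  interpret N: psd_form "Dom \<Omega> 0" "nearE 0" by (rule near_psd_form)
  have triangle: "F (\<lambda>x. a x + b x) (\<lambda>x. a x + b x) \<le> 2 * F a a + 2 * F b b"
    if "psd_form X F" "a \<in> X" "b \<in> X" for X and F :: "('a \<Rightarrow> real) \<Rightarrow> ('a \<Rightarrow> real) \<Rightarrow> real" and a b
  proof -
    interpret F: psd_form X F by fact
    have "(\<lambda>x. a x - b x) \<in> X" using F.diff that by blast
    then have "0 \<le> F (\<lambda>x. a x - b x) (\<lambda>x. a x - b x)" by (rule F.nonneg)
    then show ?thesis using F.Q_add_scaled[OF that(2,3), of "-1"] F.Q_add_scaled[OF that(2,3), of 1] by simp
  qed
  have "(\<lambda>n. on_diff ip (v n) u) \<longlonglongrightarrow> 0" using v(2) by (simp add: L2_lim_def)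
  then have "eventually (\<lambda>n. on_diff ip (v n) u < \<epsilon> / 4) sequentially"
    using \<epsilon> by (intro order_tendstoD(2)[of _ 0]) auto
  moreover have "eventually (\<lambda>n. on_diff (nearE 0) (v n) u < \<epsilon> / 4) sequentially"
    using near_strong_convergence[OF u v(1,2) ev] \<epsilon> by (intro order_tendstoD(2)[of _ 0]) auto
  ultimately have "eventually (\<lambda>n. on_diff ip (v n) u < \<epsilon> / 4 \<and> on_diff (nearE 0) (v n) u < \<epsilon> / 4) sequentially"
    by (rule eventually_conj)
  then obtain n where n: "on_diff ip (v n) u < \<epsilon> / 4" "on_diff (nearE 0) (v n) u < \<epsilon> / 4"
    unfolding eventually_sequentially by blast
  obtain w where w: "w \<in> lip_core \<Omega>" "on_diff ip w (v n) < \<epsilon> / 4" "on_diff (nearE 0) w (v n) < \<epsilon> / 4"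
    using v(3)[of n] \<epsilon> unfolding approximable_def by (meson zero_less_divide_iff zero_less_numeral)
  have wD: "w \<in> Dom \<Omega> 0" using lip_core_Dom[OF w(1), of 0] by simp
  have a: "(\<lambda>x. w x - v n x) \<in> Dom \<Omega> 0" "(\<lambda>x. v n x - u x) \<in> Dom \<Omega> 0" using wD v(1) u N.diff by auto
  have "on_diff ip w u < \<epsilon>"
    using triangle[OF ip.psd_form_axioms DomD(1)[OF a(1)] DomD(1)[OF a(2)]] w(2) n(1) by simp
  moreover have "on_diff (nearE 0) w u < \<epsilon>"
    using triangle[OF near_psd_form a] w(3) n(2) by simp
  ultimately show "\<exists>v\<in>lip_core \<Omega>. on_diff ip v u < \<epsilon> \<and> on_diff (nearE 0) v u < \<epsilon>"
    using w(1) by blast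
qed

end

subsection \<open>Mollification\<close>

lemma nn_integral_lborel_translate:
  fixes f :: "'a::euclidean_space \<Rightarrow> ennreal"
  assumes [measurable]: "f \<in> borel_measurable borel"
  shows "(\<integral>\<^sup>+x. f (x - c) \<partial>lborel) = (\<integral>\<^sup>+x. f x \<partial>lborel)"
proof -
  have "(\<integral>\<^sup>+x. f x \<partial>lborel) = (\<integral>\<^sup>+x. f x \<partial>distr lborel borel ((+) (- c)))" by (simp add: lborel_distr_plus)
  also have "\<dots> = (\<integral>\<^sup>+x. f (x - c) \<partial>lborel)" by (simp add: nn_integral_distr)
  finally show ?thesis ..
qed

lemma nn_integral_pair_translate:
  fixes F :: "'a::euclidean_space \<times> 'a \<Rightarrow> ennreal"
  assumes [measurable]: "F \<in> borel_measurable (borel \<Otimes>\<^sub>M borel)"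
  shows "(\<integral>\<^sup>+p. F (fst p - z, snd p - z) \<partial>lborel2) = (\<integral>\<^sup>+p. F p \<partial>lborel2)"
proof -
  have "(\<integral>\<^sup>+p. F (fst p - z, snd p - z) \<partial>lborel2) = (\<integral>\<^sup>+x. \<integral>\<^sup>+y. F (x - z, y - z) \<partial>lborel \<partial>lborel)"
    by (subst lborel.nn_integral_fst[symmetric]) auto
  also have "\<dots> = (\<integral>\<^sup>+x. \<integral>\<^sup>+y. F (x - z, y) \<partial>lborel \<partial>lborel)"
    by (intro nn_integral_cong nn_integral_lborel_translate) measurable
  also have "\<dots> = (\<integral>\<^sup>+x. \<integral>\<^sup>+y. F (x, y) \<partial>lborel \<partial>lborel)"
    by (rule nn_integral_lborel_translate[of "\<lambda>x. \<integral>\<^sup>+y. F (x, y) \<partial>lborel"]) measurable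
  also have "\<dots> = (\<integral>\<^sup>+p. F p \<partial>lborel2)"
    by (rule lborel.nn_integral_fst) measurable
  finally show ?thesis .
qed

context lipschitz_kernel
begin

lemma conv_alt:
  assumes "u \<in> borel_measurable borel"
  shows "conv u x = (\<integral>z. k z * u (x - z) \<partial>lborel)"
  unfolding conv_def using integral_lborel_reflect[of "\<lambda>z. k z * u (x - z)" x] assms by simp

text \<open>A convolution is a weighted average of translates, and the near kernel is translation
  invariant; weighted Cauchy-Schwarz plays the role of Jensen's inequality.\<close>

lemma conv_near_energy:
  assumes u: "integrable lborel u" "u \<in> L2"
  shows "(\<integral>\<^sup>+p. ennreal (near s p * (dif (conv u) p)\<^sup>2) \<partial>lborel2) \<le>
     ennreal (mass\<^sup>2) * (\<integral>\<^sup>+p. ennreal (near s p * (dif u p)\<^sup>2) \<partial>lborel2)"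
proof -
  have [measurable]: "u \<in> borel_measurable borel" using u by (simp add: L2_def)
  let ?P = "lborel2 :: ('a \<times> 'a) measure"
  have sh: "integrable lborel (\<lambda>z. k z * u (x - z))" for x
    using integrable_lborel_reflect[OF mult_integrable[OF u(1), of x], of x] by simp
  have shL2: "(\<lambda>z. u (x - z)) \<in> L2" for x
    using u(2) integrable_lborel_reflect[of "\<lambda>y. (u y)\<^sup>2" x] by (simp add: L2_def)
  have pt: "ennreal (near s p * (dif (conv u) p)\<^sup>2) \<le>
      ennreal mass * (\<integral>\<^sup>+z. ennreal (k z) * ennreal (near s p * (u (fst p - z) - u (snd p - z))\<^sup>2) \<partial>lborel)" for p
  proof -
    let ?f = "\<lambda>z. u (fst p - z) - u (snd p - z)"
    have i1: "integrable lborel (\<lambda>z. k z * ?f z)" using sh by (simp add: right_diff_distrib)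
    have "?f \<in> L2" using shL2 L2_diff by blast
    then have "integrable lborel (\<lambda>z. B * (?f z)\<^sup>2)" by (simp add: L2_def)
    then have i2: "integrable lborel (\<lambda>z. k z * (?f z)\<^sup>2)"
      by (rule Bochner_Integration.integrable_bound)
        (use k_nonneg k_le in \<open>auto simp: abs_mult intro!: mult_right_mono AE_I2 order_trans[OF k_le abs_ge_self]\<close>)
    have "dif (conv u) p = (\<integral>z. k z * ?f z \<partial>lborel)"
      unfolding dif_def using sh by (simp add: conv_alt right_diff_distrib)
    then have "(dif (conv u) p)\<^sup>2 \<le> mass * (\<integral>z. k z * (?f z)\<^sup>2 \<partial>lborel)"
      using weighted_cauchy_schwarz[OF k_nonneg k_int i1 i2] by (simp add: mass_def)
    then have "near s p * (dif (conv u) p)\<^sup>2 \<le> near s p * (mass * (\<integral>z. k z * (?f z)\<^sup>2 \<partial>lborel))"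
      by (intro mult_left_mono) auto
    then have "ennreal (near s p * (dif (conv u) p)\<^sup>2) \<le> ennreal (mass * (\<integral>z. near s p * (k z * (?f z)\<^sup>2) \<partial>lborel))"
      unfolding integral_mult_right_zero by (intro ennreal_leI) (simp only: mult.left_commute)
    also have "\<dots> = ennreal mass * ennreal (\<integral>z. near s p * (k z * (?f z)\<^sup>2) \<partial>lborel)"
      using mass_nonneg by (rule ennreal_mult')
    also have "ennreal (\<integral>z. near s p * (k z * (?f z)\<^sup>2) \<partial>lborel) = (\<integral>\<^sup>+z. ennreal (near s p * (k z * (?f z)\<^sup>2)) \<partial>lborel)"
      using i2 k_nonneg by (intro nn_integral_eq_integral[symmetric]) auto
    also have "\<dots> = (\<integral>\<^sup>+z. ennreal (k z) * ennreal (near s p * (?f z)\<^sup>2) \<partial>lborel)"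
      using k_nonneg by (intro nn_integral_cong) (simp add: ennreal_mult'[symmetric] mult_ac)
    finally show ?thesis .
  qed
  have "(\<integral>\<^sup>+p. ennreal (near s p * (dif (conv u) p)\<^sup>2) \<partial>?P) \<le>
     (\<integral>\<^sup>+p. ennreal mass * (\<integral>\<^sup>+z. ennreal (k z) * ennreal (near s p * (u (fst p - z) - u (snd p - z))\<^sup>2) \<partial>lborel) \<partial>?P)"
    by (intro nn_integral_mono pt)
  also have "\<dots> = ennreal mass * (\<integral>\<^sup>+p. \<integral>\<^sup>+z. ennreal (k z) * ennreal (near s p * (u (fst p - z) - u (snd p - z))\<^sup>2) \<partial>lborel \<partial>?P)"
    by (rule nn_integral_cmult) measurable
  also have "(\<integral>\<^sup>+p. \<integral>\<^sup>+z. ennreal (k z) * ennreal (near s p * (u (fst p - z) - u (snd p - z))\<^sup>2) \<partial>lborel \<partial>?P)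
    = (\<integral>\<^sup>+z. \<integral>\<^sup>+p. ennreal (k z) * ennreal (near s p * (u (fst p - z) - u (snd p - z))\<^sup>2) \<partial>?P \<partial>lborel)"
  proof -
    interpret PL: pair_sigma_finite ?P "lborel :: 'a measure"
      unfolding lborel_prod by (rule lborel_pair.pair_sigma_finite_axioms)
    show ?thesis
      by (rule PL.Fubini'[symmetric]) measurable
  qed
  also have "\<dots> = (\<integral>\<^sup>+z. ennreal (k z) * (\<integral>\<^sup>+p. ennreal (near s p * (dif u p)\<^sup>2) \<partial>?P) \<partial>lborel)"
  proof (intro nn_integral_cong)
    fix z
    have n: "near s (fst p - z, snd p - z) = near s p" for p :: "'a \<times> 'a" by (simp add: near_def indicator_def)
    have "(\<integral>\<^sup>+p. ennreal (k z) * ennreal (near s p * (u (fst p - z) - u (snd p - z))\<^sup>2) \<partial>?P)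
      = ennreal (k z) * (\<integral>\<^sup>+p. ennreal (near s p * (u (fst p - z) - u (snd p - z))\<^sup>2) \<partial>?P)"
      by (rule nn_integral_cmult) measurable
    also have "(\<integral>\<^sup>+p. ennreal (near s p * (u (fst p - z) - u (snd p - z))\<^sup>2) \<partial>?P) = (\<integral>\<^sup>+p. ennreal (near s p * (dif u p)\<^sup>2) \<partial>?P)"
      using nn_integral_pair_translate[of "\<lambda>p. ennreal (near s p * (dif u p)\<^sup>2)" z] by (simp add: n dif_def)
    finally show "(\<integral>\<^sup>+p. ennreal (k z) * ennreal (near s p * (u (fst p - z) - u (snd p - z))\<^sup>2) \<partial>?P)
      = ennreal (k z) * (\<integral>\<^sup>+p. ennreal (near s p * (dif u p)\<^sup>2) \<partial>?P)" .
  qed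
  also have "\<dots> = (\<integral>\<^sup>+z. ennreal (k z) \<partial>lborel) * (\<integral>\<^sup>+p. ennreal (near s p * (dif u p)\<^sup>2) \<partial>?P)"
    by (rule nn_integral_multc) measurable
  also have "(\<integral>\<^sup>+z. ennreal (k z) \<partial>lborel) = ennreal mass"
    unfolding mass_def using k_int k_nonneg by (intro nn_integral_eq_integral) auto
  finally show ?thesis
    using mass_nonneg by (simp add: power2_eq_square ennreal_mult mult.assoc)
qed

end

definition mker :: "real \<Rightarrow> 'a::euclidean_space \<Rightarrow> real" where
  "mker \<epsilon> z = max 0 (1 - norm z / \<epsilon>)"

lemma mker_kernel:
  assumes \<epsilon>: "0 < \<epsilon>"
  shows "lipschitz_kernel (mker \<epsilon> :: 'a::euclidean_space \<Rightarrow> real) 1 (1 / \<epsilon>)"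
proof
  fix y z :: 'a
  show "0 \<le> mker \<epsilon> z" by (simp add: mker_def)
  show le: "mker \<epsilon> z \<le> 1" for z :: 'a using \<epsilon> by (simp add: mker_def)
  have "\<bar>mker \<epsilon> y - mker \<epsilon> z\<bar> \<le> \<bar>norm y / \<epsilon> - norm z / \<epsilon>\<bar>" unfolding mker_def by (auto simp: max_def)
  also have "\<dots> = \<bar>norm y - norm z\<bar> / \<epsilon>" using \<epsilon> by (simp add: diff_divide_distrib[symmetric])
  also have "\<dots> \<le> norm (y - z) / \<epsilon>" using \<epsilon> norm_triangle_ineq3[of y z] by (intro divide_right_mono) auto
  finally show "\<bar>mker \<epsilon> y - mker \<epsilon> z\<bar> \<le> 1 / \<epsilon> * norm (y - z)" by simp
  show "integrable lborel (mker \<epsilon> :: 'a \<Rightarrow> real)"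
  proof (rule Bochner_Integration.integrable_bound)
    show "integrable lborel (indicator (cball 0 \<epsilon>) :: 'a \<Rightarrow> real)"
      using emeasure_bounded_finite[of "cball (0::'a) \<epsilon>"] by (intro integrable_real_indicator) auto
    show "(mker \<epsilon> :: 'a \<Rightarrow> real) \<in> borel_measurable lborel" unfolding mker_def by measurable
    show "AE z in lborel. norm (mker \<epsilon> (z::'a)) \<le> norm (indicator (cball 0 \<epsilon>) z :: real)"
      using \<epsilon> by (intro AE_I2) (auto simp: mker_def indicator_def max_def field_simps)
  qed
qed

text \<open>The cone is at least one half on the ball of half the radius, whose volume gives the
  constant.\<close>

lemma mker_mass:
  assumes \<epsilon>: "0 < \<epsilon>"
  shows "\<epsilon> ^ DIM('a) \<le> 2 ^ (DIM('a) + 1) / unit_ball_vol (real DIM('a)) * (\<integral>z. mker \<epsilon> (z::'a::euclidean_space) \<partial>lborel)"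
proof -
  interpret lipschitz_kernel "mker \<epsilon> :: 'a \<Rightarrow> real" 1 "1 / \<epsilon>" using \<epsilon> by (rule mker_kernel)
  have V: "unit_ball_vol (real DIM('a)) > 0" by simp
  have "(\<integral>z. 1 / 2 * indicator (cball 0 (\<epsilon> / 2)) (z::'a) \<partial>lborel) \<le> (\<integral>z. mker \<epsilon> (z::'a) \<partial>lborel)"
  proof (rule integral_mono)
    show "integrable lborel (\<lambda>z. 1 / 2 * indicator (cball 0 (\<epsilon> / 2)) (z::'a) :: real)"
      using emeasure_bounded_finite[of "cball (0::'a) (\<epsilon> / 2)"] by (intro integrable_mult_right integrable_real_indicator) auto
    show "1 / 2 * indicator (cball 0 (\<epsilon> / 2)) z \<le> mker \<epsilon> z" for z :: 'a
      using \<epsilon> by (auto simp: mker_def indicator_def max_def field_simps)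
  qed (rule k_int)
  moreover have "(\<integral>z. 1 / 2 * indicator (cball 0 (\<epsilon> / 2)) (z::'a) \<partial>lborel) = 1 / 2 * (unit_ball_vol (real DIM('a)) * (\<epsilon> / 2) ^ DIM('a))"
    using \<epsilon> by (simp add: content_cball)
  ultimately have half: "1 / 2 * (unit_ball_vol (real DIM('a)) * (\<epsilon> / 2) ^ DIM('a)) \<le> (\<integral>z. mker \<epsilon> (z::'a) \<partial>lborel)"
    by (simp only:)
  have "unit_ball_vol (real DIM('a)) * \<epsilon> ^ DIM('a) = 2 ^ (DIM('a) + 1) * (1 / 2 * (unit_ball_vol (real DIM('a)) * (\<epsilon> / 2) ^ DIM('a)))"
    by (simp add: power_divide)
  also have "\<dots> \<le> 2 ^ (DIM('a) + 1) * (\<integral>z. mker \<epsilon> (z::'a) \<partial>lborel)"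
    using half by (rule mult_left_mono) simp
  finally have "unit_ball_vol (real DIM('a)) * \<epsilon> ^ DIM('a) \<le> 2 ^ (DIM('a) + 1) * (\<integral>z. mker \<epsilon> (z::'a) \<partial>lborel)" .
  then show ?thesis using V by (simp add: field_simps)
qed

context bounded_open
begin

lemma approximable_core: "v \<in> lip_core \<Omega> \<Longrightarrow> approximable v"
  unfolding approximable_def
  by (intro allI impI bexI[of _ v]) (auto simp: ip_def nearE_def dif_def)

text \<open>If the support keeps distance \<open>\<delta>\<close> from the complement, mollifying at
  a smaller scale stays in the core and does not raise the near energy. The L2 error is bounded by
  the near energy of pairs closer than the scale, which disappears by dominated convergence.\<close>

lemma approximable_interior:
  assumes u: "u \<in> Dom \<Omega> 0" and \<delta>: "0 < \<delta>" "\<And>x. u x \<noteq> 0 \<Longrightarrow> ball x \<delta> \<subseteq> \<Omega>"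
  shows "approximable u"
proof -
  have uL: "u \<in> L2" "integrable lborel u" using DomD(1)[OF u] Dom_integrable[OF u] by auto
  have [measurable]: "u \<in> borel_measurable borel" using uL by (simp add: L2_def)
  \<comment> \<open>At most \<open>\<delta>\<close> to keep the support inside \<Omega>, at most one
    so that only pairs seen by the near kernel interact.\<close>
  define \<epsilon> where "\<epsilon> n = min 1 \<delta> / real (Suc n)" for n
  have \<epsilon>: "0 < \<epsilon> n" "\<epsilon> n \<le> \<delta>" "\<epsilon> n \<le> 1" for n
    using \<delta>(1) by (auto simp: \<epsilon>_def divide_le_eq min_le_iff_disj mult_le_cancel_left1)
  have \<epsilon>0: "\<epsilon> \<longlonglongrightarrow> 0"
    using tendsto_mult_right_zero[OF LIMSEQ_Suc[OF lim_1_over_n], of "min 1 \<delta>"] unfolding \<epsilon>_def by simp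
  define J where "J n = (\<integral>z. mker (\<epsilon> n) (z::'a) \<partial>lborel)" for n
  define cc where "cc = 2 ^ (DIM('a) + 1) / unit_ball_vol (real DIM('a))"
  have cc0: "cc \<ge> 0" by (simp add: cc_def)
  have Jm: "\<epsilon> n ^ DIM('a) \<le> cc * J n" for n unfolding cc_def J_def by (rule mker_mass[OF \<epsilon>(1)])
  have J: "J n > 0" for n
  proof (rule ccontr)
    assume "\<not> J n > 0"
    then have "cc * J n \<le> 0" using cc0 by (simp add: mult_nonneg_nonpos)
    then show False using Jm[of n] zero_less_power[OF \<epsilon>(1)[of n], of "DIM('a)"] by linarith
  qed
  define w where "w n x = lipschitz_kernel.conv (mker (\<epsilon> n)) u x / J n" for n x
  have kern: "lipschitz_kernel (mker (\<epsilon> n) :: 'a \<Rightarrow> real) 1 (1 / \<epsilon> n)" for n by (rule mker_kernel[OF \<epsilon>(1)])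
  have mass: "lipschitz_kernel.mass (mker (\<epsilon> n) :: 'a \<Rightarrow> real) = J n" for n
    unfolding J_def by (rule lipschitz_kernel.mass_def[OF kern])
  have core: "w n \<in> lip_core \<Omega>" for n
  proof -
    interpret lipschitz_kernel "mker (\<epsilon> n) :: 'a \<Rightarrow> real" 1 "1 / \<epsilon> n" by (rule kern)
    let ?L = "1 / \<epsilon> n * (\<integral>y. \<bar>u y\<bar> \<partial>lborel) / J n"
    have a: "0 \<le> ?L" using \<epsilon>(1)[of n] J[of n] by (intro divide_nonneg_nonneg mult_nonneg_nonneg integral_nonneg_AE) auto
    have b: "\<bar>w n x - w n y\<bar> \<le> ?L * norm (x - y)" for x y
    proof -
      have "\<bar>w n x - w n y\<bar> = \<bar>conv u x - conv u y\<bar> / J n"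
        unfolding w_def using J[of n] by (simp add: diff_divide_distrib[symmetric])
      also have "\<dots> \<le> (1 / \<epsilon> n * (\<integral>y. \<bar>u y\<bar> \<partial>lborel) * norm (x - y)) / J n"
        using conv_lipschitz[OF uL(2)] J[of n] by (intro divide_right_mono) auto
      finally show ?thesis by simp
    qed
    have c: "w n x = 0" if "x \<notin> \<Omega>" for x
    proof -
      have "mker (\<epsilon> n) (x - y) * u y = 0" for y
      proof (cases "u y = 0")
        case False
        then have "x \<notin> ball y \<delta>" using \<delta>(2) that by blast
        then have "norm (x - y) \<ge> \<epsilon> n" using \<epsilon>(2)[of n] by (simp add: dist_norm norm_minus_commute)
        then show ?thesis using \<epsilon>(1)[of n] by (simp add: mker_def)
      qed simp
      then have "conv u x = 0" unfolding conv_def by (simp only: Bochner_Integration.integral_zero)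
      then show ?thesis by (simp add: w_def)
    qed
    show ?thesis unfolding lip_core_def
      by (intro CollectI conjI exI[of _ ?L] allI impI) (rule a b c, assumption?)+
  qed
  have near: "nearE 0 (w n) (w n) \<le> nearE 0 u u" for n
  proof -
    interpret lipschitz_kernel "mker (\<epsilon> n) :: 'a \<Rightarrow> real" 1 "1 / \<epsilon> n" by (rule kern)
    have wD: "w n \<in> Dom \<Omega> 0" using lip_core_Dom[OF core] by simp
    have [measurable]: "conv u \<in> borel_measurable borel" using conv_measurable[OF uL(2)] .
    have "ennreal (nearE 0 (w n) (w n)) = (\<integral>\<^sup>+p. ennreal (1 / (J n)\<^sup>2) * ennreal (near 0 p * (dif (conv u) p)\<^sup>2) \<partial>lborel2)"
      unfolding nearE_eq_nn[OF wD]
    proof (intro nn_integral_cong)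
      fix p
      have "dif (w n) p = dif (conv u) p / J n" by (simp add: dif_def w_def diff_divide_distrib)
      then have "near 0 p * (dif (w n) p)\<^sup>2 = 1 / (J n)\<^sup>2 * (near 0 p * (dif (conv u) p)\<^sup>2)" by (simp add: power_divide)
      then show "ennreal (near 0 p * (dif (w n) p)\<^sup>2) = ennreal (1 / (J n)\<^sup>2) * ennreal (near 0 p * (dif (conv u) p)\<^sup>2)"
        by (simp only: ennreal_mult'[symmetric] zero_le_divide_1_iff zero_le_power2)
    qed
    also have "\<dots> = ennreal (1 / (J n)\<^sup>2) * (\<integral>\<^sup>+p. ennreal (near 0 p * (dif (conv u) p)\<^sup>2) \<partial>lborel2)"
      by (rule nn_integral_cmult) measurable
    also have "\<dots> \<le> ennreal (1 / (J n)\<^sup>2) * (ennreal (mass\<^sup>2) * (\<integral>\<^sup>+p. ennreal (near 0 p * (dif u p)\<^sup>2) \<partial>lborel2))"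
      by (intro mult_left_mono conv_near_energy uL) auto
    also have "\<dots> = ennreal (1 / (J n)\<^sup>2 * ((J n)\<^sup>2 * nearE 0 u u))"
      unfolding mass nearE_eq_nn[OF u, symmetric] using nearE_nonneg[of 0 u] by (simp only: ennreal_mult'[symmetric] zero_le_divide_1_iff zero_le_power2)
    also have "1 / (J n)\<^sup>2 * ((J n)\<^sup>2 * nearE 0 u u) = nearE 0 u u" using J[of n] by simp
    finally show ?thesis using nearE_nonneg[of 0 u] by simp
  qed
  have L2: "L2_lim w u"
  proof -
    \<comment> \<open>The energy density of \<open>u\<close> restricted to pairs closer than the
      mollification scale.\<close>
    define t where "t n p = indicator {p. norm (fst p - snd p) < \<epsilon> n} p * (near 0 p * (dif u p)\<^sup>2)" for n and p :: "'a \<times> 'a"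
    have ti: "integrable lborel2 (t n)" for n
      unfolding t_def by (rule Bochner_Integration.integrable_bound[OF DomD(4)[OF u]]) (auto simp: indicator_def)
    have t0: "(\<lambda>n. integral\<^sup>L lborel2 (t n)) \<longlonglongrightarrow> integral\<^sup>L lborel2 (\<lambda>_::'a \<times> 'a. 0)"
    proof (rule integral_dominated_convergence[where w="\<lambda>p. near 0 p * (dif u p)\<^sup>2"])
      show "integrable lborel2 (\<lambda>p. near 0 p * (dif u p)\<^sup>2)" by (rule DomD(4)[OF u])
      show "AE p in lborel2. (\<lambda>n. t n p) \<longlonglongrightarrow> 0"
      proof (rule AE_I2)
        fix p :: "'a \<times> 'a"
        show "(\<lambda>n. t n p) \<longlonglongrightarrow> 0"
        proof (cases "fst p = snd p")
          case False
          then have "eventually (\<lambda>n. \<epsilon> n < norm (fst p - snd p)) sequentially" using \<epsilon>0 by (intro order_tendstoD(2)[of _ 0]) auto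
          then have "eventually (\<lambda>n. t n p = 0) sequentially" by eventually_elim (simp add: t_def)
          then show ?thesis by (rule tendsto_eventually)
        qed (simp add: t_def dif_def)
      qed
      show "AE p in lborel2. norm (t n p) \<le> near 0 p * (dif u p)\<^sup>2" for n
        by (intro AE_I2) (auto simp: t_def indicator_def)
    qed (use borel_measurable_integrable[OF ti] in auto)
    have le: "on_diff ip (w n) u \<le> cc * integral\<^sup>L lborel2 (t n)" for n
    proof -
      interpret lipschitz_kernel "mker (\<epsilon> n) :: 'a \<Rightarrow> real" 1 "1 / \<epsilon> n" by (rule kern)
      have [measurable]: "conv u \<in> borel_measurable borel" using conv_measurable[OF uL(2)] .
      have wL: "w n \<in> L2" using lip_core_L2(1)[OF core] .
      have t_nonneg: "0 \<le> t n p" for p by (simp add: t_def)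
      \<comment> \<open>For \<open>d < \<epsilon> n\<close> the kernel is at most
        \<open>1 \<le> (\<epsilon> n / d) ^ N\<close>, which is \<open>\<epsilon> n ^ N\<close>
        times the near kernel. The factor \<open>\<epsilon> n ^ N\<close> is then absorbed by the
        mass through \<open>Jm\<close>.\<close>
      have kt: "mker (\<epsilon> n) (fst p - snd p) * (dif u p)\<^sup>2 \<le> \<epsilon> n ^ DIM('a) * t n p" for p
      proof (cases "fst p \<noteq> snd p \<and> norm (fst p - snd p) < \<epsilon> n")
        case False
        then show ?thesis using \<epsilon>(1)[of n] t_nonneg[of p] by (auto simp: dif_def mker_def max_def field_simps)
      next
        case True
        define d where "d = norm (fst p - snd p)"
        have d: "0 < d" "d < \<epsilon> n" "d < 1" using True \<epsilon>(3)[of n] by (auto simp: d_def)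
        have "mker (\<epsilon> n) (fst p - snd p) \<le> 1" by (rule k_le)
        also have "1 \<le> \<epsilon> n ^ DIM('a) / d ^ DIM('a)"
          using d by (simp add: power_mono)
        also have "\<dots> = \<epsilon> n ^ DIM('a) * near 0 p" using d by (simp add: near_def d_def[symmetric] powr_realpow)
        finally have "mker (\<epsilon> n) (fst p - snd p) * (dif u p)\<^sup>2 \<le> \<epsilon> n ^ DIM('a) * near 0 p * (dif u p)\<^sup>2"
          by (intro mult_right_mono) auto
        then show ?thesis using True by (simp add: t_def mult_ac)
      qed
      have "ennreal ((J n)\<^sup>2 * on_diff ip (w n) u) = (\<integral>\<^sup>+x. ennreal ((J n)\<^sup>2) * ennreal ((w n x - u x)\<^sup>2) \<partial>lborel)"
        using wL uL L2_measurable[OF wL] by (simp add: ennreal_mult' ip_eq_nn[OF L2_diff] nn_integral_cmult)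
      also have "\<dots> = (\<integral>\<^sup>+x. ennreal ((mass * u x - conv u x)\<^sup>2) \<partial>lborel)"
      proof (intro nn_integral_cong)
        fix x
        have "(J n)\<^sup>2 * (w n x - u x)\<^sup>2 = (mass * u x - conv u x)\<^sup>2"
        proof -
          have "J n * (w n x - u x) = conv u x - mass * u x" using J[of n] by (simp add: w_def mass right_diff_distrib)
          then have "(J n * (w n x - u x))\<^sup>2 = (conv u x - mass * u x)\<^sup>2" by simp
          then show ?thesis by (simp add: power_mult_distrib power2_commute)
        qed
        then show "ennreal ((J n)\<^sup>2) * ennreal ((w n x - u x)\<^sup>2) = ennreal ((mass * u x - conv u x)\<^sup>2)"
          by (simp add: ennreal_mult'[symmetric])
      qed
      also have "\<dots> \<le> ennreal mass * (\<integral>\<^sup>+p. ennreal (mker (\<epsilon> n) (fst p - snd p) * (dif u p)\<^sup>2) \<partial>lborel2)"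
        by (rule conv_error[OF uL(2,1)])
      also have "\<dots> \<le> ennreal mass * (\<integral>\<^sup>+p. ennreal (\<epsilon> n ^ DIM('a) * t n p) \<partial>lborel2)"
        by (intro mult_left_mono nn_integral_mono ennreal_leI kt) auto
      also have "(\<integral>\<^sup>+p. ennreal (\<epsilon> n ^ DIM('a) * t n p) \<partial>lborel2) = ennreal (\<epsilon> n ^ DIM('a) * integral\<^sup>L lborel2 (t n))"
        using ti[of n] t_nonneg \<epsilon>(1)[of n] by (subst nn_integral_eq_integral) auto
      also have "ennreal mass * \<dots> = ennreal (J n * (\<epsilon> n ^ DIM('a) * integral\<^sup>L lborel2 (t n)))"
        unfolding mass using J[of n] by (simp add: ennreal_mult')
      finally have "(J n)\<^sup>2 * on_diff ip (w n) u \<le> J n * (\<epsilon> n ^ DIM('a) * integral\<^sup>L lborel2 (t n))"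
        using J[of n] \<epsilon>(1)[of n] t_nonneg by (subst (asm) ennreal_le_iff) (auto intro!: mult_nonneg_nonneg integral_nonneg_AE simp: less_imp_le)
      also have "\<dots> \<le> J n * ((cc * J n) * integral\<^sup>L lborel2 (t n))"
        using J[of n] Jm[of n] t_nonneg by (intro mult_left_mono mult_right_mono integral_nonneg_AE) (auto simp: less_imp_le)
      also have "\<dots> = (J n)\<^sup>2 * (cc * integral\<^sup>L lborel2 (t n))" by (simp add: power2_eq_square)
      finally show ?thesis using J[of n] by (subst (asm) mult_le_cancel_left_pos) auto
    qed
    show ?thesis unfolding L2_lim_def
    proof (rule tendsto_sandwich[of "\<lambda>_. 0" _ _ "\<lambda>n. cc * integral\<^sup>L lborel2 (t n)"])
      show "(\<lambda>n. cc * integral\<^sup>L lborel2 (t n)) \<longlonglongrightarrow> 0"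
        using tendsto_mult_left[OF t0, of cc] by simp
    qed (use le in \<open>auto simp: ip_nonneg\<close>)
  qed
  show ?thesis
  proof (rule approximable_limit[OF u, of w])
    show "w n \<in> Dom \<Omega> 0" for n using lip_core_Dom[OF core] by simp
    show "approximable (w n)" for n using approximable_core[OF core] .
    show "\<forall>\<^sub>F n in sequentially. nearE 0 (w n) (w n) \<le> nearE 0 u u + \<epsilon>'" if "\<epsilon>' > 0" for \<epsilon>'
      using near that by (intro always_eventually allI) (metis add_increasing2 less_imp_le)
  qed (rule L2)
qed

end

subsection \<open>Volume of the boundary strip\<close>

text \<open>The translates of the slab by multiples of \<open>3 a e\<close> are disjoint and stay in a fixed ball,
  so the slab has volume of order \<open>a\<close>; no change of coordinates is needed.\<close>

lemma slab_measure:
  fixes h :: "'a::euclidean_space \<Rightarrow> real"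
  assumes [measurable]: "h \<in> borel_measurable borel" and e: "norm e = 1"
    and h: "\<And>y t. h (y + t *\<^sub>R e) = h y - t" and a: "0 < a" "a \<le> 1/6"
  shows "measure lborel {y\<in>ball c r. \<bar>h y\<bar> \<le> a} \<le> 6 * measure lborel (ball c (r + 1)) * a"
proof -
  define T where "T = {y\<in>ball c r. \<bar>h y\<bar> \<le> a}"
  \<comment> \<open>With \<open>3 * a * m \<le> 1\<close> the translates stay in the enlarged ball,
    and for \<open>a \<le> 1/6\<close> rounding down still leaves at least
    \<open>1 / (6 * a)\<close> of them.\<close>
  define m where "m = nat \<lfloor>1 / (3 * a)\<rfloor>"
  have m: "real m \<le> 1 / (3 * a)" "1 / (3 * a) - 1 < real m"
    using a by (auto simp: m_def)
  have m6: "1 / (6 * a) \<le> real m"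
  proof -
    have "1 \<le> 1 / (6 * a)" using a by (simp add: field_simps)
    moreover have "1 / (3 * a) = 1 / (6 * a) + 1 / (6 * a)" using a by (simp add: field_simps)
    ultimately show ?thesis using m(2) by linarith
  qed
  have T [measurable]: "T \<in> sets borel" unfolding T_def by measurable
  have Tf: "emeasure lborel T < \<infinity>"
    by (rule order_le_less_trans[OF emeasure_mono[of T "ball c r"]]) (use emeasure_bounded_finite[OF bounded_ball[of c r]] in \<open>auto simp: T_def\<close>)
  define S where "S j = (\<lambda>y. (3 * a * real j) *\<^sub>R e + y) ` T" for j :: nat
  have S_eq: "S j = (\<lambda>y. y - (3 * a * real j) *\<^sub>R e) -` T" for j
    unfolding S_def by (auto intro!: image_eqI[where x="_ - (3 * a * real j) *\<^sub>R e"])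
  have S [measurable]: "S j \<in> sets borel" for j
    unfolding S_eq using measurable_sets_borel[of "\<lambda>y. y - (3 * a * real j) *\<^sub>R e" borel T] by simp
  have Sm: "measure lborel (S j) = measure lborel T" for j
  proof -
    have "emeasure lborel T = emeasure (distr lborel borel ((+) (- ((3 * a * real j) *\<^sub>R e)))) T" by (simp add: lborel_distr_plus)
    also have "\<dots> = emeasure lborel (S j)" unfolding S_eq by (subst emeasure_distr) (auto simp: vimage_def)
    finally show ?thesis by (simp add: measure_def)
  qed
  have disj: "disjoint_family_on S {..<m}"
  proof (unfold disjoint_family_on_def, intro ballI impI)
    fix i j :: nat assume "i \<noteq> j"
    show "S i \<inter> S j = {}"
    proof (rule ccontr)
      assume "S i \<inter> S j \<noteq> {}"
      then obtain y where y: "y - (3 * a * real i) *\<^sub>R e \<in> T" "y - (3 * a * real j) *\<^sub>R e \<in> T" unfolding S_eq by auto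
      have "\<bar>h y + 3 * a * real i\<bar> \<le> a" "\<bar>h y + 3 * a * real j\<bar> \<le> a"
        using y h[of y "- (3 * a * real i)"] h[of y "- (3 * a * real j)"] by (auto simp: T_def)
      then have "\<bar>3 * a * (real i - real j)\<bar> \<le> 2 * a" by (simp add: right_diff_distrib)
      moreover have "\<bar>real i - real j\<bar> \<ge> 1" using \<open>i \<noteq> j\<close> by linarith
      then have "3 * a * 1 \<le> 3 * a * \<bar>real i - real j\<bar>" using a by (intro mult_left_mono) auto
      then have "3 * a \<le> \<bar>3 * a * (real i - real j)\<bar>" using a by (simp add: abs_mult)
      ultimately show False using a by linarith
    qed
  qed
  have sub: "(\<Union>j<m. S j) \<subseteq> ball c (r + 1)"
  proof
    fix y assume "y \<in> (\<Union>j<m. S j)"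
    then obtain j where j: "j < m" "y - (3 * a * real j) *\<^sub>R e \<in> T" unfolding S_eq by auto
    have "dist c y \<le> dist c (y - (3 * a * real j) *\<^sub>R e) + norm ((3 * a * real j) *\<^sub>R e)"
      using dist_triangle[of c y "y - (3 * a * real j) *\<^sub>R e"] by (simp add: dist_norm)
    moreover have "norm ((3 * a * real j) *\<^sub>R e) \<le> 1"
    proof -
      have "3 * a * real j \<le> 3 * a * (1 / (3 * a))" using j(1) m(1) a by (intro mult_left_mono) auto
      then show ?thesis using e a by simp
    qed
    ultimately have "dist c y \<le> dist c (y - (3 * a * real j) *\<^sub>R e) + 1" by linarith
    then show "y \<in> ball c (r + 1)" using j(2) by (simp add: T_def)
  qed
  have "real m * measure lborel T = (\<Sum>j<m. measure lborel (S j))" by (simp add: Sm)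
  also have "\<dots> = measure lborel (\<Union>j<m. S j)"
  proof (rule measure_finite_Union[symmetric])
    show "emeasure lborel (S j) \<noteq> \<infinity>" if "j \<in> {..<m}" for j
    proof -
      have "S j \<subseteq> ball c (r + 1)" using sub that by blast
      then have "bounded (S j)" by (rule bounded_subset[OF bounded_ball])
      then show ?thesis using emeasure_bounded_finite by (metis infinity_ennreal_def less_irrefl)
    qed
  qed (use disj in auto)
  also have "\<dots> \<le> measure lborel (ball c (r + 1))"
    by (rule measure_mono_fmeasurable[OF sub]) (use emeasure_bounded_finite[OF bounded_ball[of c "r + 1"]] in \<open>auto simp: fmeasurable_def\<close>)
  finally have mT: "real m * measure lborel T \<le> measure lborel (ball c (r + 1))" .
  have "1 / (6 * a) * measure lborel T \<le> real m * measure lborel T" by (rule mult_right_mono[OF m6]) simp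
  then have "1 / (6 * a) * measure lborel T \<le> measure lborel (ball c (r + 1))" using mT by simp
  then show ?thesis unfolding T_def[symmetric] using a by (simp add: field_simps)
qed

context bounded_open
begin

text \<open>The local graph recast as a zero set: \<open>h\<close> is the signed height of the graph
  over a point, measured along \<open>e\<close>. The clauses are exactly the input of the volume
  estimate for the strip.\<close>

definition chart :: "'a \<Rightarrow> real \<Rightarrow> ('a \<Rightarrow> real) \<Rightarrow> 'a \<Rightarrow> real \<Rightarrow> bool" where
  "chart x r h e L \<longleftrightarrow> 0 < r \<and> continuous_on UNIV h \<and> norm e = 1 \<and> (\<forall>y t. h (y + t *\<^sub>R e) = h y - t) \<and>
     0 \<le> L \<and> (\<forall>y z. \<bar>h y - h z\<bar> \<le> L * dist y z) \<and> (\<forall>z\<in>frontier \<Omega> \<inter> ball x r. h z = 0)"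

lemma boundary_chart:
  assumes "lipschitz_boundary \<Omega>" "x \<in> frontier \<Omega>"
  shows "\<exists>r h e L. chart x r h e L"
proof -
  obtain r e g L where r: "r > 0" "norm (e::'a) = 1" "L-lipschitz_on {z. z \<bullet> e = 0} g"
    "\<Omega> \<inter> ball x r = {y\<in>ball x r. y \<bullet> e < g (y - (y \<bullet> e) *\<^sub>R e)}"
    using assms unfolding lipschitz_boundary_def by blast
  have ee: "e \<bullet> e = 1" using r(2) by (simp add: norm_eq_1)
  define pr where "pr y = y - (y \<bullet> e) *\<^sub>R e" for y
  define h where "h y = g (pr y) - y \<bullet> e" for y
  have pr0: "pr y \<in> {z. z \<bullet> e = 0}" for y by (simp add: pr_def inner_diff_left ee)
  have L0: "0 \<le> L" using r(3) by (rule lipschitz_on_nonneg)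
  have prd: "dist (pr y) (pr z) \<le> 2 * dist y z" for y z
  proof -
    have "pr y - pr z = (y - z) - ((y - z) \<bullet> e) *\<^sub>R e" by (simp add: pr_def algebra_simps inner_diff_left)
    then have "norm (pr y - pr z) \<le> norm (y - z) + norm (((y - z) \<bullet> e) *\<^sub>R e)" by (metis norm_triangle_ineq4)
    also have "norm (((y - z) \<bullet> e) *\<^sub>R e) \<le> norm (y - z)" using Cauchy_Schwarz_ineq2[of "y - z" e] r(2) by simp
    finally show ?thesis by (simp add: dist_norm)
  qed
  \<comment> \<open>The projection along \<open>e\<close> is estimated crudely as 2-Lipschitz, and
    the height contributes the summand one.\<close>
  have hl: "\<bar>h y - h z\<bar> \<le> (2 * L + 1) * dist y z" for y z
  proof -
    have "\<bar>g (pr y) - g (pr z)\<bar> \<le> L * dist (pr y) (pr z)"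
      using lipschitz_onD[OF r(3) pr0 pr0, of y z] by (simp add: dist_real_def)
    also have "\<dots> \<le> L * (2 * dist y z)" using prd L0 by (rule mult_left_mono)
    finally have 1: "\<bar>g (pr y) - g (pr z)\<bar> \<le> 2 * L * dist y z" by simp
    have "\<bar>y \<bullet> e - z \<bullet> e\<bar> \<le> dist y z"
      using Cauchy_Schwarz_ineq2[of "y - z" e] r(2) by (simp add: inner_diff_left dist_norm)
    then show ?thesis using 1 unfolding h_def by (simp add: algebra_simps)
  qed
  have hc: "continuous_on UNIV h"
    by (rule lipschitz_on_continuous_on[of "2 * L + 1"], rule lipschitz_onI) (use hl L0 in \<open>auto simp: dist_real_def\<close>)
  have "pr (y + t *\<^sub>R e) = pr y" for y t by (simp add: pr_def inner_add_left ee algebra_simps)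
  then have ht: "h (y + t *\<^sub>R e) = h y - t" for y t by (simp add: h_def inner_add_left ee)
  have zero: "h z = 0" if z: "z \<in> frontier \<Omega>" "z \<in> ball x r" for z
  proof -
    have iff: "y \<in> \<Omega> \<longleftrightarrow> h y > 0" if "y \<in> ball x r" for y
    proof -
      have "y \<in> \<Omega> \<inter> ball x r \<longleftrightarrow> y \<in> {y\<in>ball x r. y \<bullet> e < g (y - (y \<bullet> e) *\<^sub>R e)}" by (simp only: r(4))
      then show ?thesis using that by (simp add: h_def pr_def)
    qed
    have "z \<notin> \<Omega>" using z(1) open_\<Omega> by (simp add: frontier_def interior_open)
    then have "h z \<le> 0" using iff z(2) by auto
    \<comment> \<open>Otherwise a whole neighbourhood of \<open>z\<close> would lie above the graph
      and miss \<Omega>, although \<open>z\<close> is in its closure.\<close>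
    moreover have "\<not> h z < 0"
    proof
      assume neg: "h z < 0"
      have "open {y. h y < 0}" using hc by (simp add: open_Collect_less continuous_on_const)
      then have o: "open ({y. h y < 0} \<inter> ball x r)" by auto
      have "z \<in> closure \<Omega>" using z(1) by (simp add: frontier_def)
      then have "\<Omega> \<inter> ({y. h y < 0} \<inter> ball x r) \<noteq> {}"
        using open_Int_closure_eq_empty[OF o, of \<Omega>] neg z(2) by blast
      then show False using iff by force
    qed
    ultimately show ?thesis by simp
  qed
  have "chart x r h e (2 * L + 1)" unfolding chart_def using r(1) hc r(2) ht hl zero L0 by simp
  then show ?thesis by blast
qed

lemma infdist_measurable [measurable]: "(\<lambda>x. infdist x (- \<Omega>)) \<in> borel_measurable borel"
  by (intro borel_measurable_continuous_onI continuous_intros)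

lemma strip_borel: "{x\<in>\<Omega>. infdist x (- \<Omega>) < \<delta>} \<in> sets borel"
proof -
  have "{x\<in>\<Omega>. infdist x (- \<Omega>) < \<delta>} = \<Omega> \<inter> {x. infdist x (- \<Omega>) < \<delta>}" by auto
  also have "\<dots> \<in> sets borel" by measurable
  finally show ?thesis .
qed

text \<open>A point of the strip is joined to the complement by a segment shorter than
  \<open>\<delta>\<close>, which crosses the frontier, where \<open>h\<close> vanishes. So
  \<open>h\<close> is at most of order \<open>\<delta>\<close> at the point, and finitely many slabs
  cover the strip.\<close>

lemma strip_measure:
  assumes lip: "lipschitz_boundary \<Omega>"
  shows "\<exists>\<delta>0 C. 0 < \<delta>0 \<and> 0 \<le> C \<and>
    (\<forall>\<delta>. 0 < \<delta> \<and> \<delta> < \<delta>0 \<longrightarrow> measure lborel {x\<in>\<Omega>. infdist x (- \<Omega>) < \<delta>} \<le> C * \<delta>)"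
proof -
  obtain r h e L where ch: "\<And>x. x \<in> frontier \<Omega> \<Longrightarrow> chart x (r x) (h x) (e x) (L x)"
    using boundary_chart[OF lip] by metis
  have "compact (frontier \<Omega>)" using bounded_\<Omega> by (simp add: compact_frontier_bounded)
  then obtain X where X: "X \<subseteq> frontier \<Omega>" "finite X" "frontier \<Omega> \<subseteq> (\<Union>x\<in>X. ball x (r x / 2))"
  proof (rule compactE_image[of _ "frontier \<Omega>" "\<lambda>x. ball x (r x / 2)"])
    show "frontier \<Omega> \<subseteq> (\<Union>x\<in>frontier \<Omega>. ball x (r x / 2))"
    proof
      fix x assume x: "x \<in> frontier \<Omega>"
      then have "0 < r x" using ch[OF x] by (simp add: chart_def)
      then show "x \<in> (\<Union>x\<in>frontier \<Omega>. ball x (r x / 2))" using x by (intro UN_I[of x]) auto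
    qed
  qed auto
  \<comment> \<open>The bound \<open>r x / 2\<close> keeps the strip point in the chart ball when
    the crossing point is in the half ball; the second bound meets the thickness limit 1/6 of
    \<open>slab_measure\<close>. Inserting 1 keeps the minimum meaningful for empty
    \<open>X\<close>.\<close>
  define \<delta>0 where "\<delta>0 = Min (insert 1 ((\<lambda>x. min (r x / 2) (1 / (6 * (L x + 1)))) ` X))"
  define C where "C = (\<Sum>x\<in>X. 6 * measure lborel (ball x (r x + 1)) * (L x + 1))"
  have rL: "r x > 0" "L x \<ge> 0" if "x \<in> X" for x using ch[of x] X(1) that by (auto simp: chart_def)
  show ?thesis
  proof (rule exI[of _ \<delta>0], rule exI[of _ C], intro conjI allI impI)
    show "0 < \<delta>0" unfolding \<delta>0_def using X(2) rL by (subst Min_gr_iff) (auto simp: add_nonneg_pos)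
    show "0 \<le> C" unfolding C_def using rL by (intro sum_nonneg mult_nonneg_nonneg) (auto simp: add_nonneg_nonneg)
    fix \<delta> :: real assume "0 < \<delta> \<and> \<delta> < \<delta>0"
    then have \<delta>: "0 < \<delta>" "\<delta> < \<delta>0" by auto
    have \<delta>x: "\<delta> < r x / 2" "\<delta> \<le> 1 / (6 * (L x + 1))" if "x \<in> X" for x
    proof -
      have "\<delta>0 \<le> min (r x / 2) (1 / (6 * (L x + 1)))" unfolding \<delta>0_def using X(2) that by (intro Min_le) auto
      then show "\<delta> < r x / 2" "\<delta> \<le> 1 / (6 * (L x + 1))" using \<delta>(2) by auto
    qed
    \<comment> \<open>The factor \<open>L x + 1\<close> rather than \<open>L x\<close> keeps the
      slab thickness positive even when \<open>L x = 0\<close>.\<close>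
    define T where "T x = {y\<in>ball x (r x). \<bar>h x y\<bar> \<le> (L x + 1) * \<delta>}" for x
    have hb: "h x \<in> borel_measurable borel" if "x \<in> X" for x
      using ch[of x] X(1) that by (intro borel_measurable_continuous_onI) (auto simp: chart_def)
    have Tm: "measure lborel (T x) \<le> 6 * measure lborel (ball x (r x + 1)) * ((L x + 1) * \<delta>)" if x: "x \<in> X" for x
      unfolding T_def
    proof (rule slab_measure[OF hb[OF x], of "e x"])
      have "(L x + 1) * \<delta> \<le> (L x + 1) * (1 / (6 * (L x + 1)))" using \<delta>x(2)[OF x] rL[OF x] by (intro mult_left_mono) auto
      also have "\<dots> = 1/6" using rL[OF x] by simp
      finally show "(L x + 1) * \<delta> \<le> 1/6" .
      show "0 < (L x + 1) * \<delta>" using rL[OF x] \<delta> by simp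
    qed (use ch[of x] X(1) x in \<open>auto simp: chart_def\<close>)
    have sub: "{x\<in>\<Omega>. infdist x (- \<Omega>) < \<delta>} \<subseteq> (\<Union>x\<in>X. T x)"
    proof
      fix y assume "y \<in> {x\<in>\<Omega>. infdist x (- \<Omega>) < \<delta>}"
      then have y: "y \<in> \<Omega>" "infdist y (- \<Omega>) < \<delta>" by auto
      have ne: "- \<Omega> \<noteq> {}" using bounded_\<Omega> not_bounded_UNIV by (metis Compl_empty_eq double_complement)
      obtain w where w: "w \<in> - \<Omega>" "dist y w < \<delta>"
      proof -
        have "closed (- \<Omega>)" using open_\<Omega> by (simp add: closed_Compl)
        from infdist_attains_inf[OF this ne, of y] that y(2) show ?thesis by metis
      qed
      have "closed_segment y w \<inter> \<Omega> \<noteq> {}" "closed_segment y w - \<Omega> \<noteq> {}" using y w by auto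
      then have "closed_segment y w \<inter> frontier \<Omega> \<noteq> {}"
        by (intro connected_Int_frontier) auto
      then obtain z where z: "z \<in> closed_segment y w" "z \<in> frontier \<Omega>" by blast
      have yz: "dist y z < \<delta>" using dist_in_closed_segment[OF z(1)] w(2) by (simp add: dist_commute)
      obtain x where x: "x \<in> X" "z \<in> ball x (r x / 2)" using X(3) z(2) by blast
      have xz: "z \<in> ball x (r x)" using x rL[OF x(1)] by auto
      have cx: "chart x (r x) (h x) (e x) (L x)" using ch x(1) X(1) by blast
      have xy: "dist x y < r x" using x(2) yz \<delta>x(1)[OF x(1)] dist_triangle[of x y z] by (simp add: dist_commute)
      have "h x z = 0" using cx z(2) xz by (simp add: chart_def)
      moreover have "\<bar>h x y - h x z\<bar> \<le> L x * dist y z" using cx by (simp add: chart_def)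
      ultimately have Lyz: "\<bar>h x y\<bar> \<le> L x * dist y z" by simp
      have "\<bar>h x y\<bar> \<le> (L x + 1) * \<delta>"
      proof -
        have "L x * dist y z \<le> (L x + 1) * \<delta>" using yz rL[OF x(1)] by (intro mult_mono) auto
        then show ?thesis using Lyz by linarith
      qed
      then show "y \<in> (\<Union>x\<in>X. T x)" using x(1) xy by (auto simp: T_def)
    qed
    have Tb: "T x \<in> sets lborel" "emeasure lborel (T x) < \<infinity>" if "x \<in> X" for x
    proof -
      have [measurable]: "h x \<in> borel_measurable borel" using hb[OF that] .
      show "T x \<in> sets lborel" unfolding T_def by measurable
      show "emeasure lborel (T x) < \<infinity>" by (rule emeasure_bounded_finite[OF bounded_subset[OF bounded_ball[of x "r x"]]]) (auto simp: T_def)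
    qed
    then have fT: "T x \<in> fmeasurable lborel" if "x \<in> X" for x using that by (auto simp: fmeasurable_def)
    have "{x\<in>\<Omega>. infdist x (- \<Omega>) < \<delta>} \<in> sets lborel" by (simp add: strip_borel)
    then have "measure lborel {x\<in>\<Omega>. infdist x (- \<Omega>) < \<delta>} \<le> measure lborel (\<Union>x\<in>X. T x)"
      using sub X(2) fT by (intro measure_mono_fmeasurable fmeasurable.finite_UN) auto
    also have "\<dots> \<le> (\<Sum>x\<in>X. measure lborel (T x))"
      using X(2) Tb(1) by (intro measure_UNION_le) auto
    also have "\<dots> \<le> (\<Sum>x\<in>X. 6 * measure lborel (ball x (r x + 1)) * ((L x + 1) * \<delta>))" by (intro sum_mono Tm)
    also have "\<dots> = C * \<delta>" unfolding C_def sum_distrib_right by (intro sum.cong) auto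
    finally show "measure lborel {x\<in>\<Omega>. infdist x (- \<Omega>) < \<delta>} \<le> C * \<delta>" .
  qed
qed

end

subsection \<open>Cutoff and truncation\<close>

context bounded_open
begin

text \<open>It vanishes within distance \<open>\<delta>\<close> of the complement and equals one
  beyond \<open>2 * \<delta>\<close>; for pairs in \<Omega>, its energy is therefore carried by the
  strip of width \<open>2 * \<delta>\<close>.\<close>

definition cutoff :: "real \<Rightarrow> 'a \<Rightarrow> real" where
  "cutoff \<delta> x = min 1 (max 0 (infdist x (- \<Omega>) / \<delta> - 1))"

lemma complement: "- \<Omega> \<noteq> {}" "closed (- \<Omega>)"
  using bounded_\<Omega> not_bounded_UNIV open_\<Omega> by (metis Compl_empty_eq double_complement, simp add: closed_Compl)

lemma cutoff_measurable [measurable]: "cutoff \<delta> \<in> borel_measurable borel"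
  unfolding cutoff_def by measurable

lemma cutoff_range: "0 \<le> cutoff \<delta> x" "cutoff \<delta> x \<le> 1" by (auto simp: cutoff_def)

lemma cutoff_lipschitz:
  assumes "0 < \<delta>" shows "\<bar>cutoff \<delta> x - cutoff \<delta> y\<bar> \<le> dist x y / \<delta>"
proof -
  have "\<bar>min 1 (max 0 (a - 1)) - min 1 (max 0 (b - 1))\<bar> \<le> \<bar>a - b\<bar>" for a b :: real by (auto simp: min_def max_def)
  then have "\<bar>cutoff \<delta> x - cutoff \<delta> y\<bar> \<le> \<bar>infdist x (- \<Omega>) / \<delta> - infdist y (- \<Omega>) / \<delta>\<bar>" unfolding cutoff_def .
  also have "\<dots> = \<bar>infdist x (- \<Omega>) - infdist y (- \<Omega>)\<bar> / \<delta>" using assms by (simp add: diff_divide_distrib[symmetric])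
  also have "\<dots> \<le> dist x y / \<delta>" using assms infdist_triangle_abs by (intro divide_right_mono) auto
  finally show ?thesis .
qed

lemma cutoff_interior:
  assumes "0 < \<delta>" "cutoff \<delta> x \<noteq> 0" shows "ball x \<delta> \<subseteq> \<Omega>"
proof
  fix y assume y: "y \<in> ball x \<delta>"
  have d: "infdist x (- \<Omega>) > \<delta>" using assms by (auto simp: cutoff_def min_def max_def field_simps split: if_splits)
  show "y \<in> \<Omega>"
  proof (rule ccontr)
    assume "y \<notin> \<Omega>"
    then have "infdist x (- \<Omega>) \<le> dist x y" by (intro infdist_le) auto
    then show False using d y by simp
  qed
qed

text \<open>A majorant for the energy density of the cutoff up to the factor
  \<open>1 / sqrt \<delta>\<close>. The half power gained over the critical kernel makes it
  integrable, so its integral is proportional to the volume of the strip.\<close>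

definition strip_fun :: "real \<Rightarrow> 'a \<times> 'a \<Rightarrow> real" where
  "strip_fun \<delta> p = (indicator {x\<in>\<Omega>. infdist x (- \<Omega>) < \<delta>} (fst p) + indicator {x\<in>\<Omega>. infdist x (- \<Omega>) < \<delta>} (snd p)) *
     (indicator {z. norm z < 1} (fst p - snd p) * norm (fst p - snd p) powr (1/2 - real DIM('a)))"

lemma strip_fun_nonneg: "0 \<le> strip_fun \<delta> p" by (simp add: strip_fun_def)

lemma strip_fun_nn_integral:
  "(\<integral>\<^sup>+p. ennreal (strip_fun \<delta> p) \<partial>lborel2) = ennreal (4 * sphere_area TYPE('a) * measure lborel {x\<in>\<Omega>. infdist x (- \<Omega>) < \<delta>})"
proof -
  let ?S = "{x\<in>\<Omega>. infdist x (- \<Omega>) < \<delta>}"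
  let ?w = "sphere_area TYPE('a)"
  have w: "0 \<le> ?w" using sphere_area_pos[where 'a='a] by simp
  have "emeasure lborel ?S \<le> emeasure lborel \<Omega>" by (rule emeasure_mono) auto
  then have em: "emeasure lborel ?S = ennreal (measure lborel ?S)"
    using \<Omega>_finite by (intro emeasure_eq_ennreal_measure) (auto simp: top_unique)
  have "(\<integral>\<^sup>+p. ennreal (strip_fun \<delta> p) \<partial>lborel2) = 2 * (emeasure lborel ?S * ennreal (?w / (1/2)))"
  proof -
    let ?h = "\<lambda>z::'a. indicator {z. norm z < 1} z * norm z powr (1/2 - real DIM('a))"
    have "(\<integral>\<^sup>+z. ennreal (?h z) \<partial>lborel) = ennreal (?w / (1/2))" by (rule nn_integral_norm_powr_near) simp
    moreover have "(\<integral>\<^sup>+p. ennreal ((indicator ?S (fst p) + indicator ?S (snd p)) * ?h (fst p - snd p)) \<partial>lborel2)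
      = 2 * (emeasure lborel ?S * (\<integral>\<^sup>+z. ennreal (?h z) \<partial>lborel))"
      by (rule nn_integral_pair_indicator[OF strip_borel]) (auto simp: indicator_def)
    ultimately show ?thesis unfolding strip_fun_def by (simp only:)
  qed
  also have "\<dots> = ennreal 2 * (ennreal (measure lborel ?S) * ennreal (?w / (1/2)))" by (simp add: em)
  also have "\<dots> = ennreal (2 * (measure lborel ?S * (?w / (1/2))))"
    using w by (simp only: ennreal_mult'[symmetric] measure_nonneg zero_le_numeral)
  finally show ?thesis by (simp add: mult_ac)
qed

text \<open>Between two points of \<open>\<Omega>\<close> the increment of the cutoff is at most
  \<open>min 1 (d / \<delta>)\<close>, whose square is at most \<open>sqrt (d / \<delta>)\<close>; this tames the logarithmic
  divergence of the kernel at the price of a factor \<open>\<delta> powr (-1/2)\<close>, which the volume of the strip beats.\<close>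

lemma cutoff_near_bound:
  assumes \<delta>: "0 < \<delta>" and p: "fst p \<in> \<Omega>" "snd p \<in> \<Omega>"
  shows "near 0 p * (dif (cutoff \<delta>) p)\<^sup>2 \<le> 1 / sqrt \<delta> * strip_fun (2 * \<delta>) p"
proof -
  define d where "d = norm (fst p - snd p)"
  define m where "m = \<bar>dif (cutoff \<delta>) p\<bar>"
  show ?thesis
  proof (cases "m = 0 \<or> d = 0 \<or> d \<ge> 1")
    case True
    then have "near 0 p * (dif (cutoff \<delta>) p)\<^sup>2 = 0" by (auto simp: m_def d_def near_def dif_def)
    moreover have "0 \<le> 1 / sqrt \<delta> * strip_fun (2 * \<delta>) p" using strip_fun_nonneg[of "2 * \<delta>" p] \<delta> by simp
    ultimately show ?thesis by linarith
  next
    case False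
    then have d: "0 < d" "d < 1" by (auto simp: d_def)
    have m: "0 < m" "m \<le> 1" using False cutoff_range[of \<delta> "fst p"] cutoff_range[of \<delta> "snd p"] by (auto simp: m_def dif_def)
    have md: "m \<le> d / \<delta>" using cutoff_lipschitz[OF \<delta>, of "fst p" "snd p"] by (simp add: m_def dif_def d_def dist_norm)
    have in_strip: "1 \<le> (indicator {x\<in>\<Omega>. infdist x (- \<Omega>) < 2 * \<delta>} (fst p) + indicator {x\<in>\<Omega>. infdist x (- \<Omega>) < 2 * \<delta>} (snd p) :: real)"
    proof (rule ccontr)
      assume "\<not> ?thesis"
      then have "\<not> infdist (fst p) (- \<Omega>) < 2 * \<delta>" "\<not> infdist (snd p) (- \<Omega>) < 2 * \<delta>"
        using p by (auto simp: indicator_def)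
      then have "infdist (fst p) (- \<Omega>) \<ge> 2 * \<delta>" "infdist (snd p) (- \<Omega>) \<ge> 2 * \<delta>" by auto
      then have "cutoff \<delta> (fst p) = 1" "cutoff \<delta> (snd p) = 1" using \<delta> by (auto simp: cutoff_def min_def max_def field_simps)
      then show False using m by (simp add: m_def dif_def)
    qed
    have "m\<^sup>2 \<le> m" using m by (simp add: power2_eq_square mult_left_le_one_le)
    also have "m \<le> sqrt m" using m by (intro real_le_rsqrt) (simp add: power2_eq_square mult_left_le_one_le)
    also have "\<dots> \<le> sqrt (d / \<delta>)" using md by simp
    also have "\<dots> = d powr (1/2) / sqrt \<delta>" using d by (simp add: real_sqrt_divide powr_half_sqrt)
    finally have "m\<^sup>2 \<le> d powr (1/2) / sqrt \<delta>" .
    then have "near 0 p * m\<^sup>2 \<le> near 0 p * (d powr (1/2) / sqrt \<delta>)" by (intro mult_left_mono) auto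
    also have "near 0 p = d powr (- real DIM('a))" using d by (simp add: near_def d_def powr_minus_divide)
    also have "d powr (- real DIM('a)) * (d powr (1/2) / sqrt \<delta>) = 1 / sqrt \<delta> * d powr (1/2 - real DIM('a))"
    proof -
      have "d powr (1/2 - real DIM('a)) = d powr (- real DIM('a)) * d powr (1/2)" by (simp add: powr_add[symmetric])
      then show ?thesis by simp
    qed
    also have "\<dots> \<le> 1 / sqrt \<delta> * strip_fun (2 * \<delta>) p"
    proof (rule mult_left_mono)
      have "1 * d powr (1/2 - real DIM('a)) \<le> (indicator {x\<in>\<Omega>. infdist x (- \<Omega>) < 2 * \<delta>} (fst p) + indicator {x\<in>\<Omega>. infdist x (- \<Omega>) < 2 * \<delta>} (snd p)) * d powr (1/2 - real DIM('a))"
        using in_strip by (rule mult_right_mono) simp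
      then show "d powr (1/2 - real DIM('a)) \<le> strip_fun (2 * \<delta>) p" using d by (simp add: strip_fun_def d_def)
    qed (use \<delta> in auto)
    finally show ?thesis using d by (simp add: m_def near_def d_def powr_minus_divide)
  qed
qed

text \<open>The discrete product rule with Young's inequality of weight \<open>\<theta>\<close>,
  which keeps the factor of the energy of \<open>u\<close> as close to one as desired. For a pair
  with a point outside \<Omega>, \<open>u\<close> vanishes there and the cutoff only reduces the
  difference.\<close>

lemma cutoff_product_near_bound:
  assumes \<delta>: "0 < \<delta>" and \<theta>: "0 < \<theta>" and u: "\<And>x. \<bar>u x\<bar> \<le> K"
    and p: "fst p \<notin> \<Omega> \<Longrightarrow> u (fst p) = 0" "snd p \<notin> \<Omega> \<Longrightarrow> u (snd p) = 0"
  shows "near 0 p * (dif (\<lambda>x. u x * cutoff \<delta> x) p)\<^sup>2 \<le>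
     (1 + \<theta>) * (near 0 p * (dif u p)\<^sup>2) + (1 + 1 / \<theta>) * K\<^sup>2 / sqrt \<delta> * strip_fun (2 * \<delta>) p"
proof -
  define x y where "x = fst p" and "y = snd p"
  let ?c = "cutoff \<delta>"
  have K: "0 \<le> K" using u[of x] by linarith
  have rest: "0 \<le> (1 + 1 / \<theta>) * K\<^sup>2 / sqrt \<delta> * strip_fun (2 * \<delta>) p"
    using \<theta> \<delta> strip_fun_nonneg by (intro mult_nonneg_nonneg divide_nonneg_nonneg) auto
  show ?thesis
  proof (cases "x \<in> \<Omega> \<and> y \<in> \<Omega>")
    case True
    define a b where "a = ?c x * (u x - u y)" and "b = u y * (?c x - ?c y)"
    have "0 \<le> (sqrt \<theta> * a - b / sqrt \<theta>)\<^sup>2" by simp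
    also have "\<dots> = \<theta> * a\<^sup>2 + 1 / \<theta> * b\<^sup>2 - 2 * a * b"
      using \<theta> by (simp add: power2_diff power_mult_distrib power_divide)
    finally have "(a + b)\<^sup>2 \<le> (1 + \<theta>) * a\<^sup>2 + (1 + 1 / \<theta>) * b\<^sup>2"
      by (simp add: power2_sum algebra_simps)
    moreover have "dif (\<lambda>x. u x * ?c x) p = a + b" by (simp add: dif_def a_def b_def x_def y_def algebra_simps)
    moreover have "a\<^sup>2 \<le> (dif u p)\<^sup>2"
    proof -
      have "\<bar>a\<bar> \<le> \<bar>u x - u y\<bar>" unfolding a_def abs_mult using cutoff_range[of \<delta> x] by (intro mult_left_le_one_le) auto
      then show ?thesis by (simp add: dif_def x_def y_def abs_le_square_iff)
    qed
    moreover have "b\<^sup>2 \<le> K\<^sup>2 * (dif ?c p)\<^sup>2"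
    proof -
      have "(u y)\<^sup>2 \<le> K\<^sup>2" using u[of y] K by (simp add: abs_le_square_iff[symmetric])
      then show ?thesis unfolding b_def power_mult_distrib dif_def x_def y_def by (intro mult_right_mono) auto
    qed
    moreover have "(1 + \<theta>) * a\<^sup>2 \<le> (1 + \<theta>) * (dif u p)\<^sup>2" if "a\<^sup>2 \<le> (dif u p)\<^sup>2"
      using that \<theta> by (intro mult_left_mono) auto
    moreover have "(1 + 1 / \<theta>) * b\<^sup>2 \<le> (1 + 1 / \<theta>) * (K\<^sup>2 * (dif ?c p)\<^sup>2)" if "b\<^sup>2 \<le> K\<^sup>2 * (dif ?c p)\<^sup>2"
      using that \<theta> by (intro mult_left_mono) auto
    ultimately have "(dif (\<lambda>x. u x * ?c x) p)\<^sup>2 \<le> (1 + \<theta>) * (dif u p)\<^sup>2 + (1 + 1 / \<theta>) * (K\<^sup>2 * (dif ?c p)\<^sup>2)" by simp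
    then have "near 0 p * (dif (\<lambda>x. u x * ?c x) p)\<^sup>2 \<le> near 0 p * ((1 + \<theta>) * (dif u p)\<^sup>2 + (1 + 1 / \<theta>) * (K\<^sup>2 * (dif ?c p)\<^sup>2))"
      by (intro mult_left_mono) auto
    also have "\<dots> = (1 + \<theta>) * (near 0 p * (dif u p)\<^sup>2) + (1 + 1 / \<theta>) * K\<^sup>2 * (near 0 p * (dif ?c p)\<^sup>2)"
      by (simp only: distrib_left mult_ac)
    also have "\<dots> \<le> (1 + \<theta>) * (near 0 p * (dif u p)\<^sup>2) + (1 + 1 / \<theta>) * K\<^sup>2 * (1 / sqrt \<delta> * strip_fun (2 * \<delta>) p)"
      using cutoff_near_bound[OF \<delta>, of p] True \<theta> by (intro add_left_mono mult_left_mono) (auto simp: x_def y_def)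
    finally show ?thesis by simp
  next
    case False
    have le: "\<bar>u z * ?c z\<bar> \<le> \<bar>u z\<bar>" for z unfolding abs_mult using cutoff_range[of \<delta> z] by (simp add: mult_right_le_one_le)
    have "\<bar>dif (\<lambda>x. u x * ?c x) p\<bar> \<le> \<bar>dif u p\<bar>"
      using False p le[of x] le[of y] by (auto simp: dif_def x_def y_def)
    then have "(dif (\<lambda>x. u x * ?c x) p)\<^sup>2 \<le> (dif u p)\<^sup>2" by (simp add: abs_le_square_iff)
    then have "near 0 p * (dif (\<lambda>x. u x * ?c x) p)\<^sup>2 \<le> 1 * (near 0 p * (dif u p)\<^sup>2)" by (simp add: mult_left_mono)
    also have "\<dots> \<le> (1 + \<theta>) * (near 0 p * (dif u p)\<^sup>2)" using \<theta> by (intro mult_right_mono) auto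
    finally show ?thesis using rest by linarith
  qed
qed

lemma approximable_bounded:
  assumes lip: "lipschitz_boundary \<Omega>" and u: "u \<in> Dom \<Omega> 0" and K: "\<And>x. \<bar>u x\<bar> \<le> K"
  shows "approximable u"
proof -
  have [measurable]: "u \<in> borel_measurable borel" using DomD(3)[OF u] .
  have uv: "AE x in lborel. x \<notin> \<Omega> \<longrightarrow> u x = 0" using DomD(2)[OF u] by (simp add: vanishes_off_def)
  let ?w = "sphere_area TYPE('a)"
  have w0: "0 \<le> ?w" using sphere_area_pos[where 'a='a] by simp
  obtain C \<delta>0 where C: "0 < \<delta>0" "0 \<le> C"
    "\<And>\<delta>. 0 < \<delta> \<Longrightarrow> \<delta> < \<delta>0 \<Longrightarrow> measure lborel {x\<in>\<Omega>. infdist x (- \<Omega>) < \<delta>} \<le> C * \<delta>"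
    using strip_measure[OF lip] by blast
  \<comment> \<open>The division by 4 leaves room for the strip of width
    \<open>2 * \<delta> n\<close> below \<open>\<delta>0\<close>.\<close>
  define \<delta> where "\<delta> n = \<delta>0 / 4 / real (Suc n)" for n
  have \<delta>: "0 < \<delta> n" "2 * \<delta> n < \<delta>0" for n
  proof -
    show "0 < \<delta> n" using C(1) by (simp add: \<delta>_def)
    have "\<delta> n \<le> \<delta>0 / 4 / 1" unfolding \<delta>_def using C(1) by (intro divide_left_mono) auto
    then show "2 * \<delta> n < \<delta>0" using C(1) by simp
  qed
  have \<delta>lim: "\<delta> \<longlonglongrightarrow> 0"
    using tendsto_mult_right_zero[OF LIMSEQ_Suc[OF lim_1_over_n], of "\<delta>0 / 4"] unfolding \<delta>_def by simp
  define v where "v n x = u x * cutoff (\<delta> n) x" for n x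
  have [measurable]: "v n \<in> borel_measurable borel" for n unfolding v_def by measurable
  have vle: "\<bar>v n x\<bar> \<le> \<bar>u x\<bar>" for n x unfolding v_def abs_mult using cutoff_range[of "\<delta> n" x] by (simp add: mult_right_le_one_le)
  have u2: "integrable lborel (\<lambda>x. (u x)\<^sup>2)" using DomD(1)[OF u] by (simp add: L2_def)
  have vL2: "v n \<in> L2" for n
  proof -
    have "integrable lborel (\<lambda>x. (v n x)\<^sup>2)"
      by (rule Bochner_Integration.integrable_bound[OF u2]) (use vle in \<open>auto simp: abs_le_square_iff\<close>)
    then show ?thesis by (simp add: L2_def)
  qed
  have vv: "vanishes_off \<Omega> (v n)" for n
    using uv unfolding vanishes_off_def by eventually_elim (simp add: v_def)
  \<comment> \<open>The factor \<open>1 / sqrt (\<delta> n)\<close> meets a strip of volume at most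
    \<open>2 * C * \<delta> n\<close> and the constant \<open>4 * ?w\<close>; what remains is of
    order \<open>sqrt (\<delta> n)\<close>.\<close>
  define R where "R \<theta> n = (1 + 1 / \<theta>) * K\<^sup>2 * (8 * ?w * C) * sqrt (\<delta> n)" for \<theta> n
  have energy: "(\<integral>\<^sup>+p. ennreal (near 0 p * (dif (v n) p)\<^sup>2) \<partial>lborel2) \<le> ennreal ((1 + \<theta>) * nearE 0 u u + R \<theta> n)"
    if \<theta>: "0 < \<theta>" for \<theta> n
  proof -
    let ?q = "(1 + 1 / \<theta>) * K\<^sup>2 / sqrt (\<delta> n)"
    have q: "0 \<le> ?q" using \<theta> \<delta>(1)[of n] by (intro divide_nonneg_nonneg mult_nonneg_nonneg) auto
    have "AE p in lborel2. ennreal (near 0 p * (dif (v n) p)\<^sup>2) \<le>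
        ennreal (1 + \<theta>) * ennreal (near 0 p * (dif u p)\<^sup>2) + ennreal ?q * ennreal (strip_fun (2 * \<delta> n) p)"
      using AE_pair_fst[OF uv]
    proof eventually_elim
      case (elim p)
      then have "near 0 p * (dif (v n) p)\<^sup>2 \<le> (1 + \<theta>) * (near 0 p * (dif u p)\<^sup>2) + ?q * strip_fun (2 * \<delta> n) p"
        unfolding v_def using cutoff_product_near_bound[OF \<delta>(1) \<theta>, of u K p n] K by blast
      then have "ennreal (near 0 p * (dif (v n) p)\<^sup>2) \<le> ennreal ((1 + \<theta>) * (near 0 p * (dif u p)\<^sup>2) + ?q * strip_fun (2 * \<delta> n) p)"
        by (rule ennreal_leI)
      also have "\<dots> = ennreal ((1 + \<theta>) * (near 0 p * (dif u p)\<^sup>2)) + ennreal (?q * strip_fun (2 * \<delta> n) p)"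
        using \<theta> q strip_fun_nonneg by (intro ennreal_plus mult_nonneg_nonneg) auto
      also have "\<dots> = ennreal (1 + \<theta>) * ennreal (near 0 p * (dif u p)\<^sup>2) + ennreal ?q * ennreal (strip_fun (2 * \<delta> n) p)"
        using \<theta> q by (simp only: ennreal_mult' add_nonneg_nonneg zero_le_one less_imp_le)
      finally show ?case .
    qed
    then have "(\<integral>\<^sup>+p. ennreal (near 0 p * (dif (v n) p)\<^sup>2) \<partial>lborel2) \<le>
      (\<integral>\<^sup>+p. ennreal (1 + \<theta>) * ennreal (near 0 p * (dif u p)\<^sup>2) + ennreal ?q * ennreal (strip_fun (2 * \<delta> n) p) \<partial>lborel2)"
      by (rule nn_integral_mono_AE)
    also have "\<dots> = ennreal (1 + \<theta>) * (\<integral>\<^sup>+p. ennreal (near 0 p * (dif u p)\<^sup>2) \<partial>lborel2) +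
        ennreal ?q * (\<integral>\<^sup>+p. ennreal (strip_fun (2 * \<delta> n) p) \<partial>lborel2)"
    proof -
      have [measurable]: "strip_fun d \<in> borel_measurable (borel \<Otimes>\<^sub>M borel)" for d
        unfolding strip_fun_def using strip_borel[of d] by measurable
      show ?thesis by (subst nn_integral_add) (auto simp: nn_integral_cmult)
    qed
    also have "\<dots> = ennreal (1 + \<theta>) * ennreal (nearE 0 u u) + ennreal ?q * ennreal (4 * ?w * measure lborel {x\<in>\<Omega>. infdist x (- \<Omega>) < 2 * \<delta> n})"
      by (simp only: nearE_eq_nn[OF u] strip_fun_nn_integral)
    also have "\<dots> = ennreal ((1 + \<theta>) * nearE 0 u u + ?q * (4 * ?w * measure lborel {x\<in>\<Omega>. infdist x (- \<Omega>) < 2 * \<delta> n}))"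
    proof -
      have 1: "ennreal (1 + \<theta>) * ennreal (nearE 0 u u) = ennreal ((1 + \<theta>) * nearE 0 u u)" using \<theta> by (intro ennreal_mult'[symmetric]) auto
      have 2: "ennreal ?q * ennreal (4 * ?w * measure lborel {x\<in>\<Omega>. infdist x (- \<Omega>) < 2 * \<delta> n}) = ennreal (?q * (4 * ?w * measure lborel {x\<in>\<Omega>. infdist x (- \<Omega>) < 2 * \<delta> n}))"
        using q by (rule ennreal_mult'[symmetric])
      show ?thesis unfolding 1 2
        by (intro ennreal_plus[symmetric] mult_nonneg_nonneg q w0 nearE_nonneg) (use \<theta> in auto)
    qed
    also have "\<dots> \<le> ennreal ((1 + \<theta>) * nearE 0 u u + ?q * (4 * ?w * (C * (2 * \<delta> n))))"
      using C(3)[of "2 * \<delta> n"] \<delta>[of n] q w0 by (intro ennreal_leI add_left_mono mult_left_mono) auto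
    also have "?q * (4 * ?w * (C * (2 * \<delta> n))) = R \<theta> n"
    proof -
      have "\<delta> n / sqrt (\<delta> n) = sqrt (\<delta> n)" using \<delta>(1)[of n] by (simp add: real_div_sqrt)
      moreover have "A / sqrt (\<delta> n) * (4 * ?w * (C * (2 * \<delta> n))) = A * (8 * ?w * C) * (\<delta> n / sqrt (\<delta> n))" for A by simp
      ultimately have "A / sqrt (\<delta> n) * (4 * ?w * (C * (2 * \<delta> n))) = A * (8 * ?w * C) * sqrt (\<delta> n)" for A by simp
      then show ?thesis unfolding R_def .
    qed
    finally show ?thesis .
  qed
  have R0: "0 \<le> R \<theta> n" if "0 < \<theta>" for \<theta> n
    unfolding R_def using that C(2) w0 \<delta>(1)[of n] by (intro mult_nonneg_nonneg) (auto simp: less_imp_le)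
  have vD: "v n \<in> Dom \<Omega> 0" and vE: "0 < \<theta> \<Longrightarrow> nearE 0 (v n) (v n) \<le> (1 + \<theta>) * nearE 0 u u + R \<theta> n" for n \<theta>
  proof -
    have *: "v n \<in> Dom \<Omega> 0 \<and> nearE 0 (v n) (v n) \<le> (1 + t) * nearE 0 u u + R t n" if "0 < t" for t
      using DomI_nn[OF vL2 vv energy[OF that]] R0[OF that, of n] nearE_nonneg[of 0 u] that by simp
    show "v n \<in> Dom \<Omega> 0" using *[of 1] by simp
    show "0 < \<theta> \<Longrightarrow> nearE 0 (v n) (v n) \<le> (1 + \<theta>) * nearE 0 u u + R \<theta> n" using * by blast
  qed
  show ?thesis
  proof (rule approximable_limit[OF u vD])
    show "approximable (v n)" for n
    proof (rule approximable_interior[OF vD \<delta>(1)[of n]])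
      fix x assume "v n x \<noteq> 0"
      then show "ball x (\<delta> n) \<subseteq> \<Omega>" using cutoff_interior[OF \<delta>(1)] by (simp add: v_def)
    qed
    show "L2_lim v u"
    proof -
      have "(\<lambda>n. \<integral>x. (v n x - u x)\<^sup>2 \<partial>lborel) \<longlonglongrightarrow> (\<integral>x. 0 \<partial>(lborel :: 'a measure))"
      proof (rule integral_dominated_convergence[where w="\<lambda>x. (u x)\<^sup>2"])
        show "AE x in lborel. (\<lambda>n. (v n x - u x)\<^sup>2) \<longlonglongrightarrow> 0" using uv
        proof eventually_elim
          case (elim x)
          show ?case
          proof (cases "x \<in> \<Omega>")
            case True
            then have "x \<notin> - \<Omega>" by simp
            then have d: "infdist x (- \<Omega>) > 0" using complement infdist_pos_not_in_closed by blast
            have "eventually (\<lambda>n. \<delta> n < infdist x (- \<Omega>) / 2) sequentially" using \<delta>lim d by (intro order_tendstoD(2)[of _ 0]) auto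
            then have "eventually (\<lambda>n. (v n x - u x)\<^sup>2 = 0) sequentially"
            proof eventually_elim
              case (elim n)
              then have "2 \<le> infdist x (- \<Omega>) / \<delta> n" using \<delta>(1)[of n] by (simp add: field_simps)
              then show ?case by (simp add: v_def cutoff_def)
            qed
            then show ?thesis by (rule tendsto_eventually)
          qed (use elim in \<open>simp add: v_def\<close>)
        qed
        show "AE x in lborel. norm ((v n x - u x)\<^sup>2) \<le> (u x)\<^sup>2" for n
        proof (rule AE_I2)
          fix x
          have "v n x - u x = - (u x * (1 - cutoff (\<delta> n) x))" by (simp add: v_def algebra_simps)
          then have "\<bar>v n x - u x\<bar> = \<bar>u x\<bar> * \<bar>1 - cutoff (\<delta> n) x\<bar>" by (simp add: abs_mult)
          also have "\<dots> \<le> \<bar>u x\<bar>" using cutoff_range[of "\<delta> n" x] by (intro mult_right_le_one_le) auto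
          finally show "norm ((v n x - u x)\<^sup>2) \<le> (u x)\<^sup>2" by (simp add: abs_le_square_iff)
        qed
      qed (use u2 in auto)
      then show ?thesis by (simp add: L2_lim_def ip_def power2_eq_square)
    qed
    fix \<epsilon> :: real assume \<epsilon>: "0 < \<epsilon>"
    \<comment> \<open>Half of \<open>\<epsilon>\<close> is spent on \<open>\<theta>\<close> times
      the energy of \<open>u\<close>, the other half on \<open>R \<theta> n\<close> with this
      \<open>\<theta>\<close> fixed; the summand one guards against zero energy.\<close>
    define \<theta> where "\<theta> = \<epsilon> / (2 * (nearE 0 u u + 1))"
    have E1: "nearE 0 u u + 1 > 0" using nearE_nonneg[of 0 u] by linarith
    have \<theta>: "0 < \<theta>" using \<epsilon> E1 by (simp add: \<theta>_def)
    have \<theta>E: "\<theta> * nearE 0 u u \<le> \<epsilon> / 2"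
    proof -
      have "\<theta> * nearE 0 u u \<le> \<theta> * (nearE 0 u u + 1)" using \<theta> by (intro mult_left_mono) auto
      also have "\<dots> = \<epsilon> / 2" unfolding \<theta>_def using E1 by (simp add: field_simps)
      finally show ?thesis .
    qed
    have "(\<lambda>n. sqrt (\<delta> n)) \<longlonglongrightarrow> 0" using tendsto_real_sqrt[OF \<delta>lim] by simp
    then have "(R \<theta>) \<longlonglongrightarrow> 0" unfolding R_def by (rule tendsto_mult_right_zero)
    then have "eventually (\<lambda>n. R \<theta> n < \<epsilon> / 2) sequentially" using \<epsilon> by (intro order_tendstoD(2)[of _ 0]) auto
    then show "eventually (\<lambda>n. nearE 0 (v n) (v n) \<le> nearE 0 u u + \<epsilon>) sequentially"
    proof eventually_elim
      case (elim n)
      have "(1 + \<theta>) * nearE 0 u u = nearE 0 u u + \<theta> * nearE 0 u u" by (simp add: algebra_simps)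
      then show ?case using vE[OF \<theta>, of n] \<theta>E elim by linarith
    qed
  qed
qed

text \<open>Clipping to \<open>[-n, n]\<close> contracts the real line, hence lowers every
  difference and the near energy, and reduces the claim to bounded functions.\<close>

theorem approximable_all:
  assumes lip: "lipschitz_boundary \<Omega>" and u: "u \<in> Dom \<Omega> 0"
  shows "approximable u"
proof -
  have [measurable]: "u \<in> borel_measurable borel" using DomD(3)[OF u] .
  have u2: "integrable lborel (\<lambda>x. (u x)\<^sup>2)" using DomD(1)[OF u] by (simp add: L2_def)
  define v where "v n x = max (- real n) (min (real n) (u x))" for n x
  have [measurable]: "v n \<in> borel_measurable borel" for n unfolding v_def by measurable
  have vle: "\<bar>v n x\<bar> \<le> \<bar>u x\<bar>" for n x by (auto simp: v_def max_def min_def)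
  have vL2: "v n \<in> L2" for n
  proof -
    have "integrable lborel (\<lambda>x. (v n x)\<^sup>2)"
      by (rule Bochner_Integration.integrable_bound[OF u2]) (use vle in \<open>auto simp: abs_le_square_iff\<close>)
    then show ?thesis by (simp add: L2_def)
  qed
  have vv: "vanishes_off \<Omega> (v n)" for n
    using DomD(2)[OF u] unfolding vanishes_off_def by eventually_elim (auto simp: v_def)
  have dle: "(dif (v n) p)\<^sup>2 \<le> (dif u p)\<^sup>2" for n p
  proof -
    have "\<bar>max (- c) (min c a) - max (- c) (min c b)\<bar> \<le> \<bar>a - b\<bar>" for a b c :: real by (auto simp: max_def min_def)
    then show ?thesis unfolding dif_def v_def by (simp add: abs_le_square_iff)
  qed
  have "(\<integral>\<^sup>+p. ennreal (near 0 p * (dif (v n) p)\<^sup>2) \<partial>lborel2) \<le> ennreal (nearE 0 u u)" for n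
    unfolding nearE_eq_nn[OF u] by (intro nn_integral_mono ennreal_leI mult_left_mono dle) auto
  then have vD: "v n \<in> Dom \<Omega> 0" "nearE 0 (v n) (v n) \<le> nearE 0 u u" for n
    using DomI_nn[OF vL2 vv] nearE_nonneg[of 0 u] by blast+
  show ?thesis
  proof (rule approximable_limit[OF u vD(1)])
    show "approximable (v n)" for n
      by (rule approximable_bounded[OF lip vD(1), of n "real n"]) (auto simp: v_def max_def min_def)
    show "eventually (\<lambda>n. nearE 0 (v n) (v n) \<le> nearE 0 u u + \<epsilon>) sequentially" if "0 < \<epsilon>" for \<epsilon>
      using vD(2) that by (intro always_eventually allI) (metis add_increasing2 less_imp_le)
    have "(\<lambda>n. \<integral>x. (v n x - u x)\<^sup>2 \<partial>lborel) \<longlonglongrightarrow> (\<integral>x. 0 \<partial>(lborel :: 'a measure))"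
    proof (rule integral_dominated_convergence[where w="\<lambda>x. (u x)\<^sup>2"])
      show "AE x in lborel. (\<lambda>n. (v n x - u x)\<^sup>2) \<longlonglongrightarrow> 0"
      proof (rule AE_I2)
        fix x
        obtain m :: nat where m: "\<bar>u x\<bar> \<le> real m" using real_arch_simple by blast
        have "eventually (\<lambda>n. (v n x - u x)\<^sup>2 = 0) sequentially"
          using eventually_ge_at_top[of m]
          by eventually_elim (use m in \<open>auto simp: v_def max_def min_def\<close>)
        then show "(\<lambda>n. (v n x - u x)\<^sup>2) \<longlonglongrightarrow> 0" by (rule tendsto_eventually)
      qed
      show "AE x in lborel. norm ((v n x - u x)\<^sup>2) \<le> (u x)\<^sup>2" for n
      proof (rule AE_I2)
        fix x
        have "\<bar>v n x - u x\<bar> \<le> \<bar>u x\<bar>" by (auto simp: v_def max_def min_def)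
        then show "norm ((v n x - u x)\<^sup>2) \<le> (u x)\<^sup>2" by (simp add: abs_le_square_iff)
      qed
    qed (use u2 in auto)
    then show "L2_lim v u" by (simp add: L2_lim_def ip_def power2_eq_square)
  qed
qed

text \<open>Approximation in near energy and in L2 is approximation in \<open>Qf 0\<close>, because
  the far part is continuous for L2 convergence.\<close>

lemma core_dense:
  assumes lip: "lipschitz_boundary \<Omega>" and u: "u \<in> Dom \<Omega> 0"
  shows "\<exists>v. (\<forall>n::nat. v n \<in> lip_core \<Omega>) \<and> L2_lim v u \<and> (\<lambda>n. on_diff (Qf 0) (v n) u) \<longlonglongrightarrow> 0"
proof -
  define good where "good n v \<longleftrightarrow> v \<in> lip_core \<Omega> \<and> on_diff ip v u < 1 / real (Suc n) \<and>
    on_diff (nearE 0) v u < 1 / real (Suc n)" for n v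
  have "\<exists>v. good n v" for n
  proof -
    have "0 < 1 / real (Suc n)" by simp
    then show ?thesis using approximable_all[OF lip u] unfolding approximable_def good_def by blast
  qed
  then obtain v where "\<And>n. good n (v n)" by metis
  then have v: "\<And>n. v n \<in> lip_core \<Omega>" "\<And>n. on_diff ip (v n) u < 1 / real (Suc n)"
    "\<And>n. on_diff (nearE 0) (v n) u < 1 / real (Suc n)" unfolding good_def by blast+
  have lim: "(\<lambda>n. 1 / real (Suc n)) \<longlonglongrightarrow> 0" by (rule LIMSEQ_Suc[OF lim_1_over_n])
  have L: "L2_lim v u" unfolding L2_lim_def
    by (rule tendsto_sandwich[of "\<lambda>_. 0", OF _ _ tendsto_const lim]) (use v(2) in \<open>auto simp: ip_nonneg intro!: always_eventually less_imp_le\<close>)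
  have N: "(\<lambda>n. on_diff (nearE 0) (v n) u) \<longlonglongrightarrow> 0"
    by (rule tendsto_sandwich[of "\<lambda>_. 0", OF _ _ tendsto_const lim]) (use v(3) in \<open>auto simp: nearE_nonneg intro!: always_eventually less_imp_le\<close>)
  have D: "(\<lambda>x. v n x - u x) \<in> Dom \<Omega> 0" for n
    using sym_form.diff[OF Qf_form[of 0], of "v n" u] lip_core_Dom[OF v(1), of 0] u by simp
  have F: "(\<lambda>n. farB 0 (\<lambda>x. v n x - u x) (\<lambda>x. v n x - u x)) \<longlonglongrightarrow> farB 0 (\<lambda>x::'a. 0) (\<lambda>x. 0)"
    by (rule farB_tendsto[of "\<lambda>_. 0" 0 "\<lambda>n x. v n x - u x" "\<lambda>x. 0"]) (use DomD[OF D] L in \<open>auto simp: L2_zero L2_lim_def\<close>)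
  have F: "(\<lambda>n. farB 0 (\<lambda>x. v n x - u x) (\<lambda>x. v n x - u x)) \<longlonglongrightarrow> 0" using F by (simp add: farB_def)
  have "(\<lambda>n. cfun TYPE('a) 0 / 2 * on_diff (nearE 0) (v n) u - cfun TYPE('a) 0 * farB 0 (\<lambda>x. v n x - u x) (\<lambda>x. v n x - u x)
     + rhof TYPE('a) 0 * on_diff ip (v n) u) \<longlonglongrightarrow> cfun TYPE('a) 0 / 2 * 0 - cfun TYPE('a) 0 * 0 + rhof TYPE('a) 0 * 0"
    using N F L unfolding L2_lim_def by (intro tendsto_intros)
  then have "(\<lambda>n. on_diff (Qf 0) (v n) u) \<longlonglongrightarrow> 0" by (simp add: Qf_def)
  then show ?thesis using v(1) L by blast
qed

end

section \<open>The theorem\<close>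

lemma (in bounded_open) gamma_family_Qf:
  assumes lip: "lipschitz_boundary \<Omega>" and ne: "\<Omega> \<noteq> {}"
  shows "\<exists>M. gamma_family (Dom \<Omega>) Qf (lip_core \<Omega>) M (1/2)"
proof -
  obtain c M where cM: "0 < c" "0 \<le> M"
    "\<And>s u. 0 \<le> s \<Longrightarrow> s \<le> 1/2 \<Longrightarrow> u \<in> Dom \<Omega> s \<Longrightarrow> c * nearE s u u \<le> Qf s u u + M * ip u u"
    using near_control by blast
  have "gamma_family (Dom \<Omega>) Qf (lip_core \<Omega>) M (1/2)"
  proof (rule gamma_family.intro)
    show "(0::real) < 1/2" by simp
    show "sym_form (Dom \<Omega> s) (Qf s)" if "0 \<le> s" "s < 1/2" for s using Qf_form that by blast
    show "Dom \<Omega> s \<subseteq> L2" if "0 \<le> s" "s < 1/2" for s using DomD(1) by blast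
    show "- M * ip f f \<le> Qf s f f" if "0 \<le> s" "s < 1/2" "f \<in> Dom \<Omega> s" for s f
    proof -
      have "0 \<le> c * nearE s f f" using cM(1) nearE_nonneg[of s f] by simp
      then show ?thesis using cM(3)[of s f] that by simp
    qed
    show "\<exists>r v. strict_mono r \<and> v \<in> L2 \<and> L2_lim (\<lambda>n. u (r n)) v"
      if \<sigma>: "\<And>n::nat. 0 \<le> \<sigma> n" "\<And>n. \<sigma> n < 1/2" and u: "\<And>n. u n \<in> Dom \<Omega> (\<sigma> n)" "\<And>n. ip (u n) (u n) = 1" "\<And>n. Qf (\<sigma> n) (u n) (u n) \<le> C"
      for \<sigma> u C
    proof (rule near_compact)
      show "u n \<in> Dom \<Omega> 0" for n using Dom_mono(1)[OF \<sigma>(1) u(1)] .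
      show "ip (u n) (u n) \<le> 1" for n using u(2) by simp
      show "nearE 0 (u n) (u n) \<le> (C + M) / c" for n
      proof -
        have "c * nearE (\<sigma> n) (u n) (u n) \<le> C + M" using cM(3)[OF \<sigma>(1) less_imp_le[OF \<sigma>(2)] u(1), of n] u(2,3)[of n] by simp
        then have "nearE (\<sigma> n) (u n) (u n) \<le> (C + M) / c" using cM(1) by (simp add: field_simps)
        then show ?thesis using Dom_mono(2)[OF \<sigma>(1) u(1), of n] by linarith
      qed
    qed
    show "v \<in> Dom \<Omega> t \<and> Qf t v v \<le> c'"
      if "\<And>n::nat. 0 \<le> \<sigma> n" "\<And>n. \<sigma> n < 1/2" "\<sigma> \<longlonglongrightarrow> t" "0 \<le> t" "t < 1/2"
        "\<And>n. u n \<in> Dom \<Omega> (\<sigma> n)" "v \<in> L2" "L2_lim u v" "(\<lambda>n. Qf (\<sigma> n) (u n) (u n)) \<longlonglongrightarrow> c'" for \<sigma> t u v c'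
      using Qf_lsc that by blast
    show "lip_core \<Omega> \<subseteq> Dom \<Omega> s" if "0 \<le> s" "s < 1/2" for s using lip_core_Dom that by auto
    show "\<exists>f. \<forall>i<k::nat. f i \<in> lip_core \<Omega> \<and> (\<forall>j<k. ip (f i) (f j) = (if i = j then 1 else 0))" for k
      using lip_core_infinite_dim[OF ne] .
    show "((\<lambda>s. Qf s f g) \<longlongrightarrow> Qf 0 f g) (at_right 0)" if "f \<in> lip_core \<Omega>" "g \<in> lip_core \<Omega>" for f g
      using Qf_core_tendsto that by blast
    show "\<exists>h. (\<forall>n::nat. h n \<in> lip_core \<Omega>) \<and> L2_lim h f \<and> (\<lambda>n. on_diff (Qf 0) (h n) f) \<longlonglongrightarrow> 0"
      if "f \<in> Dom \<Omega> 0" for f using core_dense[OF lip that] .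
  qed
  then show ?thesis ..
qed

section \<open>Translation of the two eigenvalue problems\<close>

lemma (in bounded_open) set_integral_eq_ip:
  assumes "u \<in> Dom \<Omega> s" "v \<in> Dom \<Omega> t"
  shows "(LINT x:\<Omega>|lborel. u x * v x) = ip u v"
proof -
  have [measurable]: "u \<in> borel_measurable borel" "v \<in> borel_measurable borel" using assms DomD(3) by auto
  have "AE x in lborel. indicator \<Omega> x *\<^sub>R (u x * v x) = u x * v x"
    using DomD(2)[OF assms(1)] unfolding vanishes_off_def by eventually_elim (auto simp: indicator_def)
  then show ?thesis unfolding set_lebesgue_integral_def ip_def by (intro integral_cong_AE) auto
qed

lemma (in bounded_open) frac_eigenpair_iff:
  assumes s: "0 < s"
  shows "frac_eigenpair s \<Omega> \<phi> lam \<longleftrightarrow> eigenpair (Dom \<Omega> s) (Qf s) \<phi> ((lam - 1) / s)"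
proof -
  have "Es s \<phi> v = lam * (LINT x:\<Omega>|lborel. \<phi> x * v x) \<longleftrightarrow> Qf s \<phi> v = (lam - 1) / s * ip \<phi> v"
    if "\<phi> \<in> Dom \<Omega> s" "v \<in> Dom \<Omega> s" for v
    unfolding set_integral_eq_ip[OF that] Es_eq_Qf[OF s that Dom_integrable[OF that(1)] Dom_integrable[OF that(2)]]
    using s by (auto simp: field_simps)
  then show ?thesis unfolding frac_eigenpair_def eigenpair_def Hs0_eq_Dom[OF s] by blast
qed

lemma (in bounded_open) log_eigenpair_iff:
  "log_eigenpair \<Omega> \<phi> lam \<longleftrightarrow> eigenpair (Dom \<Omega> 0) (Qf 0) \<phi> lam"
  unfolding log_eigenpair_def eigenpair_def H00_eq_Dom EL_eq_Qf using set_integral_eq_ip by metis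

theorem theorem2p10:
  fixes \<Omega> :: "'a::euclidean_space set" and k :: nat
  assumes "open \<Omega>" and "\<Omega> \<noteq> {}" and "bounded \<Omega>" and "lipschitz_boundary \<Omega>" and "k \<ge> 1"
  shows "((\<lambda>s. (lambda_ks k s \<Omega> - 1) / s) \<longlongrightarrow> lambda_kL k \<Omega>) (at_right 0) \<and>
         (\<forall>(sn :: nat \<Rightarrow> real) (\<phi>n :: nat \<Rightarrow> 'a \<Rightarrow> real).
           (\<forall>n. 0 < sn n \<and> sn n < 1) \<longrightarrow> sn \<longlonglongrightarrow> 0 \<longrightarrow>
           (\<forall>n. frac_eigenpair (sn n) \<Omega> (\<phi>n n) (lambda_ks k (sn n) \<Omega>) \<and>
                (\<integral>x. (\<phi>n n x)\<^sup>2 \<partial>lborel) = 1) \<longrightarrow>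
           (\<exists>r \<phi>. strict_mono r \<and> log_eigenpair \<Omega> \<phi> (lambda_kL k \<Omega>) \<and>
                 (\<integral>x. (\<phi> x)\<^sup>2 \<partial>lborel) = 1 \<and>
                 (\<lambda>n. LINT x:\<Omega>|lborel. (\<phi>n (r n) x - \<phi> x)\<^sup>2) \<longlonglongrightarrow> 0))"
proof -
  interpret bounded_open \<Omega> using assms by unfold_locales
  obtain M where "gamma_family (Dom \<Omega>) Qf (lip_core \<Omega>) M (1/2)"
    using gamma_family_Qf assms by blast
  then interpret gamma_family "Dom \<Omega>" Qf "lip_core \<Omega>" M "1/2" .
  \<comment> \<open>The statement counts eigenvalues from one, \<open>ev\<close> from zero.\<close>
  obtain j where k: "k = Suc j" using assms(5) by (cases k) auto
  have L: "lambda_kL k \<Omega> = ev j 0"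
    unfolding lambda_kL_def ev_def k by (rule arg_cong[where f="\<lambda>P. kth_eigenvalue P (Suc j)"]) (auto simp: fun_eq_iff log_eigenpair_iff)
  have S: "lambda_ks k s \<Omega> = 1 + s * ev j s" if s: "0 < s" "s < 1/2" for s
  proof -
    interpret F: spectral_form "Dom \<Omega> s" "Qf s" M using spectral s by simp
    obtain e \<mu> where E: "eigen_family (Dom \<Omega> s) (Qf s) (Suc j) e \<mu>" using F.eigen_family_exists by blast
    have "kth_eigenvalue (frac_eigenpair s \<Omega>) (Suc j) = 1 + s * \<mu> j"
      by (rule F.kth_eigenvalue_eq[OF E s(1)]) (simp add: frac_eigenpair_iff[OF s(1)] eigenpair_def)
    then show ?thesis using ev_eq[OF _ s(2) E] s unfolding lambda_ks_def k by simp
  qed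
  have ip2: "(\<integral>x. (f x)\<^sup>2 \<partial>lborel) = ip f f" for f :: "'a \<Rightarrow> real" by (simp add: ip_def power2_eq_square)
  show ?thesis
  proof (intro conjI allI impI)
    have "eventually (\<lambda>s. ev j s = (lambda_ks k s \<Omega> - 1) / s) (at_right 0)"
      by (rule eventually_at_rightI[of 0 "1/2"]) (auto simp: S)
    then show "((\<lambda>s. (lambda_ks k s \<Omega> - 1) / s) \<longlongrightarrow> lambda_kL k \<Omega>) (at_right 0)"
      unfolding L by (rule Lim_transform_eventually[OF ev_tendsto])
  next
    fix sn :: "nat \<Rightarrow> real" and \<phi>n :: "nat \<Rightarrow> 'a \<Rightarrow> real"
    assume sn: "\<forall>n. 0 < sn n \<and> sn n < 1" "sn \<longlonglongrightarrow> 0"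
      and \<phi>: "\<forall>n. frac_eigenpair (sn n) \<Omega> (\<phi>n n) (lambda_ks k (sn n) \<Omega>) \<and> (\<integral>x. (\<phi>n n x)\<^sup>2 \<partial>lborel) = 1"
    have "eventually (\<lambda>n. sn n < 1/2) sequentially" using sn(2) by (intro order_tendstoD(2)[of _ 0]) auto
    then obtain m where m: "\<And>n. n \<ge> m \<Longrightarrow> sn n < 1/2" by (auto simp: eventually_sequentially)
    \<comment> \<open>The given parameters may exceed 1/2 finitely often; the first \<open>m\<close>
      terms are dropped, and the final subsequence is \<open>r n + m\<close>.\<close>
    define \<sigma> where "\<sigma> n = sn (n + m)" for n
    have \<sigma>: "0 < \<sigma> n" "\<sigma> n < 1/2" for n using sn(1) m by (auto simp: \<sigma>_def)
    have \<sigma>lim: "\<sigma> \<longlonglongrightarrow> 0" unfolding \<sigma>_def using sn(2) by (rule LIMSEQ_ignore_initial_segment)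
    have eig: "eigenpair (Dom \<Omega> (\<sigma> n)) (Qf (\<sigma> n)) (\<phi>n (n + m)) (ev j (\<sigma> n))" for n
    proof -
      have "eigenpair (Dom \<Omega> (\<sigma> n)) (Qf (\<sigma> n)) (\<phi>n (n + m)) ((lambda_ks k (\<sigma> n) \<Omega> - 1) / \<sigma> n)"
        using \<phi> frac_eigenpair_iff[OF \<sigma>(1)] unfolding \<sigma>_def by blast
      then show ?thesis using S[OF \<sigma>, of n] \<sigma>(1)[of n] by simp
    qed
    have nrm: "ip (\<phi>n (n + m)) (\<phi>n (n + m)) = 1" for n using \<phi> by (simp add: ip2)
    obtain r v where r: "strict_mono r" "eigenpair (Dom \<Omega> 0) (Qf 0) v (ev j 0)" "ip v v = 1" "L2_lim (\<lambda>n. \<phi>n (r n + m)) v"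
      using eigenfunctions_subconverge[OF \<sigma> \<sigma>lim eig nrm] by blast
    have D: "\<phi>n (r n + m) \<in> Dom \<Omega> 0" "v \<in> Dom \<Omega> 0" for n
    proof -
      have "0 \<le> \<sigma> (r n)" using \<sigma>(1)[of "r n"] by simp
      then show "\<phi>n (r n + m) \<in> Dom \<Omega> 0" using eig[of "r n"] Dom_mono(1) unfolding eigenpair_def by blast
      show "v \<in> Dom \<Omega> 0" using r(2) by (simp add: eigenpair_def)
    qed
    have "(LINT x:\<Omega>|lborel. (\<phi>n (r n + m) x - v x)\<^sup>2) = ip (\<lambda>x. \<phi>n (r n + m) x - v x) (\<lambda>x. \<phi>n (r n + m) x - v x)" for n
      unfolding power2_eq_square using D sym_form.diff[OF Qf_form[of 0]] by (intro set_integral_eq_ip[of _ 0 _ 0]) auto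
    then have "(\<lambda>n. LINT x:\<Omega>|lborel. (\<phi>n (r n + m) x - v x)\<^sup>2) \<longlonglongrightarrow> 0" using r(4) by (simp add: L2_lim_def)
    moreover have "strict_mono (\<lambda>n. r n + m)" using r(1) by (simp add: strict_mono_def)
    moreover have "log_eigenpair \<Omega> v (lambda_kL k \<Omega>)" unfolding L log_eigenpair_iff by (rule r(2))
    moreover have "(\<integral>x. (v x)\<^sup>2 \<partial>lborel) = 1" unfolding ip2 by (rule r(3))
    ultimately show "\<exists>r \<phi>. strict_mono r \<and> log_eigenpair \<Omega> \<phi> (lambda_kL k \<Omega>) \<and> (\<integral>x. (\<phi> x)\<^sup>2 \<partial>lborel) = 1 \<and>
        (\<lambda>n. LINT x:\<Omega>|lborel. (\<phi>n (r n) x - \<phi> x)\<^sup>2) \<longlonglongrightarrow> 0"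
      by (intro exI[of _ "\<lambda>n. r n + m"] exI[of _ v] conjI)
  qed
qed

end
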